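(* The map $\mathbb{k}\mapsto \mu_{\mathbb{k}}$ is a homeomorphism between $\Delta$ and the space $\mathcal{P}_{\mathrm{erg}}(\mathrm{Mat}(\mathbb{N},F))$ of ergodic $\mathrm{GL}(\infty,\mathcal{O}_F)\times\mathrm{GL}(\infty,\mathcal{O}_F)$-invariant Borel probability measures on $\mathrm{Mat}(\mathbb{N},F)$ (endowed with the topology of weak convergence).
   Context: $F$ is a non-discrete locally compact non-Archimedean field with absolute value $|\cdot|$; $\mathcal{O}_F=\{x\in F:|x|\le 1\}$ is its ring of integers; $\varpi$ is a fixed generator of the maximal ideal $\{x\in F: |x|<1\}$; $q=\#(\mathcal{O}_F/\varpi\mathcal{O}_F)$, and $|\varpi|=q^{-1}$. Convention: $\varpi^{\infty}=0$. $\mathrm{GL}(\infty,\mathcal{O}_F)=\varinjlim \mathrm{GL}(n,\mathcal{O}_F)$ (via $a\mapsto \begin{pmatrix}a&0\\0&1\end{pmatrix}$) is the group of infinite invertible matrices $g=(g_{ij})_{i,j\in\mathbb{N}}$ over $\mathcal{O}_F$ with $g_{ij}=\delta_{ij}$ for $i+j$ large. $\mathrm{Mat}(\mathbb{N},F)$ is the space of all infinite matrices $(X_{ij})_{i,j\in\mathbb{N}}$ with $X_{ij}\in F$ (product topology). The group $\mathrm{GL}(\infty,\mathcal{O}_F)\times \mathrm{GL}(\infty,\mathcal{O}_F)$ acts on it by $((g_1,g_2),M)\mapsto g_1Mg_2^{-1}$. An invariant Borel probability measure is ergodic if every invariant Borel set has measure $0$ or $1$. $\Delta=\{\mathbb{k}=(k_j)_{j=1}^\infty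 : k_j\in\mathbb{Z}\cup\{-\infty\},\ k_1\ge k_2\ge\cdots\}$, with the topology induced from the product topology on $(\mathbb{Z}\cup\{-\infty\})^{\mathbb{N}}$, where $\mathbb{Z}\cup\{-\infty\}$ carries the order topology (integers are isolated points; a sequence of integers tending to $-\infty$ converges to the point $-\infty$). Definition of $\mu_{\mathbb{k}}$: let $X_i^{(n)},Y_i^{(n)},Z_{ij}$ $(i,j,n=1,2,\dots)$ be independent random variables, each distributed according to the normalized Haar measure on $\mathcal{O}_F$. For $\mathbb{k}=(k_n)_{n\in\mathbb{N}}\in\Delta$ let $k=\lim_{n\to\infty}k_n\in\mathbb{Z}\cup\{-\infty\}$ and $$M_{\mathbb{k}}=\Big[\sum_{n:\,k_n>k}\varpi^{-k_n}X_i^{(n)}Y_j^{(n)}+\varpi^{-k}Z_{ij}\Big]_{i,j\in\mathbb{N}}.$$ Then $\mu_{\mathbb{k}}$ is the probability distribution of $M_{\mathbb{k}}$. *)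

theory Defs
  imports "HOL-Probability.Probability"
begin

section \<open>Non-discrete locally compact non-Archimedean fields\<close>

text \<open>The topology is that of the metric \<open>abs_val (x - y)\<close>, which also forces \<open>abs_val\<close> to be
  nonnegative and to vanish exactly at \<open>0\<close>. A separate constant is needed because \<^const>\<open>norm\<close>
  is constrained to real vector spaces. \<^class>\<open>perfect_space\<close> says that the topology is not
  discrete.\<close>

class nonarch_local_field = field + metric_space + perfect_space +
  fixes abs_val :: "'a \<Rightarrow> real"
  assumes dist_abs_val: "dist x y = abs_val (x - y)"
    and abs_val_mult: "abs_val (x * y) = abs_val x * abs_val y"
    and abs_val_ultrametric: "abs_val (x + y) \<le> max (abs_val x) (abs_val y)"
    and locally_compact: "\<exists>U K. open U \<and> x \<in> U \<and> U \<subseteq> K \<and> compact K"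

definition ring_of_integers :: "'a::nonarch_local_field set" where
  "ring_of_integers = {x. abs_val x \<le> 1}"

definition uniformizer :: "'a::nonarch_local_field \<Rightarrow> bool" where
  "uniformizer \<pi> \<longleftrightarrow> {x. abs_val x < 1} = (\<lambda>y. \<pi> * y) ` ring_of_integers"

definition residue_card :: "'a::nonarch_local_field \<Rightarrow> nat" where
  "residue_card \<pi> = card (ring_of_integers //
     {(x, y). x \<in> ring_of_integers \<and> y \<in> ring_of_integers \<and>
              x - y \<in> (\<lambda>z. \<pi> * z) ` ring_of_integers})"

definition haar_integers :: "'a::nonarch_local_field measure" where
  "haar_integers = (THE \<mu>. prob_space \<mu> \<and> sets \<mu> = sets (restrict_space borel ring_of_integers) \<and>
     (\<forall>a\<in>ring_of_integers. distr \<mu> \<mu> (\<lambda>x. a + x) = \<mu>))"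


section \<open>The parameter space\<close>

text \<open>Integers with a least element \<open>-\<infinity>\<close> adjoined, carrying the order topology.\<close>

datatype int_minf = MInfty | Fin int

instantiation int_minf :: linorder
begin

fun less_eq_int_minf :: "int_minf \<Rightarrow> int_minf \<Rightarrow> bool" where
  "less_eq_int_minf MInfty _ = True"
| "less_eq_int_minf (Fin _) MInfty = False"
| "less_eq_int_minf (Fin a) (Fin b) = (a \<le> b)"

definition less_int_minf :: "int_minf \<Rightarrow> int_minf \<Rightarrow> bool" where
  "less_int_minf x y \<longleftrightarrow> x \<le> y \<and> \<not> y \<le> x"

instance
proof
  fix x y z :: int_minf
  show "x < y \<longleftrightarrow> x \<le> y \<and> \<not> y \<le> x" by (simp add: less_int_minf_def)
  show "x \<le> x" by (cases x) auto
  show "x \<le> y \<Longrightarrow> y \<le> z \<Longrightarrow> x \<le> z" by (cases x; cases y; cases z) auto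
  show "x \<le> y \<Longrightarrow> y \<le> x \<Longrightarrow> x = y" by (cases x; cases y) auto
  show "x \<le> y \<or> y \<le> x" by (cases x; cases y) auto
qed

end

instantiation int_minf :: linorder_topology
begin

definition open_int_minf :: "int_minf set \<Rightarrow> bool" where
  "open_int_minf = generate_topology (range (\<lambda>a. {..<a}) \<union> range (\<lambda>a. {a<..}))"

instance
  by standard (rule open_int_minf_def)

end

text \<open>Sequences are indexed from \<open>0\<close>; the function type carries the product topology.\<close>

definition Delta :: "(nat \<Rightarrow> int_minf) set" where
  "Delta = {k. decseq k}"


section \<open>Infinite matrices and the group action\<close>

type_synonym 'a inf_matrix = "nat \<Rightarrow> nat \<Rightarrow> 'a"

definition inf_id :: "'a::nonarch_local_field inf_matrix" where
  "inf_id i j = (if i = j then 1 else 0)"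

text \<open>The sum ranges over the nonzero terms only; there are finitely many of them whenever one of
  the factors agrees with the identity outside of a finite block.\<close>

definition inf_mult ::
    "'a::nonarch_local_field inf_matrix \<Rightarrow> 'a inf_matrix \<Rightarrow> 'a inf_matrix" where
  "inf_mult A B i j = (\<Sum>l | A i l * B l j \<noteq> 0. A i l * B l j)"

definition finitary_integral :: "'a::nonarch_local_field inf_matrix set" where
  "finitary_integral = {g. (\<forall>i j. g i j \<in> ring_of_integers) \<and>
     (\<exists>N. \<forall>i j. i + j \<ge> N \<longrightarrow> g i j = inf_id i j)}"

definition GL_inf :: "'a::nonarch_local_field inf_matrix set" where
  "GL_inf = {g \<in> finitary_integral.
     \<exists>h\<in>finitary_integral. inf_mult g h = inf_id \<and> inf_mult h g = inf_id}"

definition GL_inv :: "'a::nonarch_local_field inf_matrix \<Rightarrow> 'a inf_matrix" where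
  "GL_inv g = (THE h. h \<in> GL_inf \<and> inf_mult g h = inf_id \<and> inf_mult h g = inf_id)"

definition GL_act :: "'a::nonarch_local_field inf_matrix \<Rightarrow> 'a inf_matrix \<Rightarrow>
    'a inf_matrix \<Rightarrow> 'a inf_matrix" where
  "GL_act g1 g2 M = inf_mult (inf_mult g1 M) (GL_inv g2)"


section \<open>Ergodic invariant measures and weak convergence\<close>

definition borel_probs :: "'b::topological_space measure set" where
  "borel_probs = {\<mu>. sets \<mu> = sets borel \<and> prob_space \<mu>}"

definition GL_invariant :: "'a::nonarch_local_field inf_matrix measure \<Rightarrow> bool" where
  "GL_invariant \<mu> \<longleftrightarrow> (\<forall>g1\<in>GL_inf. \<forall>g2\<in>GL_inf. distr \<mu> borel (GL_act g1 g2) = \<mu>)"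

definition GL_invariant_set :: "'a::nonarch_local_field inf_matrix set \<Rightarrow> bool" where
  "GL_invariant_set A \<longleftrightarrow> (\<forall>g1\<in>GL_inf. \<forall>g2\<in>GL_inf. GL_act g1 g2 ` A = A)"

definition P_erg :: "'a::nonarch_local_field inf_matrix measure set" where
  "P_erg = {\<mu> \<in> borel_probs. GL_invariant \<mu> \<and>
     (\<forall>A\<in>sets borel. GL_invariant_set A \<longrightarrow> measure \<mu> A = 0 \<or> measure \<mu> A = 1)}"

text \<open>The coarsest topology on the Borel probability measures for which integration against every
  bounded continuous real function is continuous.\<close>

definition weak_topology :: "'b::topological_space measure topology" where
  "weak_topology = topology_generated_by
     {{\<mu> \<in> borel_probs. (\<integral>x. f x \<partial>\<mu>) \<in> U} | (f :: 'b \<Rightarrow> real) U.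
        continuous_on UNIV f \<and> bounded (range f) \<and> open U}"


section \<open>The measures \<open>\<mu>\<^sub>k\<close>\<close>

text \<open>Labels of the independent random variables: \<open>XVar n i\<close>, \<open>YVar n i\<close>, \<open>ZVar i j\<close> stand for
  \<open>X\<^sub>i\<^sup>(\<^sup>n\<^sup>)\<close>, \<open>Y\<^sub>i\<^sup>(\<^sup>n\<^sup>)\<close>, \<open>Z\<^sub>i\<^sub>j\<close>. They are realised as the
  coordinates of the product of copies of the normalised Haar measure.\<close>

datatype var_label = XVar nat nat | YVar nat nat | ZVar nat nat

definition var_space :: "(var_label \<Rightarrow> 'a::nonarch_local_field) measure" where
  "var_space = (\<Pi>\<^sub>M v\<in>UNIV. haar_integers)"

text \<open>\<open>\<pi>\<^sup>-\<^sup>m\<close> with the convention \<open>\<pi>\<^sup>\<infinity> = 0\<close>.\<close>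

fun neg_power :: "'a::nonarch_local_field \<Rightarrow> int_minf \<Rightarrow> 'a" where
  "neg_power \<pi> MInfty = 0"
| "neg_power \<pi> (Fin m) = \<pi> powi (- m)"

definition random_matrix :: "'a::nonarch_local_field \<Rightarrow> (nat \<Rightarrow> int_minf) \<Rightarrow>
    (var_label \<Rightarrow> 'a) \<Rightarrow> 'a inf_matrix" where
  "random_matrix \<pi> k \<omega> i j =
     (\<Sum>n. if k n > lim k then neg_power \<pi> (k n) * \<omega> (XVar n i) * \<omega> (YVar n j) else 0)
     + neg_power \<pi> (lim k) * \<omega> (ZVar i j)"

definition mu :: "'a::nonarch_local_field \<Rightarrow> (nat \<Rightarrow> int_minf) \<Rightarrow> 'a inf_matrix measure" where
  "mu \<pi> k = distr var_space borel (random_matrix \<pi> k)"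

end

theory Submission
  imports Defs
begin

text \<open>No Fourier analysis is used. Conditionally on the variables \<open>X\<close>, an entry of the random matrix
  is uniform on a ball of radius \<open>q\<^sup>R\<close>. The probabilities of two balls determine the chance that
  \<open>R \<le> l\<close>, which is the product of the \<open>q\<close>-powers with exponents \<open>- max (k n - l) 0\<close>; the ratios of
  consecutive values of this function of \<open>l\<close> recover \<open>k\<close>. This gives injectivity and the continuity of
  the inverse. A product of Haar distributed rectangular matrices with many inner indices is exactly
  Haar distributed outside an event of small probability, so modifying \<open>k\<close> far out changes the law of a
  corner little; this gives continuity. The measures are ergodic by the Hewitt-Savage argument, since
  disjoint diagonal blocks of the random matrix are independent.

  Conversely, averaging a function over the orbits of the group of level \<open>N\<close> can be done, up to a small
  error, with Haar distributed rectangular matrices in place of group elements. By the Smith normal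
  form such an average is an integral against one of the measures \<open>mu \<pi> k\<close>. For an ergodic measure the
  averages converge in \<open>L\<^sup>2\<close> to a constant, so the measure is a limit of measures \<open>mu \<pi> k\<close>; the ball
  probabilities keep \<open>k\<close> in a compact set, and continuity finishes the proof.\<close>

section \<open>Non-Archimedean local fields\<close>

text \<open>The distributional identities for products and group actions rest on one principle: an
  additive surjection between powers of the ring of integers carries Haar measure to Haar measure
  (\<open>distr_haar_pow_surj\<close>). It takes the place of Haar measure on the groups of level
  \<open>N\<close>, which is never constructed; only the probability that a rectangular Haar matrix
  has no invertible completion must be estimated. Two obstacles shape the rest. The space of
  matrices is not locally compact, so compactness is sought among the parameters: if
  \<open>k 0\<close> exceeds \<open>l\<close>, then \<open>phi (mu \<pi> k) l\<close> is at most
  \<open>1 / 2\<close>, whereas \<open>phi \<mu> l\<close> exceeds \<open>1 / 2\<close> for large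
  \<open>l\<close> and any probability measure. And the formula for the random matrix jumps where a
  sequence with constant tail \<open>c\<close> is approximated by sequences that fall below
  \<open>c\<close> very late; comparing the block \<open>Z\<close> with a long sum of products
  \<open>X Y\<close> bridges this jump. The number \<open>2 / 3\<close> in the recovery of
  \<open>k\<close> is any constant strictly between \<open>1 / 2\<close> and \<open>1\<close>:
  powers of \<open>1 / q\<close> are at least a factor \<open>2\<close> apart, so it turns
  equalities between powers into strict inequalities, that is, into open conditions.\<close>

lemma abs_val_conv_dist: "abs_val (x::'a::nonarch_local_field) = dist x 0"
  by (simp add: dist_abs_val)

lemma abs_val_nonneg [simp]: "0 \<le> abs_val (x::'a::nonarch_local_field)"
  by (simp add: abs_val_conv_dist)

lemma abs_val_eq_0 [simp]: "abs_val (x::'a::nonarch_local_field) = 0 \<longleftrightarrow> x = 0"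
  by (simp add: abs_val_conv_dist)

lemma abs_val_pos [simp]: "0 < abs_val (x::'a::nonarch_local_field) \<longleftrightarrow> x \<noteq> 0"
  by (simp add: abs_val_conv_dist)

lemma abs_val_0 [simp]: "abs_val (0::'a::nonarch_local_field) = 0"
  by simp

lemma abs_val_1 [simp]: "abs_val (1::'a::nonarch_local_field) = 1"
  using abs_val_mult[of "1::'a" 1] by simp

lemma abs_val_minus [simp]: "abs_val (- x) = abs_val (x::'a::nonarch_local_field)"
  using dist_commute[of x 0] by (simp add: dist_abs_val)

lemma abs_val_minus_commute: "abs_val (x - y) = abs_val (y - x::'a::nonarch_local_field)"
  using abs_val_minus[of "x - y"] by simp

lemma abs_val_power: "abs_val (x ^ n) = abs_val (x::'a::nonarch_local_field) ^ n"
  by (induction n) (simp_all add: abs_val_mult)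

lemma abs_val_inverse: "abs_val (inverse x) = inverse (abs_val (x::'a::nonarch_local_field))"
proof (cases "x = 0")
  case False
  then have "abs_val (inverse x) * abs_val x = 1"
    by (simp flip: abs_val_mult)
  then show ?thesis
    by (metis inverse_unique mult.commute)
qed simp

lemma abs_val_divide: "abs_val (x / y) = abs_val x / abs_val (y::'a::nonarch_local_field)"
  by (simp add: divide_inverse abs_val_mult abs_val_inverse)

lemma abs_val_power_int: "abs_val (x powi n) = abs_val (x::'a::nonarch_local_field) powi n"
  by (simp add: power_int_def abs_val_power abs_val_inverse)

lemma abs_val_add_le:
  "abs_val x \<le> r \<Longrightarrow> abs_val y \<le> r \<Longrightarrow> abs_val (x + y::'a::nonarch_local_field) \<le> r"
  using abs_val_ultrametric[of x y] by linarith

lemma abs_val_add_less: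
  "abs_val x < r \<Longrightarrow> abs_val y < r \<Longrightarrow> abs_val (x + y::'a::nonarch_local_field) < r"
  using abs_val_ultrametric[of x y] by linarith

lemma abs_val_diff_le:
  "abs_val x \<le> r \<Longrightarrow> abs_val y \<le> r \<Longrightarrow> abs_val (x - y::'a::nonarch_local_field) \<le> r"
  using abs_val_add_le[of x r "- y"] by simp

lemma abs_val_sum_le:
  fixes f :: "'b \<Rightarrow> 'a::nonarch_local_field"
  assumes "\<And>i. i \<in> A \<Longrightarrow> abs_val (f i) \<le> r" "0 \<le> r"
  shows "abs_val (sum f A) \<le> r"
  using assms by (induction A rule: infinite_finite_induct) (auto intro: abs_val_add_le)

text \<open>Applying the ultrametric inequality to \<open>y = (x + y) - x\<close> shows that the
  larger of two different absolute values cannot be cancelled.\<close>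

lemma abs_val_add_eq:
  fixes x y :: "'a::nonarch_local_field"
  assumes "abs_val x < abs_val y"
  shows "abs_val (x + y) = abs_val y"
proof (rule antisym)
  show "abs_val (x + y) \<le> abs_val y"
    using assms by (intro abs_val_add_le) auto
  have "abs_val (x + y + - x) \<le> max (abs_val (x + y)) (abs_val (- x))"
    by (rule abs_val_ultrametric)
  then show "abs_val y \<le> abs_val (x + y)"
    using assms by (auto simp: max_def split: if_splits)
qed

instance nonarch_local_field \<subseteq> topological_ab_group_add
proof
  fix a b :: 'a
  show "((\<lambda>x. fst x + snd x) \<longlongrightarrow> a + b) (nhds a \<times>\<^sub>F nhds b)"
  proof (rule tendstoI)
    fix e :: real assume e: "0 < e"
    have "dist (x + y) (a + b) < e" if "dist x a < e" "dist y b < e" for x y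
      using that abs_val_add_less[of "x - a" e "y - b"] by (simp add: dist_abs_val algebra_simps)
    moreover have "\<forall>\<^sub>F x in nhds a. dist x a < e" "\<forall>\<^sub>F x in nhds b. dist x b < e"
      using e by (auto simp: eventually_nhds_metric)
    ultimately show "\<forall>\<^sub>F x in nhds a \<times>\<^sub>F nhds b. dist (fst x + snd x) (a + b) < e"
      unfolding eventually_prod_filter by fastforce
  qed
  show "(uminus \<longlongrightarrow> - a) (nhds a)"
  proof (rule tendstoI)
    fix e :: real assume e: "0 < e"
    have "dist (- x) (- a) = dist x a" for x
      using abs_val_minus_commute[of x a] by (simp add: dist_abs_val)
    then show "\<forall>\<^sub>F x in nhds a. dist (- x) (- a) < e"
      using e by (auto simp: eventually_nhds_metric)
  qed
qed

instance nonarch_local_field \<subseteq> topological_semigroup_mult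
proof
  fix a b :: 'a
  show "((\<lambda>x. fst x * snd x) \<longlongrightarrow> a * b) (nhds a \<times>\<^sub>F nhds b)"
  proof (rule tendstoI)
    fix e :: real assume e: "0 < e"
    \<comment> \<open>In \<open>x * y - a * b = (x - a) * (y - b) + (y - b) * a + (x - a) *
      b\<close> the cap at \<open>1\<close> controls the quadratic term, so that each of the three
      terms is less than \<open>d\<close> times a factor at most
      \<open>1 + abs_val a + abs_val b\<close>.\<close>
    define d where "d = min 1 (e / (1 + abs_val a + abs_val b))"
    have s: "0 < 1 + abs_val a + abs_val b"
      by (smt (verit) abs_val_nonneg)
    have d: "0 < d" "d \<le> 1" "d * (1 + abs_val a + abs_val b) \<le> e"
      using e s mult_right_mono[of d "e / (1 + abs_val a + abs_val b)" "1 + abs_val a + abs_val b"]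
      by (auto simp: d_def)
    have *: "abs_val z * c < e" if "abs_val z < d" "0 \<le> c" "c \<le> 1 + abs_val a + abs_val b" for z :: 'a and c
    proof -
      have "abs_val z * c \<le> abs_val z * (1 + abs_val a + abs_val b)"
        using that by (intro mult_left_mono) auto
      also have "\<dots> < d * (1 + abs_val a + abs_val b)"
        using that s by (intro mult_strict_right_mono) auto
      finally show ?thesis using d by simp
    qed
    have "dist (x * y) (a * b) < e" if "dist x a < d" "dist y b < d" for x y
    proof -
      have x: "abs_val (x - a) < d" and y: "abs_val (y - b) < d"
        using that by (auto simp: dist_abs_val)
      have "abs_val ((x - a) * (y - b)) < e"
        using *[OF x, of "abs_val (y - b)"] y d abs_val_nonneg[of a] abs_val_nonneg[of b]
        by (simp add: abs_val_mult)
      moreover have "abs_val ((y - b) * a) < e" "abs_val ((x - a) * b) < e"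
        using *[OF x, of "abs_val b"] *[OF y, of "abs_val a"] abs_val_nonneg[of a] abs_val_nonneg[of b]
        by (simp_all add: abs_val_mult)
      ultimately have "abs_val ((x - a) * (y - b) + (y - b) * a + (x - a) * b) < e"
        by (intro abs_val_add_less)
      then show ?thesis by (simp add: dist_abs_val algebra_simps)
    qed
    moreover have "\<forall>\<^sub>F x in nhds a. dist x a < d" "\<forall>\<^sub>F x in nhds b. dist x b < d"
      using d by (auto simp: eventually_nhds_metric)
    ultimately show "\<forall>\<^sub>F x in nhds a \<times>\<^sub>F nhds b. dist (fst x * snd x) (a * b) < e"
      unfolding eventually_prod_filter by fastforce
  qed
qed

lemma ex_small_abs_val: "\<exists>t::'a::nonarch_local_field. t \<noteq> 0 \<and> abs_val t < 1"
  using perfect_choose_dist[of 1 "0::'a"] by (auto simp: abs_val_conv_dist)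

text \<open>Local compactness provides one compact ball of some radius \<open>r\<close>.
  Multiplication by \<open>inverse (t ^ n)\<close> with \<open>0 < abs_val t < 1\<close> is a
  continuous dilation that blows it up past any radius \<open>R\<close>.\<close>

lemma compact_cball_nonarch: "compact (cball (0::'a::nonarch_local_field) R)"
proof -
  obtain U K where UK: "open U" "(0::'a) \<in> U" "U \<subseteq> K" "compact K"
    using locally_compact by blast
  then obtain r where r: "r > 0" "cball (0::'a) r \<subseteq> U"
    by (metis open_contains_cball)
  then have c: "compact (cball (0::'a) r)"
    using UK by (metis compact_Int_closed closed_cball inf.absorb_iff2 order.trans)
  obtain t :: 'a where t: "t \<noteq> 0" "abs_val t < 1"
    using ex_small_abs_val by blast
  have "(\<lambda>n. abs_val t ^ n * R) \<longlonglongrightarrow> 0 * R"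
    using t by (intro tendsto_intros LIMSEQ_power_zero) auto
  then have "\<forall>\<^sub>F n in sequentially. abs_val t ^ n * R < r"
    using r by (intro order_tendstoD) auto
  then obtain n where n: "abs_val t ^ n * R < r"
    by (meson eventually_sequentially order.refl)
  have "compact ((\<lambda>x. inverse (t ^ n) * x) ` cball 0 r)"
    by (intro compact_continuous_image c continuous_intros)
  moreover have "cball 0 R \<subseteq> (\<lambda>x. inverse (t ^ n) * x) ` cball 0 r"
  proof
    fix x :: 'a assume "x \<in> cball 0 R"
    then have "abs_val x \<le> R" by (simp add: abs_val_conv_dist dist_commute)
    then have "abs_val t ^ n * abs_val x \<le> abs_val t ^ n * R"
      by (intro mult_left_mono) auto
    then have "abs_val (t ^ n * x) \<le> r"
      using n by (simp add: abs_val_mult abs_val_power)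
    then show "x \<in> (\<lambda>x. inverse (t ^ n) * x) ` cball 0 r"
      using t by (intro image_eqI[of _ _ "t ^ n * x"])
        (auto simp: abs_val_conv_dist dist_commute)
  qed
  ultimately show ?thesis
    by (metis compact_Int_closed closed_cball inf.absorb_iff2)
qed

instance nonarch_local_field \<subseteq> complete_space
proof
  fix X :: "nat \<Rightarrow> 'a" assume X: "Cauchy X"
  then have "bounded (range X)"
    by (rule cauchy_imp_bounded)
  then obtain R where "\<forall>n. dist 0 (X n) \<le> R"
    by (auto simp: bounded_any_center[of _ 0])
  then have "\<forall>n. X n \<in> cball 0 R" by simp
  with X show "convergent X"
    using compact_imp_complete[OF compact_cball_nonarch[where R=R]]
    unfolding complete_def convergent_def by blast
qed

text \<open>Finite covers of the compact balls of radius \<open>n\<close> by balls of radius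
  \<open>1 / Suc n\<close> together form a countable base. Second countability is what makes a map
  into infinite matrices Borel as soon as its entries are.\<close>

instance nonarch_local_field \<subseteq> second_countable_topology
proof
  have "\<exists>D. finite D \<and> cball (0::'a) (real n) \<subseteq> (\<Union>x\<in>D. ball x (1 / Suc n))" for n
    using seq_compact_imp_totally_bounded[OF compact_imp_seq_compact[OF compact_cball_nonarch]]
    by (metis of_nat_0_less_iff zero_less_Suc zero_less_divide_1_iff)
  then obtain D where D: "\<And>n. finite (D n)"
      "\<And>n. cball (0::'a) (real n) \<subseteq> (\<Union>x\<in>D n. ball x (1 / Suc n))"
    by metis
  define B where "B = (\<lambda>(x, n). ball x (1 / Suc n)) ` ((\<Union>n. D n) \<times> (UNIV::nat set))"
  have "countable B"
    unfolding B_def by (intro countable_image countable_SIGMA countable_UN countable_finite[OF D(1)]) auto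
  moreover have "topological_basis B"
  proof (rule topological_basisI)
    show "open b" if "b \<in> B" for b using that by (auto simp: B_def)
    fix U :: "'a set" and x assume "open U" "x \<in> U"
    then obtain e where e: "e > 0" "ball x e \<subseteq> U" by (meson open_contains_ball)
    obtain m where m: "1 / Suc m < e / 2"
      by (metis e(1) half_gt_zero nat_approx_posE)
    obtain n where n: "n \<ge> m" "dist 0 x \<le> real n"
      by (metis linear order_trans real_arch_simple of_nat_le_iff)
    then obtain d where d: "d \<in> D n" "x \<in> ball d (1 / Suc n)"
      using D(2)[of n] by auto
    have "1 / Suc n \<le> 1 / Suc m" using n by (intro divide_left_mono) auto
    then have "ball d (1 / Suc n) \<subseteq> ball x e"
      using d m e(1) unfolding mem_ball subset_eq
      by (smt (verit) dist_commute dist_triangle field_sum_of_halves mem_ball)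
    then show "\<exists>B'\<in>B. x \<in> B' \<and> B' \<subseteq> U"
      using d e by (intro bexI[of _ "ball d (1 / Suc n)"]) (auto simp: B_def)
  qed
  ultimately show "\<exists>B::'a set set. countable B \<and> open = generate_topology B"
    using topological_basis_imp_subbasis by blast
qed

instance nonarch_local_field \<subseteq> polish_space ..

lemma cball_eq_abs_val: "cball a r = {x. abs_val (x - a::'a::nonarch_local_field) \<le> r}"
  by (auto simp: dist_abs_val abs_val_minus_commute)

lemma closed_abs_val_le: "closed {x::'a::nonarch_local_field. abs_val x \<le> r}"
  using closed_cball[of "0::'a" r] by (simp add: cball_eq_abs_val)

lemma continuous_on_abs_val [continuous_intros]:
  fixes f :: "'b::topological_space \<Rightarrow> 'a::nonarch_local_field"
  shows "continuous_on A f \<Longrightarrow> continuous_on A (\<lambda>x. abs_val (f x))"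
  unfolding abs_val_conv_dist by (intro continuous_intros)

text \<open>Shifting by \<open>a - b\<close> does not leave a ball of radius \<open>r\<close>, so
  every point of a ball is a centre of it. Hence closed balls are open, and two balls are nested or
  disjoint.\<close>

lemma cball_nonarch_eq:
  assumes "abs_val (a - b) \<le> r"
  shows "cball a r = cball (b::'a::nonarch_local_field) r"
proof -
  have "abs_val (x - a) \<le> r \<longleftrightarrow> abs_val (x - b) \<le> r" for x
    using abs_val_add_le[of "x - a" r "a - b"] abs_val_diff_le[of "x - b" r "a - b"] assms by auto
  then show ?thesis by (simp add: cball_eq_abs_val)
qed

lemma open_cball_nonarch:
  assumes "0 < r"
  shows "open (cball (a::'a::nonarch_local_field) r)"
  unfolding open_contains_ball
proof
  fix x assume "x \<in> cball a r"
  then have "cball x r = cball a r"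
    by (intro cball_nonarch_eq) (simp add: dist_abs_val abs_val_minus_commute)
  then show "\<exists>e>0. ball x e \<subseteq> cball a r"
    using assms ball_subset_cball by blast
qed

text \<open>A finite block of terms is no larger than its largest term, so terms tending to zero
  already make the partial sums Cauchy.\<close>

lemma summable_nonarch:
  fixes f :: "nat \<Rightarrow> 'a::nonarch_local_field"
  assumes "f \<longlonglongrightarrow> 0"
  shows "summable f"
proof -
  have "Cauchy (\<lambda>n. \<Sum>i<n. f i)"
  proof (rule metric_CauchyI)
    fix e :: real assume e: "0 < e"
    then obtain N where N: "\<And>n. n \<ge> N \<Longrightarrow> abs_val (f n) < e / 2"
      using assms half_gt_zero[OF e] unfolding lim_sequentially abs_val_conv_dist by blast
    have *: "dist (\<Sum>i<n. f i) (\<Sum>i<m. f i) < e" if "N \<le> m" "m \<le> n" for m n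
    proof -
      have "(\<Sum>i<n. f i) - (\<Sum>i<m. f i) = (\<Sum>i\<in>{m..<n}. f i)"
        using that sum_diff[of "{..<n}" "{..<m}" f]
        by (metis finite_lessThan lessThan_subset_iff lessThan_minus_lessThan)
      moreover have "abs_val (\<Sum>i\<in>{m..<n}. f i) \<le> e / 2"
        using N that e by (intro abs_val_sum_le less_imp_le) auto
      ultimately show ?thesis using e by (simp add: dist_abs_val)
    qed
    show "\<exists>M. \<forall>m\<ge>M. \<forall>n\<ge>M. dist (\<Sum>i<m. f i) (\<Sum>i<n. f i) < e"
      using * by (metis dist_commute linear)
  qed
  then show ?thesis
    by (simp add: summable_iff_convergent Cauchy_convergent)
qed

lemma abs_val_suminf_le:
  fixes f :: "nat \<Rightarrow> 'a::nonarch_local_field"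
  assumes "summable f" "\<And>n. abs_val (f n) \<le> r" "0 \<le> r"
  shows "abs_val (suminf f) \<le> r"
proof -
  have "suminf f \<in> {x. abs_val x \<le> r}"
    by (rule Lim_in_closed_set[OF closed_abs_val_le _ sequentially_bot summable_LIMSEQ[OF assms(1)]])
      (intro always_eventually allI CollectI abs_val_sum_le assms)
  then show ?thesis by simp
qed

lemma suminf_split_nonarch:
  fixes f :: "nat \<Rightarrow> 'a::nonarch_local_field"
  assumes "summable f"
  shows "summable (\<lambda>n. f (n + N))" "suminf f = (\<Sum>n<N. f n) + (\<Sum>n. f (n + N))"
proof -
  have "(\<lambda>n. (\<Sum>i<n + N. f i) - (\<Sum>i<N. f i)) \<longlonglongrightarrow> suminf f - (\<Sum>i<N. f i)"
    by (intro tendsto_diff tendsto_const LIMSEQ_ignore_initial_segment[OF summable_LIMSEQ[OF assms]])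
  moreover have "(\<Sum>i<n + N. f i) - (\<Sum>i<N. f i) = (\<Sum>i<n. f (i + N))" for n
    by (induction n) (simp_all add: algebra_simps)
  ultimately have "(\<lambda>n. f (n + N)) sums (suminf f - (\<Sum>i<N. f i))"
    by (simp add: sums_def)
  then show "summable (\<lambda>n. f (n + N))" "suminf f = (\<Sum>n<N. f n) + (\<Sum>n. f (n + N))"
    by (auto simp: sums_iff)
qed

lemma mem_ring_of_integers: "x \<in> ring_of_integers \<longleftrightarrow> abs_val x \<le> 1"
  by (simp add: ring_of_integers_def)

lemma ring_of_integers_closed [simp]:
  "(0::'a::nonarch_local_field) \<in> ring_of_integers" "(1::'a) \<in> ring_of_integers"
  "(x::'a) \<in> ring_of_integers \<Longrightarrow> y \<in> ring_of_integers \<Longrightarrow> x + y \<in> ring_of_integers"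
  "x \<in> ring_of_integers \<Longrightarrow> y \<in> ring_of_integers \<Longrightarrow> x - y \<in> ring_of_integers"
  "x \<in> ring_of_integers \<Longrightarrow> y \<in> ring_of_integers \<Longrightarrow> x * y \<in> ring_of_integers"
  "x \<in> ring_of_integers \<Longrightarrow> - x \<in> ring_of_integers"
  by (auto simp: mem_ring_of_integers abs_val_mult intro: abs_val_add_le abs_val_diff_le mult_le_one)

lemma ring_of_integers_sum [simp]:
  "(\<And>i. i \<in> A \<Longrightarrow> f i \<in> ring_of_integers) \<Longrightarrow> (\<Sum>i\<in>A. f i::'a::nonarch_local_field) \<in> ring_of_integers"
  by (simp add: mem_ring_of_integers abs_val_sum_le)

lemma ring_of_integers_borel [measurable]: "(ring_of_integers::'a::nonarch_local_field set) \<in> sets borel"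
  unfolding ring_of_integers_def by (intro borel_closed closed_abs_val_le)

section \<open>Uniformizer, value group and residue system\<close>

locale uniformized_field =
  fixes \<pi> :: "'a::nonarch_local_field"
  assumes uniformizer: "uniformizer \<pi>"
    and abs_val_uniformizer: "abs_val \<pi> = 1 / real (residue_card \<pi>)"
begin

abbreviation q :: real where "q \<equiv> real (residue_card \<pi>)"

lemma max_ideal_iff: "abs_val (x::'a) < 1 \<longleftrightarrow> (\<exists>y. abs_val y \<le> 1 \<and> x = \<pi> * y)"
  using uniformizer unfolding uniformizer_def ring_of_integers_def by (auto simp: set_eq_iff)

lemma uniformizer_neq_0 [simp]: "\<pi> \<noteq> 0"
  using ex_small_abs_val[where ?'a='a] max_ideal_iff by fastforce

lemma q_gt_1: "1 < q"
proof -
  have "abs_val \<pi> < 1"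
    using max_ideal_iff[of \<pi>] by (metis abs_val_1 mult.right_neutral order.refl)
  \<comment> \<open>An infinite residue field would have \<open>card\<close> equal to
    \<open>0\<close>, and then \<open>abs_val \<pi> = 1 / 0 = 0\<close> would contradict
    \<open>\<pi> \<noteq> 0\<close>. The normalisation thus yields finiteness of the residue
    field.\<close>
  moreover have "q > 0"
    using abs_val_pos[of \<pi>] unfolding abs_val_uniformizer by (simp del: abs_val_pos)
  ultimately show ?thesis
    by (simp add: abs_val_uniformizer)
qed

lemma q_pos [simp]: "0 < q" and q_neq_0 [simp]: "q \<noteq> 0" and q_ge_2: "2 \<le> q"
  using q_gt_1 by auto

lemma residue_card_pos [simp]: "0 < residue_card \<pi>"
  using q_gt_1 by linarith

lemma abs_val_pi_power_int: "abs_val (\<pi> powi n) = q powi (- n)"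
  by (simp add: abs_val_power_int abs_val_uniformizer power_int_minus power_int_divide_distrib field_simps)

lemma q_powi_le_iff [simp]: "q powi m \<le> q powi n \<longleftrightarrow> m \<le> n"
  by (metis linorder_not_less power_int_increasing power_int_strict_increasing q_gt_1 order_less_imp_le)

lemma abs_val_less_1_iff: "abs_val (x::'a) < 1 \<longleftrightarrow> abs_val x \<le> 1 / q"
proof
  assume "abs_val x < 1"
  then obtain y where "abs_val y \<le> 1" "x = \<pi> * y" by (auto simp: max_ideal_iff)
  then show "abs_val x \<le> 1 / q" 
    by (simp add: abs_val_mult abs_val_uniformizer divide_right_mono)
next
  assume "abs_val x \<le> 1 / q"
  moreover have "1 / q < 1" using q_gt_1 by simp
  ultimately show "abs_val x < 1" by linarith
qed

text \<open>With \<open>n\<close> the ceiling of the logarithm, \<open>x * \<pi> powi n\<close> has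
  absolute value above \<open>1 / q\<close> and at most \<open>1\<close>; there is no value strictly
  between \<open>1 / q\<close> and \<open>1\<close>.\<close>

lemma abs_val_values:
  assumes "(x::'a) \<noteq> 0"
  obtains n where "abs_val x = q powi n"
proof
  define n where "n = \<lceil>log q (abs_val x)\<rceil>"
  have "log q (abs_val x) \<le> of_int n" "of_int (n - 1) < log q (abs_val x)"
    unfolding n_def by linarith+
  then have "abs_val x \<le> q powr of_int n" "q powr of_int (n - 1) < abs_val x"
    using log_le_iff[of q "abs_val x" n] less_log_iff[of q "abs_val x" "real_of_int (n - 1)"] assms q_gt_1
    by auto
  then have le: "abs_val x \<le> q powi n" and lt: "q powi (n - 1) < abs_val x"
    using powr_real_of_int'[of q n] powr_real_of_int'[of q "n - 1"]
    by (metis q_neq_0 of_nat_0_le_iff)+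
  have "abs_val (x * \<pi> powi n) \<le> 1"
    using le zero_less_power_int[OF q_pos, of n]
    by (simp add: abs_val_mult abs_val_pi_power_int power_int_minus flip: divide_inverse)
  moreover have "\<not> abs_val (x * \<pi> powi n) \<le> 1 / q"
  proof -
    have "q powi n / q < abs_val x"
      using lt power_int_diff[of q n 1] by (metis power_int_1_right q_neq_0)
    then have "1 / q < abs_val x / q powi n"
      using zero_less_power_int[OF q_pos, of n] by (simp add: pos_less_divide_eq)
    then show ?thesis
      by (simp add: abs_val_mult abs_val_pi_power_int power_int_minus flip: divide_inverse)
  qed
  ultimately have "abs_val (x * \<pi> powi n) = 1"
    using abs_val_less_1_iff by force
  then show "abs_val x = q powi n"
    by (simp add: abs_val_mult abs_val_pi_power_int power_int_minus field_simps)
qed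

lemma abs_val_gt_iff: "q powi n < abs_val (x::'a) \<longleftrightarrow> q powi (n + 1) \<le> abs_val x"
proof (cases "x = 0")
  case True
  have "0 < q powi m" for m by (rule zero_less_power_int) (rule q_pos)
  then show ?thesis using True by (smt (verit) abs_val_0)
next
  case False
  then obtain m where "abs_val x = q powi m" by (rule abs_val_values)
  then show ?thesis by (simp add: not_le[symmetric] del: not_le) linarith
qed

text \<open>One point is chosen in each class of the quotient that \<open>residue_card\<close>
  counts. This is the digit set of the random expansions that realise Haar measure.\<close>

lemma residue_system:
  obtains R :: "'a set" where "finite R" "card R = residue_card \<pi>" "R \<subseteq> ring_of_integers"
    "\<And>x. x \<in> ring_of_integers \<Longrightarrow> \<exists>!r. r \<in> R \<and> abs_val (x - r) < 1"
proof -
  define E where "E = {(x, y::'a). x \<in> ring_of_integers \<and> y \<in> ring_of_integers \<and> abs_val (x - y) < 1}"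
  have E_eq: "E = {(x, y). x \<in> ring_of_integers \<and> y \<in> ring_of_integers \<and>
              x - y \<in> (\<lambda>z. \<pi> * z) ` ring_of_integers}"
    unfolding E_def using max_ideal_iff by (auto simp: ring_of_integers_def)
  have eq: "equiv ring_of_integers E"
  proof (rule equivI)
    show "refl_on ring_of_integers E" "E \<subseteq> ring_of_integers \<times> ring_of_integers"
      by (auto simp: E_def refl_on_def)
    show "sym E" by (auto simp: sym_def E_def abs_val_minus_commute)
    show "trans E"
    proof (rule transI)
      fix x y z assume "(x, y) \<in> E" "(y, z) \<in> E"
      then show "(x, z) \<in> E"
        using abs_val_add_less[of "x - y" 1 "y - z"] by (simp add: E_def)
    qed
  qed
  define C where "C = (ring_of_integers :: 'a set) // E"
  have card: "card C = residue_card \<pi>" by (simp add: C_def E_eq residue_card_def)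
  then have "finite C" using q_gt_1 by (metis card.infinite of_nat_0 not_one_less_zero)
  define s where "s c = (SOME x. x \<in> c)" for c :: "'a set"
  have s: "s c \<in> c" if "c \<in> C" for c
    using in_quotient_imp_non_empty[OF eq that[unfolded C_def]] unfolding s_def by (simp add: some_in_eq)
  have inj: "inj_on s C"
    using s quotient_disj[OF eq] unfolding C_def inj_on_def by (metis IntI empty_iff)
  have *: "\<exists>!r. r \<in> s ` C \<and> abs_val (x - r) < 1" if x: "x \<in> ring_of_integers" for x
  proof -
    have c: "E `` {x} \<in> C" using x by (simp add: C_def quotientI)
    show ?thesis
    proof (rule ex1I[of _ "s (E `` {x})"])
      show "s (E `` {x}) \<in> s ` C \<and> abs_val (x - s (E `` {x})) < 1"
        using s[OF c] c by (auto simp: E_def)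
      fix r assume r: "r \<in> s ` C \<and> abs_val (x - r) < 1"
      then obtain c' where c': "c' \<in> C" "r = s c'" by auto
      then have "r \<in> c'" "r \<in> ring_of_integers"
        using s in_quotient_imp_subset[OF eq] unfolding C_def by blast+
      then have "r \<in> E `` {x}" using r x by (auto simp: E_def)
      then have "c' = E `` {x}"
        using quotient_disj[OF eq] c' c \<open>r \<in> c'\<close> unfolding C_def by blast
      then show "r = s (E `` {x})" using c' by simp
    qed
  qed
  show ?thesis
  proof (rule that[of "s ` C"])
    show "finite (s ` C)" "card (s ` C) = residue_card \<pi>"
      using \<open>finite C\<close> card card_image[OF inj] by auto
    show "s ` C \<subseteq> ring_of_integers"
      using s in_quotient_imp_subset[OF eq] unfolding C_def by blast
  qed (rule *)
qed

end

section \<open>Haar measure\<close>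

text \<open>Fubini for \<open>indicator A (pl x y)\<close>: integrating over \<open>x\<close> first
  gives the mass of \<open>A\<close> under \<open>M\<close>, integrating over \<open>y\<close> first
  gives its mass under \<open>N\<close>, since the two measures are invariant in opposite arguments
  of \<open>pl\<close>. The lemma identifies Haar measure itself and later its images under additive
  maps.\<close>

lemma invariant_prob_unique:
  fixes pl :: "'b \<Rightarrow> 'b \<Rightarrow> 'b"
  assumes "prob_space M" "prob_space N" and sets: "sets N = sets M"
    and meas: "(\<lambda>(x, y). pl x y) \<in> M \<Otimes>\<^sub>M M \<rightarrow>\<^sub>M M"
    and M: "\<And>a. a \<in> space M \<Longrightarrow> distr M M (\<lambda>x. pl x a) = M"
    and N: "\<And>a. a \<in> space M \<Longrightarrow> distr N M (\<lambda>y. pl a y) = N"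
  shows "M = N"
proof (rule measure_eqI)
  interpret M: prob_space M by fact
  interpret N: prob_space N by fact
  interpret pair_sigma_finite N M ..
  have space: "space N = space M" using sets by (rule sets_eq_imp_space_eq)
  fix A assume A: "A \<in> sets M"
  have [measurable]: "(\<lambda>(y, x). pl x y) \<in> N \<Otimes>\<^sub>M M \<rightarrow>\<^sub>M M"
    using measurable_compose[OF measurable_pair_swap' meas]
    by (simp add: split_def sets cong: measurable_cong_sets sets_pair_measure_cong)
  have f: "(\<lambda>(y, x). indicator A (pl x y) :: ennreal) \<in> borel_measurable (N \<Otimes>\<^sub>M M)"
    using A by measurable
  have 1: "(\<integral>\<^sup>+x. indicator A (pl x y) \<partial>M) = emeasure M A" if "y \<in> space N" for y
  proof -
    have m: "(\<lambda>x. pl x y) \<in> M \<rightarrow>\<^sub>M M"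
      using measurable_compose[OF measurable_Pair2'[of y M M] meas] that space by simp
    have "emeasure M A = emeasure (distr M M (\<lambda>x. pl x y)) A"
      using M that space by simp
    also have "\<dots> = (\<integral>\<^sup>+x. indicator A x \<partial>distr M M (\<lambda>x. pl x y))"
      using A by simp
    also have "\<dots> = (\<integral>\<^sup>+x. indicator A (pl x y) \<partial>M)"
      using A by (intro nn_integral_distr m) simp
    finally show ?thesis ..
  qed
  have 2: "(\<integral>\<^sup>+y. indicator A (pl x y) \<partial>N) = emeasure N A" if "x \<in> space M" for x
  proof -
    have m: "(\<lambda>y. pl x y) \<in> N \<rightarrow>\<^sub>M M"
      using measurable_compose[OF measurable_Pair1'[of x M M] meas] that sets
      by (simp cong: measurable_cong_sets)
    have "emeasure N A = emeasure (distr N M (\<lambda>y. pl x y)) A"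
      using N that by simp
    also have "\<dots> = (\<integral>\<^sup>+y. indicator A y \<partial>distr N M (\<lambda>y. pl x y))"
      using A by simp
    also have "\<dots> = (\<integral>\<^sup>+y. indicator A (pl x y) \<partial>N)"
      using A by (intro nn_integral_distr m) simp
    finally show ?thesis ..
  qed
  have "emeasure M A = (\<integral>\<^sup>+y. (\<integral>\<^sup>+x. indicator A (pl x y) \<partial>M) \<partial>N)"
    using 1 by (simp add: N.emeasure_space_1 cong: nn_integral_cong)
  also have "\<dots> = (\<integral>\<^sup>+x. (\<integral>\<^sup>+y. indicator A (pl x y) \<partial>N) \<partial>M)"
    using Fubini[OF f] by simp
  also have "\<dots> = emeasure N A"
    using 2 by (simp add: M.emeasure_space_1 cong: nn_integral_cong)
  finally show "emeasure M A = emeasure N A" .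
qed (use sets in simp)

lemma sums_mult_nonarch:
  fixes f :: "nat \<Rightarrow> 'a::nonarch_local_field"
  shows "f sums s \<Longrightarrow> (\<lambda>n. c * f n) sums (c * s)"
  unfolding sums_def by (simp flip: sum_distrib_left) (intro tendsto_intros)

lemma suminf_mult_nonarch:
  fixes f :: "nat \<Rightarrow> 'a::nonarch_local_field"
  shows "summable f \<Longrightarrow> (\<Sum>n. c * f n) = c * suminf f"
  using sums_mult_nonarch[of f "suminf f" c] by (simp add: summable_sums sums_iff)

lemma borel_measurable_mult_nonarch [measurable (raw)]:
  fixes f g :: "'b \<Rightarrow> 'a::nonarch_local_field"
  assumes "f \<in> borel_measurable M" "g \<in> borel_measurable M"
  shows "(\<lambda>x. f x * g x) \<in> borel_measurable M"
  using assms by (rule borel_measurable_continuous_Pair) (intro continuous_intros)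

lemma borel_measurable_diff_nonarch [measurable (raw)]:
  fixes f g :: "'b \<Rightarrow> 'a::nonarch_local_field"
  assumes "f \<in> borel_measurable M" "g \<in> borel_measurable M"
  shows "(\<lambda>x. f x - g x) \<in> borel_measurable M"
  using assms by (rule borel_measurable_continuous_Pair) (intro continuous_intros)

context uniformized_field
begin

section \<open>The Haar probability measure on the ring of integers\<close>

lemma inverse_q_power_lt:
  assumes "0 < e" obtains n where "1 / q ^ n < e"
  using real_arch_pow_inv[of e "1 / q"] assms q_gt_1 by (auto simp: power_divide)

text \<open>An open set is the union of the balls of radius \<open>1 / q ^ n\<close> that it
  contains. Each of them has a centre in a countable dense set, so countably many suffice.\<close>

lemma sets_integers_generated:
  "sets (restrict_space borel ring_of_integers) =
     sigma_sets ring_of_integers {cball a (1 / q ^ n) |a n. a \<in> (ring_of_integers :: 'a set)}"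
  (is "_ = sigma_sets ?O ?E")
proof
  have EO: "e \<subseteq> ?O" if e: "e \<in> ?E" for e
  proof -
    obtain a n where an: "e = cball a (1 / q ^ n)" "a \<in> ?O" using e by auto
    have "1 / q ^ n \<le> 1" using q_gt_1 by simp
    then have "x \<in> ?O" if "x \<in> e" for x
    proof -
      have "abs_val (x - a) \<le> 1"
        using that an \<open>1 / q ^ n \<le> 1\<close> unfolding cball_eq_abs_val by (metis mem_Collect_eq order_trans)
      then show ?thesis
        using an abs_val_add_le[of "x - a" 1 a] by (simp add: mem_ring_of_integers)
    qed
    then show ?thesis by auto
  qed
  show "sigma_sets ?O ?E \<subseteq> sets (restrict_space borel ?O)"
  proof -
    have "?E \<subseteq> sets (restrict_space borel ?O)"
    proof
      fix e assume e: "e \<in> ?E"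
      then have "e \<in> sets borel" by auto
      moreover have "e = ?O \<inter> e" using EO[OF e] by auto
      ultimately show "e \<in> sets (restrict_space borel ?O)" by (auto simp: sets_restrict_space)
    qed
    then show ?thesis
      using sets.sigma_sets_subset[of ?E "restrict_space borel ?O"] by (simp add: space_restrict_space)
  qed
  interpret S: sigma_algebra ?O "sigma_sets ?O ?E"
    using EO by (intro sigma_algebra_sigma_sets) auto
  have "?O \<inter> A \<in> sigma_sets ?O ?E" if "A \<in> sigma_sets UNIV {S. open S}" for A
    using that
  proof induction
    case (Basic S)
    then have S: "open S" by simp
    obtain D :: "'a set" where D: "countable D" "\<And>X. open X \<Longrightarrow> X \<noteq> {} \<Longrightarrow> \<exists>d\<in>D. d \<in> X"
      using countable_dense_setE by metis
    define C where "C = {cball d (1 / q ^ n) |d n. d \<in> D \<and> cball d (1 / q ^ n) \<subseteq> ?O \<inter> S}"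
    have "C \<subseteq> (\<lambda>(d, n). cball d (1 / q ^ n)) ` (D \<times> UNIV)"
      by (auto simp: C_def)
    then have cC: "countable C"
      using D(1) by (metis countable_SIGMA countable_image countable_subset countableI_type)
    have CE: "C \<subseteq> ?E"
    proof
      fix c assume "c \<in> C"
      then obtain d n where c: "c = cball d (1 / q ^ n)" "cball d (1 / q ^ n) \<subseteq> ?O"
        by (auto simp: C_def)
      have "d \<in> cball d (1 / q ^ n)" by simp
      with c show "c \<in> ?E" by blast
    qed
    have "?O \<inter> S \<subseteq> \<Union>C"
    proof
      fix x assume x: "x \<in> ?O \<inter> S"
      with S obtain e where e: "0 < e" "ball x e \<subseteq> S" by (auto simp: open_contains_ball)
      obtain n where n: "1 / q ^ n < e" using inverse_q_power_lt[OF e(1)] .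
      obtain d where d: "d \<in> D" "d \<in> cball x (1 / q ^ n)"
        using D(2)[OF open_cball_nonarch[of "1 / q ^ n" x]] by auto
      have eq: "cball x (1 / q ^ n) = cball d (1 / q ^ n)"
        using d(2) by (intro cball_nonarch_eq) (simp add: dist_abs_val)
      have "cball x (1 / q ^ n) \<subseteq> ?O" using x by (intro EO) auto
      moreover have "cball x (1 / q ^ n) \<subseteq> S" using n e(2) by auto
      ultimately have "cball d (1 / q ^ n) \<in> C" using d(1) eq by (auto simp: C_def)
      moreover have "x \<in> cball d (1 / q ^ n)" using eq by (metis centre_in_cball less_imp_le q_pos zero_less_divide_1_iff zero_less_power)
      ultimately show "x \<in> \<Union>C" by blast
    qed
    then have "?O \<inter> S = \<Union>C" by (auto simp: C_def)
    also have "\<dots> \<in> sigma_sets ?O ?E"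
      using cC CE by (intro S.countable_Union) auto
    finally show ?case .
  next
    case (Compl A)
    have "?O \<inter> (UNIV - A) = ?O - ?O \<inter> A" by auto
    then show ?case using sigma_sets.Compl[OF Compl.IH] by simp
  next
    case (Union A)
    have "?O \<inter> \<Union> (range A) = (\<Union>i. ?O \<inter> A i)" by auto
    then show ?case using sigma_sets.Union[OF Union.IH] by simp
  qed (simp add: sigma_sets.Empty)
  then show "sets (restrict_space borel ?O) \<subseteq> sigma_sets ?O ?E"
    by (auto simp: sets_restrict_space borel_def)
qed

text \<open>Two balls are nested or disjoint; the empty set is added to the family for the disjoint
  case.\<close>

lemma Int_stable_cballs:
  "Int_stable (insert {} {cball a (1 / q ^ n) |a n. a \<in> (ring_of_integers :: 'a set)})"
proof (rule Int_stableI)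
  have *: "cball a (1 / q ^ m) \<inter> cball b (1 / q ^ n) \<in> {{}, cball b (1 / q ^ n)}"
    if "m \<le> n" for a b :: 'a and m n
  proof (cases "cball a (1 / q ^ m) \<inter> cball b (1 / q ^ n) = {}")
    case False
    then obtain x where x: "abs_val (x - a) \<le> 1 / q ^ m" "abs_val (x - b) \<le> 1 / q ^ n"
      by (auto simp: cball_eq_abs_val)
    have le: "1 / q ^ n \<le> 1 / q ^ m"
      using that q_gt_1 by (intro divide_left_mono power_increasing) auto
    have "cball a (1 / q ^ m) = cball x (1 / q ^ m)" "cball b (1 / q ^ n) = cball x (1 / q ^ n)"
      using x by (auto intro!: cball_nonarch_eq simp: abs_val_minus_commute)
    then show ?thesis using le by auto
  qed auto
  fix A B assume AB: "A \<in> insert {} {cball a (1 / q ^ n) |a n. a \<in> (ring_of_integers :: 'a set)}"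
    "B \<in> insert {} {cball a (1 / q ^ n) |a n. a \<in> (ring_of_integers :: 'a set)}"
  show "A \<inter> B \<in> insert {} {cball a (1 / q ^ n) |a n. a \<in> (ring_of_integers :: 'a set)}"
  proof (cases "A = {} \<or> B = {}")
    case False
    then obtain a m b n where "A = cball a (1 / q ^ m)" "B = cball b (1 / q ^ n)"
      using AB by blast
    then have "A \<inter> B \<in> {{}, A, B}"
      using *[of m n a b] *[of n m b a] by (metis Int_commute insert_iff linear)
    then show ?thesis using AB by blast
  qed auto
qed

lemma measure_integers_eqI:
  assumes "prob_space M" "prob_space N"
    and M: "sets M = sets (restrict_space borel (ring_of_integers :: 'a set))"
    and N: "sets N = sets (restrict_space borel (ring_of_integers :: 'a set))"
    and eq: "\<And>a n. a \<in> ring_of_integers \<Longrightarrow>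
      emeasure M (cball a (1 / q ^ n)) = emeasure N (cball a (1 / q ^ n))"
  shows "M = N"
proof (rule measure_eqI_generator_eq[OF Int_stable_cballs])
  interpret M: prob_space M by fact
  let ?E = "{cball a (1 / q ^ n) |a n. a \<in> (ring_of_integers :: 'a set)}"
  have "sets M = sigma_sets ring_of_integers ?E"
    using M sets_integers_generated by simp
  moreover have "sigma_sets ring_of_integers (insert {} ?E) = sigma_sets ring_of_integers ?E"
    by (intro antisym sigma_sets_mono insert_subsetI sigma_sets.Empty subsetI)
      (auto intro: sigma_sets.Basic)
  ultimately show "sets M = sigma_sets ring_of_integers (insert {} ?E)"
     "sets N = sigma_sets ring_of_integers (insert {} ?E)"
    using M N by auto
  then show "insert {} ?E \<subseteq> Pow ring_of_integers"
    using sets.sets_into_space[of _ M] sets_eq_imp_space_eq[OF M] 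
    by (auto simp: space_restrict_space intro!: sigma_sets.Basic)
  have c: "cball (0::'a) (1 / q ^ 0) = ring_of_integers"
    by (auto simp: cball_eq_abs_val ring_of_integers_def)
  show "range (\<lambda>i::nat. (ring_of_integers :: 'a set)) \<subseteq> insert {} ?E"
    using c by (force intro!: exI[of _ "0::'a"] exI[of _ "0::nat"])
  show "emeasure M ring_of_integers \<noteq> \<infinity>" by simp
qed (use eq in auto)

text \<open>Haar measure is realised as the law of a random expansion in powers of
  \<open>\<pi>\<close> with independent, uniformly distributed digits. Lying in a given ball of
  radius \<open>1 / q ^ n\<close> prescribes exactly the first \<open>n\<close> digits, whence the
  mass.\<close>

lemma ex_haar:
  "\<exists>M. prob_space M \<and> sets M = sets (restrict_space borel (ring_of_integers :: 'a set)) \<and>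
     (\<forall>b\<in>ring_of_integers. \<forall>n. emeasure M (cball b (1 / q ^ n)) = ennreal ((1 / q) ^ n))"
proof -
  obtain R :: "'a set" where R: "finite R" "card R = residue_card \<pi>" "R \<subseteq> ring_of_integers"
    "\<And>x. x \<in> ring_of_integers \<Longrightarrow> \<exists>!r. r \<in> R \<and> abs_val (x - r) < 1"
    by (rule residue_system, rule that)
  have "R \<noteq> {}" using R(2) q_gt_1 by auto
  define rep where "rep x = (THE r. r \<in> R \<and> abs_val (x - r) < 1)" for x
  have rep: "rep x \<in> R" "abs_val (x - rep x) < 1" if "x \<in> ring_of_integers" for x
    using theI'[OF R(4)[OF that]] unfolding rep_def by auto
  have rep_eq: "rep x = r" if "x \<in> ring_of_integers" "r \<in> R" "abs_val (x - r) < 1" for x r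
    using R(4)[OF that(1)] rep[OF that(1)] that by blast
  \<comment> \<open>\<open>rep\<close> reads the leading digit and \<open>st\<close> deletes it and
    shifts the expansion, so \<open>rep ((st ^^ i) b)\<close> is the digit number \<open>i\<close>
    of \<open>b\<close>.\<close>
  define st where "st x = (x - rep x) / \<pi>" for x
  have st: "st x \<in> ring_of_integers" if "x \<in> ring_of_integers" for x
    using rep(2)[OF that] abs_val_less_1_iff[of "x - rep x"] q_gt_1
    by (simp add: mem_ring_of_integers st_def abs_val_divide abs_val_uniformizer field_simps)
  define D where "D = (\<Pi>\<^sub>M i\<in>(UNIV::nat set). uniform_count_measure R)"
  interpret U: prob_space "uniform_count_measure R"
    using R(1) \<open>R \<noteq> {}\<close> by (rule prob_space_uniform_count_measure)
  interpret D: product_prob_space "\<lambda>_. uniform_count_measure R" "UNIV :: nat set" ..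
  have spD: "\<omega> \<in> space D \<longleftrightarrow> (\<forall>i. \<omega> i \<in> R)" for \<omega>
    by (auto simp: D_def space_PiM space_uniform_count_measure)
  define X where "X \<omega> = (\<Sum>n. \<pi> ^ n * \<omega> n)" for \<omega> :: "nat \<Rightarrow> 'a"
  have term_le: "abs_val (\<pi> ^ n * \<omega> n) \<le> (1 / q) ^ n" if "\<omega> \<in> space D" for \<omega> n
  proof -
    have "abs_val (\<omega> n) \<le> 1" using that R(3) spD by (auto simp: mem_ring_of_integers)
    then show ?thesis
      by (simp add: abs_val_mult abs_val_power abs_val_uniformizer mult_left_le)
  qed
  have summ: "summable (\<lambda>n. \<pi> ^ n * \<omega> n)" if "\<omega> \<in> space D" for \<omega>
  proof (rule summable_nonarch)
    have "(\<lambda>n. (1 / q) ^ n) \<longlonglongrightarrow> 0" using q_gt_1 by (intro LIMSEQ_power_zero) auto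
    then have "(\<lambda>n. abs_val (\<pi> ^ n * \<omega> n)) \<longlonglongrightarrow> 0"
      by (rule Lim_null_comparison[rotated]) (use term_le[OF that] in auto)
    then show "(\<lambda>n. \<pi> ^ n * \<omega> n) \<longlonglongrightarrow> 0"
      by (simp add: abs_val_conv_dist tendsto_dist_iff[symmetric])
  qed
  have XO: "X \<omega> \<in> ring_of_integers" if "\<omega> \<in> space D" for \<omega>
  proof -
    have "(1 / q) ^ n \<le> 1" for n using q_gt_1 by (intro power_le_one) auto
    then show ?thesis
      unfolding X_def mem_ring_of_integers using term_le[OF that]
      by (intro abs_val_suminf_le summ that) (auto intro: order_trans)
  qed
  have comp: "(\<lambda>\<omega>. \<omega> n) \<in> borel_measurable D" for n
  proof -
    have "(\<lambda>\<omega>. \<omega> n) \<in> D \<rightarrow>\<^sub>M uniform_count_measure R"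
      unfolding D_def by (rule measurable_component_singleton) simp
    moreover have "uniform_count_measure R \<rightarrow>\<^sub>M borel = count_space R \<rightarrow>\<^sub>M (borel :: 'a measure)"
      by (rule measurable_cong_sets) (simp_all add: sets_uniform_count_measure)
    hence "(\<lambda>x. x) \<in> uniform_count_measure R \<rightarrow>\<^sub>M (borel :: 'a measure)" by simp
    ultimately show ?thesis by (rule measurable_compose)
  qed
  have X: "X \<in> borel_measurable D"
  proof (rule borel_measurable_LIMSEQ_metric)
    show "(\<lambda>\<omega>. \<Sum>n<N. \<pi> ^ n * \<omega> n) \<in> borel_measurable D" for N
      by (intro borel_measurable_sum borel_measurable_mult_nonarch borel_measurable_const comp)
    show "(\<lambda>N. \<Sum>n<N. \<pi> ^ n * \<omega> n) \<longlonglongrightarrow> X \<omega>" if "\<omega> \<in> space D" for \<omega>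
      unfolding X_def by (rule summable_LIMSEQ[OF summ[OF that]])
  qed
  then have X': "X \<in> D \<rightarrow>\<^sub>M restrict_space borel ring_of_integers"
    using XO by (intro measurable_restrict_space2) auto
  have digits: "abs_val (X \<omega> - b) \<le> 1 / q ^ n \<longleftrightarrow> (\<forall>i<n. \<omega> i = rep ((st ^^ i) b))"
    if "\<omega> \<in> space D" "b \<in> ring_of_integers" for \<omega> b n
    using that
  proof (induction n arbitrary: \<omega> b)
    case 0
    then show ?case using XO[of \<omega>] ring_of_integers_closed(4)[of "X \<omega>" b]
      by (simp add: mem_ring_of_integers)
  next
    case (Suc n)
    define \<omega>' where "\<omega>' i = \<omega> (Suc i)" for i
    have \<omega>': "\<omega>' \<in> space D" using Suc.prems spD by (simp add: \<omega>'_def)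
    have X_eq: "X \<omega> = \<omega> 0 + \<pi> * X \<omega>'"
      using suminf_split_nonarch(2)[OF summ[OF Suc.prems(1)], of 1] suminf_mult_nonarch[OF summ[OF \<omega>'], of \<pi>]
      by (simp add: X_def \<omega>'_def mult.assoc)
    have all: "(\<forall>i<Suc n. \<omega> i = rep ((st ^^ i) b)) \<longleftrightarrow>
        \<omega> 0 = rep b \<and> (\<forall>i<n. \<omega>' i = rep ((st ^^ i) (st b)))"
      by (auto simp: \<omega>'_def less_Suc_eq_0_disj funpow_swap1)
    have IH: "abs_val (X \<omega>' - st b) \<le> 1 / q ^ n \<longleftrightarrow> (\<forall>i<n. \<omega>' i = rep ((st ^^ i) (st b)))"
      using Suc.IH[OF \<omega>' st[OF Suc.prems(2)]] .
    have R0: "\<omega> 0 \<in> R" using Suc.prems spD by auto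
    have *: "abs_val (X \<omega> - b) \<le> 1 / q ^ Suc n \<longleftrightarrow> abs_val (X \<omega>' - st b) \<le> 1 / q ^ n" if "\<omega> 0 = rep b"
    proof -
      have "X \<omega> - b = \<pi> * (X \<omega>' - st b)"
        using that by (simp add: X_eq st_def field_simps)
      then have "abs_val (X \<omega> - b) = abs_val (X \<omega>' - st b) / q"
        by (simp only: abs_val_mult abs_val_uniformizer) simp
      then show ?thesis
        by (simp only:) (simp add: field_simps)
    qed
    \<comment> \<open>A distance below \<open>1\<close> fixes the residue class, hence the leading
      digit; only afterwards can a factor \<open>\<pi>\<close> be divided out and the induction
      hypothesis be used.\<close>
    have "\<omega> 0 = rep b" if "abs_val (X \<omega> - b) \<le> 1 / q ^ Suc n"
    proof -
      have "1 / q ^ Suc n < 1" using one_less_power[OF q_gt_1, of "Suc n"] by simp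
      then have "abs_val (X \<omega> - b) < 1" using that by linarith
      moreover have "abs_val (\<pi> * X \<omega>') < 1"
        unfolding max_ideal_iff using XO[OF \<omega>'] by (auto simp: mem_ring_of_integers)
      ultimately have "abs_val (b - X \<omega> + \<pi> * X \<omega>') < 1"
        by (intro abs_val_add_less) (simp_all add: abs_val_minus_commute)
      then show ?thesis
        using rep_eq[OF Suc.prems(2) R0] by (simp add: X_eq)
    qed
    then show ?case using all IH * by blast
  qed
  define M where "M = distr D (restrict_space borel ring_of_integers) X"
  have "emeasure M (cball b (1 / q ^ n)) = ennreal ((1 / q) ^ n)" if b: "b \<in> ring_of_integers" for b n
  proof -
    have "(st ^^ i) b \<in> ring_of_integers" for i using st b by (induction i) auto
    then have digR: "rep ((st ^^ i) b) \<in> R" for i by (rule rep)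
    have "cball b (1 / q ^ n) \<in> sets (restrict_space borel ring_of_integers)"
      unfolding sets_integers_generated using b by (intro sigma_sets.Basic) auto
    then have "emeasure M (cball b (1 / q ^ n)) = emeasure D (X -` cball b (1 / q ^ n) \<inter> space D)"
      unfolding M_def by (intro emeasure_distr X')
    also have "X -` cball b (1 / q ^ n) \<inter> space D =
        {\<omega>\<in>space D. \<forall>i\<in>{..<n}. \<omega> i \<in> {rep ((st ^^ i) b)}}"
      using digits[OF _ b] by (auto simp: cball_eq_abs_val)
    also have "emeasure D \<dots> = (\<Prod>i\<in>{..<n}. emeasure (uniform_count_measure R) {rep ((st ^^ i) b)})"
      unfolding D_def using digR by (intro D.emeasure_PiM_Collect) (auto simp: sets_uniform_count_measure)
    also have "\<dots> = (\<Prod>i\<in>{..<n}. ennreal (1 / q))"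
    proof (rule prod.cong)
      fix i
      show "emeasure (uniform_count_measure R) {rep ((st ^^ i) b)} = ennreal (1 / q)"
        using R digR by (simp add: emeasure_uniform_count_measure divide_ennreal ennreal_of_nat_eq_real_of_nat)
    qed simp
    finally show ?thesis by (simp add: ennreal_power)
  qed
  moreover have "prob_space M"
    unfolding M_def using X' D.prob_space_axioms by (intro prob_space.prob_space_distr) (auto simp: D_def)
  moreover have "sets M = sets (restrict_space borel ring_of_integers)" by (simp add: M_def)
  ultimately show ?thesis by blast
qed

text \<open>This resolves the definite description in \<open>haar_integers\<close>. A translation
  only moves the centre of a ball, so the measure of \<open>ex_haar\<close> is invariant by
  comparison on balls, and \<open>invariant_prob_unique\<close> excludes every other
  candidate.\<close>

lemma
  shows prob_space_haar_integers: "prob_space (haar_integers :: 'a measure)"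
    and sets_haar_integers: "sets (haar_integers :: 'a measure) = sets (restrict_space borel ring_of_integers)"
    and distr_haar_integers_add:
      "\<And>a. a \<in> ring_of_integers \<Longrightarrow> distr haar_integers haar_integers (\<lambda>x. a + x) = (haar_integers :: 'a measure)"
    and emeasure_haar_cball: "\<And>(b::'a) n. b \<in> ring_of_integers \<Longrightarrow>
      emeasure haar_integers (cball b (1 / q ^ n)) = ennreal ((1 / q) ^ n)"
proof -
  let ?O = "ring_of_integers :: 'a set"
  let ?B = "restrict_space borel ?O"
  obtain M where M: "prob_space M" "sets M = sets ?B"
    "\<And>b n. b \<in> ?O \<Longrightarrow> emeasure M (cball b (1 / q ^ n)) = ennreal ((1 / q) ^ n)"
    using ex_haar by blast
  interpret M: prob_space M by fact
  have sp: "space M = ?O" using sets_eq_imp_space_eq[OF M(2)] by (simp add: space_restrict_space)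
  have meas: "(\<lambda>x. a + x) \<in> M \<rightarrow>\<^sub>M M" if a: "a \<in> ?O" for a
  proof -
    have "(\<lambda>x. a + x) \<in> ?B \<rightarrow>\<^sub>M ?B"
    proof (rule measurable_restrict_space2)
      show "(\<lambda>x. a + x) \<in> borel_measurable ?B"
        by (intro measurable_restrict_space1 borel_measurable_continuous_onI continuous_intros)
    qed (use a in \<open>auto simp: space_restrict_space\<close>)
    then show ?thesis using M(2) by (simp cong: measurable_cong_sets)
  qed
  have inv: "distr M M (\<lambda>x. a + x) = M" if a: "a \<in> ?O" for a
  proof (rule measure_integers_eqI)
    show "prob_space (distr M M (\<lambda>x. a + x))" by (intro M.prob_space_distr meas a)
    fix b :: 'a and n assume b: "b \<in> ?O"
    have "cball b (1 / q ^ n) \<in> sets M"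
      unfolding M(2) sets_integers_generated using b by (intro sigma_sets.Basic) auto
    then have "emeasure (distr M M (\<lambda>x. a + x)) (cball b (1 / q ^ n)) =
        emeasure M ((\<lambda>x. a + x) -` cball b (1 / q ^ n) \<inter> space M)"
      by (intro emeasure_distr meas a)
    also have "(\<lambda>x. a + x) -` cball b (1 / q ^ n) \<inter> space M = cball (b - a) (1 / q ^ n)"
    proof -
      have "cball (b - a) (1 / q ^ n) \<in> sets M"
        unfolding M(2) sets_integers_generated using b a by (intro sigma_sets.Basic) auto
      then have "cball (b - a) (1 / q ^ n) \<subseteq> space M" by (rule sets.sets_into_space)
      then show ?thesis by (auto simp: cball_eq_abs_val algebra_simps)
    qed
    finally show "emeasure (distr M M (\<lambda>x. a + x)) (cball b (1 / q ^ n)) = emeasure M (cball b (1 / q ^ n))"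
      using a b by (simp add: M(3))
  qed (use M in auto)
  have add: "(\<lambda>(x, y). x + y) \<in> M \<Otimes>\<^sub>M M \<rightarrow>\<^sub>M M"
  proof -
    have [measurable]: "(\<lambda>x. x) \<in> M \<rightarrow>\<^sub>M borel"
      using M(2) by (simp add: measurable_restrict_space1 cong: measurable_cong_sets)
    have [measurable]: "fst \<in> M \<Otimes>\<^sub>M M \<rightarrow>\<^sub>M borel" "snd \<in> M \<Otimes>\<^sub>M M \<rightarrow>\<^sub>M borel"
      using measurable_compose[OF measurable_fst \<open>(\<lambda>x. x) \<in> M \<rightarrow>\<^sub>M borel\<close>]
        measurable_compose[OF measurable_snd \<open>(\<lambda>x. x) \<in> M \<rightarrow>\<^sub>M borel\<close>] by simp_all
    have "(\<lambda>p. fst p + snd p) \<in> M \<Otimes>\<^sub>M M \<rightarrow>\<^sub>M ?B"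
      by (intro measurable_restrict_space2 borel_measurable_add) (auto simp: sp space_pair_measure)
    then show ?thesis using M(2) by (simp add: split_def cong: measurable_cong_sets)
  qed
  have uniq: "N = M" if N: "prob_space N" "sets N = sets ?B" "\<And>a. a \<in> ?O \<Longrightarrow> distr N N (\<lambda>x. a + x) = N" for N
  proof (rule invariant_prob_unique[symmetric, OF M(1) N(1) _ add])
    show "sets N = sets M" using N M by simp
    fix a assume "a \<in> space M"
    then have a: "a \<in> ?O" using sp by simp
    show "distr M M (\<lambda>x. x + a) = M" using inv[OF a] by (simp add: add.commute)
    have "distr N M (\<lambda>x. a + x) = distr N N (\<lambda>x. a + x)"
      using N M by (intro distr_cong) auto
    then show "distr N M (\<lambda>y. a + y) = N" using N(3)[OF a] by simp
  qed
  have "haar_integers = M"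
    unfolding haar_integers_def
  proof (rule the_equality)
    show "prob_space M \<and> sets M = sets ?B \<and> (\<forall>a\<in>?O. distr M M ((+) a) = M)"
      using M inv by auto
  qed (use uniq in auto)
  then show "prob_space (haar_integers :: 'a measure)"
    "sets (haar_integers :: 'a measure) = sets ?B"
    "\<And>a. a \<in> ?O \<Longrightarrow> distr haar_integers haar_integers (\<lambda>x. a + x) = (haar_integers :: 'a measure)"
    "\<And>(b::'a) n. b \<in> ?O \<Longrightarrow> emeasure haar_integers (cball b (1 / q ^ n)) = ennreal ((1 / q) ^ n)"
    using M inv by auto
qed

end

section \<open>Powers of the Haar measure\<close>

text \<open>The index type is left open because variable labels and pairs of matrix indices both
  occur, and additive maps between such powers transport the measure.\<close>

definition haar_pow :: "('i \<Rightarrow> 'a::nonarch_local_field) measure" where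
  "haar_pow = (\<Pi>\<^sub>M i\<in>UNIV. haar_integers)"

text \<open>Assigns to the coordinates in \<open>S\<close> the values of the first argument; conditioning on these
  coordinates becomes an integration over the second argument.\<close>

definition merge_coords :: "'i set \<Rightarrow> ('i \<Rightarrow> 'a) \<times> ('i \<Rightarrow> 'a) \<Rightarrow> 'i \<Rightarrow> 'a" where
  "merge_coords S p i = (if i \<in> S then fst p i else snd p i)"

context uniformized_field
begin

lemma space_haar_integers: "space (haar_integers :: 'a measure) = ring_of_integers"
  using sets_eq_imp_space_eq[OF sets_haar_integers] by (simp add: space_restrict_space)

lemma product_prob_space_haar: "product_prob_space (\<lambda>_. haar_integers :: 'a measure)"
proof -
  interpret H: prob_space "haar_integers :: 'a measure" by (rule prob_space_haar_integers)
  show ?thesis ..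
qed

lemma in_space_haar_pow:
  "\<omega> \<in> space (haar_pow :: ('i \<Rightarrow> 'a) measure) \<longleftrightarrow> (\<forall>i. \<omega> i \<in> ring_of_integers)"
  by (auto simp: haar_pow_def space_PiM space_haar_integers)

lemma abs_val_haar_pow: "\<omega> \<in> space (haar_pow :: ('i \<Rightarrow> 'a) measure) \<Longrightarrow> abs_val (\<omega> i) \<le> 1"
  by (simp add: in_space_haar_pow mem_ring_of_integers)

lemma prob_space_haar_pow: "prob_space (haar_pow :: ('i \<Rightarrow> 'a) measure)"
  unfolding haar_pow_def by (intro prob_space_PiM prob_space_haar_integers)

lemma measurable_haar_integers_iff:
  "f \<in> M \<rightarrow>\<^sub>M (haar_integers :: 'a measure) \<longleftrightarrow> f \<in> M \<rightarrow>\<^sub>M restrict_space borel ring_of_integers"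
  by (simp add: sets_haar_integers cong: measurable_cong_sets)

lemma measurable_haar_pow_component [measurable]:
  "(\<lambda>\<omega>. \<omega> i) \<in> borel_measurable (haar_pow :: ('i \<Rightarrow> 'a) measure)"
proof -
  have "(\<lambda>\<omega>. \<omega> i) \<in> (haar_pow :: ('i \<Rightarrow> 'a) measure) \<rightarrow>\<^sub>M restrict_space borel ring_of_integers"
    unfolding haar_pow_def measurable_haar_integers_iff[symmetric]
    by (rule measurable_component_singleton) simp
  then show ?thesis
    using measurable_restrict_space2_iff by blast
qed

lemma measurable_haar_powI:
  fixes f :: "'b \<Rightarrow> 'i \<Rightarrow> 'a"
  assumes "\<And>i. (\<lambda>x. f x i) \<in> borel_measurable M"
    and "\<And>x i. x \<in> space M \<Longrightarrow> f x i \<in> ring_of_integers"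
  shows "f \<in> M \<rightarrow>\<^sub>M haar_pow"
  unfolding haar_pow_def
proof (rule measurable_PiM_single')
  show "(\<lambda>x. f x i) \<in> M \<rightarrow>\<^sub>M haar_integers" for i
    unfolding measurable_haar_integers_iff using assms by (intro measurable_restrict_space2) auto
  show "f \<in> space M \<rightarrow> (\<Pi>\<^sub>E i\<in>UNIV. space haar_integers)"
    using assms by (auto simp: space_haar_integers)
qed

lemma measurable_haar_pow_component':
  "f \<in> M \<rightarrow>\<^sub>M (haar_pow :: ('i \<Rightarrow> 'a) measure) \<Longrightarrow> (\<lambda>x. f x i) \<in> borel_measurable M"
  by (rule measurable_compose[OF _ measurable_haar_pow_component])

lemma emeasure_haar_pow_Collect:
  fixes F :: "'i \<Rightarrow> 'a set"
  assumes "finite J" "\<And>j. j \<in> J \<Longrightarrow> F j \<in> sets haar_integers"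
  shows "emeasure haar_pow {\<omega>\<in>space haar_pow. \<forall>j\<in>J. \<omega> j \<in> F j} = (\<Prod>j\<in>J. emeasure haar_integers (F j))"
proof -
  interpret product_prob_space "\<lambda>_. haar_integers :: 'a measure" "UNIV :: 'i set"
    by (rule product_prob_space_haar)
  show ?thesis unfolding haar_pow_def using assms by (intro emeasure_PiM_Collect) auto
qed

lemma haar_pow_eqI:
  fixes M :: "('i \<Rightarrow> 'a) measure"
  assumes "sets M = sets haar_pow"
    and "\<And>J F. finite J \<Longrightarrow> (\<And>j. j \<in> J \<Longrightarrow> F j \<in> sets haar_integers) \<Longrightarrow>
      emeasure M {\<omega>\<in>space haar_pow. \<forall>j\<in>J. \<omega> j \<in> F j} = (\<Prod>j\<in>J. emeasure haar_integers (F j))"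
  shows "M = haar_pow"
proof -
  interpret product_prob_space "\<lambda>_. haar_integers :: 'a measure" "UNIV :: 'i set"
    by (rule product_prob_space_haar)
  show ?thesis unfolding haar_pow_def
  proof (rule PiM_eq)
    fix J F assume J: "finite J" "J \<subseteq> (UNIV :: 'i set)" "\<And>j. j \<in> J \<Longrightarrow> F j \<in> sets (haar_integers :: 'a measure)"
    have "prod_emb UNIV (\<lambda>_. haar_integers) J (\<Pi>\<^sub>E j\<in>J. F j) = {\<omega>\<in>space haar_pow. \<forall>j\<in>J. \<omega> j \<in> F j}"
      by (auto simp: prod_emb_def haar_pow_def space_PiM)
    then show "emeasure M (prod_emb UNIV (\<lambda>_. haar_integers) J (\<Pi>\<^sub>E j\<in>J. F j)) =
        (\<Prod>j\<in>J. emeasure haar_integers (F j))"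
      using assms(2)[OF J(1,3)] by simp
  qed (use assms in \<open>simp add: haar_pow_def\<close>)
qed

lemma haar_pow_set [measurable]:
  fixes F :: "'i \<Rightarrow> 'a set"
  assumes "finite J" "\<And>j. j \<in> J \<Longrightarrow> F j \<in> sets haar_integers"
  shows "{\<omega>\<in>space haar_pow. \<forall>j\<in>J. \<omega> j \<in> F j} \<in> sets haar_pow"
proof -
  have "{\<omega>\<in>space haar_pow. \<omega> j \<in> F j} \<in> sets haar_pow" if "j \<in> J" for j
  proof -
    have "F j \<in> sets borel" using assms(2)[OF that] by (auto simp: sets_haar_integers sets_restrict_space)
    then show ?thesis by measurable
  qed
  then show ?thesis using assms(1) by (intro sets.sets_Collect_finite_All)
qed

lemma measurable_haar_pow_add:
  fixes f g :: "'b \<Rightarrow> 'i \<Rightarrow> 'a"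
  assumes f: "f \<in> M \<rightarrow>\<^sub>M haar_pow" and g: "g \<in> M \<rightarrow>\<^sub>M haar_pow"
  shows "(\<lambda>x i. f x i + g x i) \<in> M \<rightarrow>\<^sub>M haar_pow"
  using measurable_haar_pow_component'[OF f] measurable_haar_pow_component'[OF g]
    measurable_space[OF f] measurable_space[OF g]
  by (intro measurable_haar_powI borel_measurable_add) (auto simp: in_space_haar_pow)

lemma distr_haar_pow_add:
  fixes a :: "'i \<Rightarrow> 'a"
  assumes "a \<in> space haar_pow"
  shows "distr haar_pow haar_pow (\<lambda>\<omega> i. \<omega> i + a i) = haar_pow"
proof (rule haar_pow_eqI)
  have m: "(\<lambda>\<omega> i. \<omega> i + a i) \<in> haar_pow \<rightarrow>\<^sub>M haar_pow"
    using assms by (intro measurable_haar_pow_add) auto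
  fix J and F :: "'i \<Rightarrow> 'a set"
  assume J: "finite J" "\<And>j. j \<in> J \<Longrightarrow> F j \<in> sets haar_integers"
  define F' where "F' j = (\<lambda>x. a j + x) -` F j \<inter> space haar_integers" for j
  have aj: "a j \<in> ring_of_integers" for j using assms by (simp add: in_space_haar_pow)
  have m1: "(\<lambda>x. a j + x) \<in> haar_integers \<rightarrow>\<^sub>M haar_integers" for j
  proof -
    have "(\<lambda>x. a j + x) \<in> borel_measurable haar_integers"
      by (simp add: sets_haar_integers measurable_restrict_space1 cong: measurable_cong_sets)
    then show ?thesis
      unfolding measurable_haar_integers_iff using aj
      by (intro measurable_restrict_space2) (auto simp: space_haar_integers)
  qed
  have F': "F' j \<in> sets haar_integers" "emeasure haar_integers (F' j) = emeasure haar_integers (F j)"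
    if "j \<in> J" for j
  proof -
    show "F' j \<in> sets haar_integers" unfolding F'_def by (intro measurable_sets[OF m1] J that)
    show "emeasure haar_integers (F' j) = emeasure haar_integers (F j)"
      using emeasure_distr[OF m1[of j] J(2)[OF that]] distr_haar_integers_add[OF aj[of j]]
      unfolding F'_def by simp
  qed
  have "emeasure (distr haar_pow haar_pow (\<lambda>\<omega> i. \<omega> i + a i)) {\<omega>\<in>space haar_pow. \<forall>j\<in>J. \<omega> j \<in> F j} =
      emeasure haar_pow ((\<lambda>\<omega> i. \<omega> i + a i) -` {\<omega>\<in>space haar_pow. \<forall>j\<in>J. \<omega> j \<in> F j} \<inter> space haar_pow)"
    using J by (intro emeasure_distr m haar_pow_set)
  also have "(\<lambda>\<omega> i. \<omega> i + a i) -` {\<omega>\<in>space haar_pow. \<forall>j\<in>J. \<omega> j \<in> F j} \<inter> space haar_pow =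
      {\<omega>\<in>space haar_pow. \<forall>j\<in>J. \<omega> j \<in> F' j}"
    using measurable_space[OF m]
    by (auto simp: F'_def in_space_haar_pow space_haar_integers add.commute)
  also have "emeasure haar_pow \<dots> = (\<Prod>j\<in>J. emeasure haar_integers (F' j))"
    using J(1) F' by (intro emeasure_haar_pow_Collect) auto
  finally show "emeasure (distr haar_pow haar_pow (\<lambda>\<omega> i. \<omega> i + a i))
      {\<omega>\<in>space haar_pow. \<forall>j\<in>J. \<omega> j \<in> F j} = (\<Prod>j\<in>J. emeasure haar_integers (F j))"
    using F' by simp
qed simp

text \<open>By surjectivity a translation by \<open>a\<close> is one by some \<open>T b\<close>, and
  additivity pulls it back to a translation by \<open>b\<close> in the source. So the image measure
  is translation invariant, hence Haar measure by uniqueness. Every later claim that a transformed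
  family of variables is again Haar distributed is an instance.\<close>

lemma distr_haar_pow_surj:
  fixes T :: "('i \<Rightarrow> 'a) \<Rightarrow> 'j \<Rightarrow> 'a"
  assumes T: "T \<in> haar_pow \<rightarrow>\<^sub>M haar_pow"
    and add: "\<And>x y j. x \<in> space haar_pow \<Longrightarrow> y \<in> space haar_pow \<Longrightarrow> T (\<lambda>i. x i + y i) j = T x j + T y j"
    and surj: "\<And>y. y \<in> space haar_pow \<Longrightarrow> \<exists>x\<in>space haar_pow. T x = y"
  shows "distr haar_pow haar_pow T = haar_pow"
proof (rule invariant_prob_unique[of haar_pow "distr haar_pow haar_pow T" "\<lambda>x y j. x j + y j", symmetric])
  show "prob_space (haar_pow :: ('j \<Rightarrow> 'a) measure)" by (rule prob_space_haar_pow)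
  show "prob_space (distr haar_pow haar_pow T)" by (rule prob_space.prob_space_distr[OF prob_space_haar_pow T])
  show "(\<lambda>(x, y) j. x j + y j) \<in> haar_pow \<Otimes>\<^sub>M haar_pow \<rightarrow>\<^sub>M (haar_pow :: ('j \<Rightarrow> 'a) measure)"
    unfolding split_def by (intro measurable_haar_pow_add measurable_fst measurable_snd)
  fix a :: "'j \<Rightarrow> 'a" assume a: "a \<in> space haar_pow"
  show "distr haar_pow haar_pow (\<lambda>x j. x j + a j) = haar_pow" by (rule distr_haar_pow_add[OF a])
  obtain b where b: "b \<in> space haar_pow" "T b = a" using surj[OF a] by blast
  have m: "(\<lambda>y j. a j + y j) \<in> haar_pow \<rightarrow>\<^sub>M haar_pow"
    using a by (intro measurable_haar_pow_add) auto
  have mb: "(\<lambda>x i. x i + b i) \<in> haar_pow \<rightarrow>\<^sub>M haar_pow"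
    using b by (intro measurable_haar_pow_add) auto
  have "distr (distr haar_pow haar_pow T) haar_pow (\<lambda>y j. a j + y j) = distr haar_pow haar_pow (\<lambda>x j. a j + T x j)"
    by (subst distr_distr[OF m T]) (simp add: comp_def)
  also have "\<dots> = distr haar_pow haar_pow (\<lambda>x. T (\<lambda>i. x i + b i))"
    using b by (intro distr_cong) (auto simp: add add.commute fun_eq_iff)
  also have "\<dots> = distr (distr haar_pow haar_pow (\<lambda>x i. x i + b i)) haar_pow T"
    by (subst distr_distr[OF T mb]) (simp add: comp_def)
  finally show "distr (distr haar_pow haar_pow T) haar_pow (\<lambda>y j. a j + y j) = distr haar_pow haar_pow T"
    using distr_haar_pow_add[OF b(1)] by simp
qed simp

lemma integral_haar_pow_surj:
  fixes T :: "('i \<Rightarrow> 'a) \<Rightarrow> 'j \<Rightarrow> 'a" and f :: "('j \<Rightarrow> 'a) \<Rightarrow> real"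
  assumes "T \<in> haar_pow \<rightarrow>\<^sub>M haar_pow"
    and "\<And>x y j. x \<in> space haar_pow \<Longrightarrow> y \<in> space haar_pow \<Longrightarrow> T (\<lambda>i. x i + y i) j = T x j + T y j"
    and "\<And>y. y \<in> space haar_pow \<Longrightarrow> \<exists>x\<in>space haar_pow. T x = y"
    and f: "f \<in> borel_measurable haar_pow"
  shows "(\<integral>x. f (T x) \<partial>haar_pow) = (\<integral>y. f y \<partial>haar_pow)"
proof -
  have "(\<integral>y. f y \<partial>haar_pow) = (\<integral>y. f y \<partial>distr haar_pow haar_pow T)"
    by (simp only: distr_haar_pow_surj[OF assms(1-3)])
  also have "\<dots> = (\<integral>x. f (T x) \<partial>haar_pow)"
    by (rule integral_distr[OF assms(1) f])
  finally show ?thesis ..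
qed

lemma measurable_merge_coords [measurable]:
  "merge_coords S \<in> haar_pow \<Otimes>\<^sub>M haar_pow \<rightarrow>\<^sub>M (haar_pow :: ('i \<Rightarrow> 'a) measure)"
proof (rule measurable_haar_powI)
  show "(\<lambda>p. merge_coords S p i) \<in> borel_measurable (haar_pow \<Otimes>\<^sub>M (haar_pow :: ('i \<Rightarrow> 'a) measure))" for i
    unfolding merge_coords_def by measurable
qed (auto simp: merge_coords_def space_pair_measure in_space_haar_pow)

lemma distr_merge_coords:
  "distr (haar_pow \<Otimes>\<^sub>M haar_pow) haar_pow (merge_coords S) = (haar_pow :: ('i \<Rightarrow> 'a) measure)"
proof (rule haar_pow_eqI)
  interpret P: prob_space "haar_pow :: ('i \<Rightarrow> 'a) measure" by (rule prob_space_haar_pow)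
  fix J and F :: "'i \<Rightarrow> 'a set"
  assume J: "finite J" "\<And>j. j \<in> J \<Longrightarrow> F j \<in> sets haar_integers"
  let ?C = "\<lambda>J. {\<omega>\<in>space haar_pow. \<forall>j\<in>J. \<omega> j \<in> F j}"
  have "emeasure (distr (haar_pow \<Otimes>\<^sub>M haar_pow) haar_pow (merge_coords S)) (?C J) =
      emeasure (haar_pow \<Otimes>\<^sub>M haar_pow) (merge_coords S -` ?C J \<inter> space (haar_pow \<Otimes>\<^sub>M haar_pow))"
    using J by (intro emeasure_distr haar_pow_set measurable_merge_coords)
  also have "merge_coords S -` ?C J \<inter> space (haar_pow \<Otimes>\<^sub>M haar_pow) = ?C (J \<inter> S) \<times> ?C (J - S)"
    by (auto simp: space_pair_measure merge_coords_def in_space_haar_pow split: if_splits)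
  also have "emeasure (haar_pow \<Otimes>\<^sub>M haar_pow) \<dots> = emeasure haar_pow (?C (J \<inter> S)) * emeasure haar_pow (?C (J - S))"
    using J by (intro P.emeasure_pair_measure_Times haar_pow_set) auto
  also have "\<dots> = (\<Prod>j\<in>J\<inter>S. emeasure haar_integers (F j)) * (\<Prod>j\<in>J-S. emeasure haar_integers (F j))"
    using J by (subst (1 2) emeasure_haar_pow_Collect) auto
  also have "\<dots> = (\<Prod>j\<in>J. emeasure haar_integers (F j))"
    using J(1) by (subst prod.Int_Diff[of J _ S]) auto
  finally show "emeasure (distr (haar_pow \<Otimes>\<^sub>M haar_pow) haar_pow (merge_coords S)) (?C J) =
      (\<Prod>j\<in>J. emeasure haar_integers (F j))" .
qed simp

text \<open>A merged pair of independent points is again Haar distributed, so Fubini for the pair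
  integrates out the coordinates outside \<open>S\<close> while those in \<open>S\<close> stay
  fixed.\<close>

lemma integral_merge_coords:
  fixes f :: "('i \<Rightarrow> 'a) \<Rightarrow> real"
  assumes f: "f \<in> borel_measurable haar_pow" and B: "\<And>x. x \<in> space haar_pow \<Longrightarrow> \<bar>f x\<bar> \<le> B"
  shows "(\<integral>x. f x \<partial>haar_pow) = (\<integral>x. (\<integral>y. f (merge_coords S (x, y)) \<partial>haar_pow) \<partial>haar_pow)"
    and "(\<lambda>x. \<integral>y. f (merge_coords S (x, y)) \<partial>haar_pow) \<in> borel_measurable haar_pow"
proof -
  interpret P: prob_space "haar_pow :: ('i \<Rightarrow> 'a) measure" by (rule prob_space_haar_pow)
  interpret PP: pair_prob_space "haar_pow :: ('i \<Rightarrow> 'a) measure" "haar_pow :: ('i \<Rightarrow> 'a) measure" ..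
  have m: "(\<lambda>p. f (merge_coords S p)) \<in> borel_measurable (haar_pow \<Otimes>\<^sub>M haar_pow)"
    using f by measurable
  have i: "integrable (haar_pow \<Otimes>\<^sub>M haar_pow) (\<lambda>p. f (merge_coords S p))"
    using B measurable_space[OF measurable_merge_coords]
    by (intro PP.integrable_const_bound[of _ B] m AE_I2) auto
  have "(\<integral>x. f x \<partial>haar_pow) = (\<integral>x. f x \<partial>distr (haar_pow \<Otimes>\<^sub>M haar_pow) haar_pow (merge_coords S))"
    by (simp add: distr_merge_coords)
  also have "\<dots> = (\<integral>p. f (merge_coords S p) \<partial>(haar_pow \<Otimes>\<^sub>M haar_pow))"
    by (rule integral_distr) (simp_all add: f)
  also have "\<dots> = (\<integral>x. (\<integral>y. f (merge_coords S (x, y)) \<partial>haar_pow) \<partial>haar_pow)"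
    using PP.integral_fst'[OF i] by simp
  finally show "(\<integral>x. f x \<partial>haar_pow) = (\<integral>x. (\<integral>y. f (merge_coords S (x, y)) \<partial>haar_pow) \<partial>haar_pow)" .
  show "(\<lambda>x. \<integral>y. f (merge_coords S (x, y)) \<partial>haar_pow) \<in> borel_measurable haar_pow"
    using m by (intro P.borel_measurable_lebesgue_integral) (simp add: split_def)
qed

text \<open>After substituting a merged pair, \<open>f\<close> sees only the first argument and
  \<open>g\<close> only the second, so the double integral factorises.\<close>

lemma integral_mult_indep:
  fixes f g :: "('i \<Rightarrow> 'a) \<Rightarrow> real"
  assumes f: "f \<in> borel_measurable haar_pow" and g: "g \<in> borel_measurable haar_pow"
    and Bf: "\<And>x. x \<in> space haar_pow \<Longrightarrow> \<bar>f x\<bar> \<le> B" and Bg: "\<And>x. x \<in> space haar_pow \<Longrightarrow> \<bar>g x\<bar> \<le> B'"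
    and fS: "\<And>x y. (\<And>i. i \<in> S \<Longrightarrow> x i = y i) \<Longrightarrow> f x = f y"
    and gS: "\<And>x y. (\<And>i. i \<notin> S \<Longrightarrow> x i = y i) \<Longrightarrow> g x = g y"
  shows "(\<integral>x. f x * g x \<partial>haar_pow) = (\<integral>x. f x \<partial>haar_pow) * (\<integral>x. g x \<partial>haar_pow)"
proof -
  have 1: "f (merge_coords S (x, y)) = f x" for x y by (rule fS) (simp add: merge_coords_def)
  have 2: "g (merge_coords S (x, y)) = g y" for x y by (rule gS) (simp add: merge_coords_def)
  have "(\<integral>x. f x * g x \<partial>haar_pow) =
      (\<integral>x. (\<integral>y. f (merge_coords S (x, y)) * g (merge_coords S (x, y)) \<partial>haar_pow) \<partial>haar_pow)"
  proof (rule integral_merge_coords(1)[of _ "\<bar>B\<bar> * \<bar>B'\<bar>"])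
    show "(\<lambda>x. f x * g x) \<in> borel_measurable haar_pow" using f g by measurable
    show "\<bar>f x * g x\<bar> \<le> \<bar>B\<bar> * \<bar>B'\<bar>" if "x \<in> space haar_pow" for x
      unfolding abs_mult using Bf[OF that] Bg[OF that] by (intro mult_mono) auto
  qed
  then show ?thesis by (simp add: 1 2)
qed

lemma var_space_eq: "(var_space :: (var_label \<Rightarrow> 'a) measure) = haar_pow"
  by (simp add: var_space_def haar_pow_def)

end

section \<open>Infinite integral matrices\<close>

lemma inf_mult_eq_sum:
  assumes "finite K" "\<And>l. l \<notin> K \<Longrightarrow> A i l * B l j = 0"
  shows "inf_mult A B i j = (\<Sum>l\<in>K. A i l * B l j)"
  unfolding inf_mult_def using assms by (intro sum.mono_neutral_left) auto

text \<open>Invertibility at level \<open>N\<close> with the inverse carried along as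
  \<open>h\<close>: both matrices are the identity outside the leading block. The infinite products
  of \<open>GL_inf\<close> become sums over \<open>l < N\<close>, and \<open>GL_inv\<close> need not
  be unfolded again.\<close>

definition GL_pair ::
    "nat \<Rightarrow> 'a::nonarch_local_field inf_matrix \<Rightarrow> 'a inf_matrix \<Rightarrow> bool" where
  "GL_pair N g h \<longleftrightarrow>
     (\<forall>i j. g i j \<in> ring_of_integers \<and> h i j \<in> ring_of_integers) \<and>
     (\<forall>i j. N \<le> i \<or> N \<le> j \<longrightarrow> g i j = inf_id i j \<and> h i j = inf_id i j) \<and>
     (\<forall>i<N. \<forall>j<N. (\<Sum>l<N. g i l * h l j) = inf_id i j \<and> (\<Sum>l<N. h i l * g l j) = inf_id i j)"

lemma GL_pair_sym: "GL_pair N g h \<Longrightarrow> GL_pair N h g"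
  by (simp add: GL_pair_def)

lemma inf_id_sym: "inf_id i j = inf_id j i"
  by (auto simp: inf_id_def)

lemma GL_pair_transpose: "GL_pair N g h \<Longrightarrow> GL_pair N (\<lambda>i j. g j i) (\<lambda>i j. h j i)"
  unfolding GL_pair_def by (auto simp: inf_id_def mult.commute)

lemma inf_id_sum [simp]:
  fixes f :: "nat \<Rightarrow> 'a::nonarch_local_field"
  shows "finite K \<Longrightarrow> (\<Sum>l\<in>K. inf_id i l * f l) = (if i \<in> K then f i else 0)"
    "finite K \<Longrightarrow> (\<Sum>l\<in>K. f l * inf_id l i) = (if i \<in> K then f i else 0)"
  by (simp_all add: inf_id_def if_distrib[where f="\<lambda>x. x * _"] if_distrib[where f="\<lambda>x. _ * x"] cong: if_cong)

lemma GL_pair_mono: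
  assumes "GL_pair N g h" "N \<le> K"
  shows "GL_pair K g h"
proof -
  have *: "(\<Sum>l<K. x i l * y l j) = inf_id i j"
    if xy: "GL_pair N x y" and ij: "i < K" "j < K" for x y :: "'a inf_matrix" and i j
  proof (cases "i < N \<and> j < N")
    case True
    have "(\<Sum>l<K. x i l * y l j) = (\<Sum>l<N. x i l * y l j)"
      using xy True assms(2) by (intro sum.mono_neutral_right) (auto simp: GL_pair_def inf_id_def)
    then show ?thesis using xy True by (simp add: GL_pair_def)
  next
    case False
    then show ?thesis
    proof (cases "N \<le> i")
      case True
      then have "(\<Sum>l<K. x i l * y l j) = (\<Sum>l<K. inf_id i l * y l j)"
        using xy by (simp add: GL_pair_def)
      then show ?thesis using True xy ij by (simp add: GL_pair_def)
    next
      case c: False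
      then have "(\<Sum>l<K. x i l * y l j) = (\<Sum>l<K. x i l * inf_id l j)"
        using xy False by (simp add: GL_pair_def)
      then show ?thesis using False c xy ij by (simp add: GL_pair_def)
    qed
  qed
  show ?thesis
    using assms(1) *[OF assms(1)] *[OF GL_pair_sym[OF assms(1)]] assms(2)
    unfolding GL_pair_def by (meson order.trans)
qed

lemma GL_pair_finitary: "GL_pair N g h \<Longrightarrow> g \<in> finitary_integral"
proof -
  assume g: "GL_pair N g h"
  have "g i j = inf_id i j" if "2 * N \<le> i + j" for i j
  proof -
    have "N \<le> i \<or> N \<le> j" using that by linarith
    then show ?thesis using g unfolding GL_pair_def by blast
  qed
  then show ?thesis
    using g unfolding finitary_integral_def GL_pair_def by blast
qed

lemma GL_pair_inf_mult:
  assumes "GL_pair N g h"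
  shows "inf_mult g h = inf_id"
proof (intro ext)
  fix i j
  define K where "K = Suc (max N (max i j))"
  have K: "GL_pair K g h" using assms by (rule GL_pair_mono) (simp add: K_def)
  have "inf_mult g h i j = (\<Sum>l<K. g i l * h l j)"
    using K by (intro inf_mult_eq_sum) (auto simp: GL_pair_def inf_id_def K_def)
  then show "inf_mult g h i j = inf_id i j"
    using K by (simp add: GL_pair_def K_def)
qed

lemma GL_pair_of_finitary:
  assumes g: "g \<in> finitary_integral" and h: "h \<in> finitary_integral"
    and gh: "inf_mult g h = inf_id" and hg: "inf_mult h g = inf_id"
  obtains N where "GL_pair N g h"
proof -
  obtain N1 N2 where N: "\<And>i j. i + j \<ge> N1 \<Longrightarrow> g i j = inf_id i j" "\<And>i j. i + j \<ge> N2 \<Longrightarrow> h i j = inf_id i j"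
    using g h unfolding finitary_integral_def by blast
  define N where "N = max N1 N2"
  have out: "g i j = inf_id i j" "h i j = inf_id i j" if "N \<le> i \<or> N \<le> j" for i j
    using that N[of i j] by (auto simp: N_def)
  have "(\<Sum>l<N. g i l * h l j) = inf_id i j" "(\<Sum>l<N. h i l * g l j) = inf_id i j"
    if "i < N" "j < N" for i j
  proof -
    have "g i l * h l j = 0" "h i l * g l j = 0" if "l \<notin> {..<N}" for l
      using out[of i l] that \<open>i < N\<close> by (simp_all add: inf_id_def)
    then have "inf_mult g h i j = (\<Sum>l<N. g i l * h l j)" "inf_mult h g i j = (\<Sum>l<N. h i l * g l j)"
      using inf_mult_eq_sum[OF finite_lessThan, of N g i h j] inf_mult_eq_sum[OF finite_lessThan, of N h i g j]
      by blast+
    then show "(\<Sum>l<N. g i l * h l j) = inf_id i j" "(\<Sum>l<N. h i l * g l j) = inf_id i j"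
      using gh hg by simp_all
  qed
  then have "GL_pair N g h"
    using g h out by (auto simp: GL_pair_def finitary_integral_def)
  then show ?thesis by (rule that)
qed

lemma GL_pair_unique:
  assumes "GL_pair N g h" "GL_pair M g h'"
  shows "h = h'"
proof (intro ext)
  fix i j
  define K where "K = Suc (max (max N M) (max i j))"
  have K: "GL_pair K g h" "GL_pair K g h'"
    using assms by (auto intro: GL_pair_mono simp: K_def)
  have ij: "i < K" "j < K" by (auto simp: K_def)
  have "h i j = (\<Sum>l<K. h i l * inf_id l j)" using ij by simp
  also have "\<dots> = (\<Sum>l<K. h i l * (\<Sum>r<K. g l r * h' r j))"
    using K(2) ij by (intro sum.cong) (auto simp: GL_pair_def)
  also have "\<dots> = (\<Sum>r<K. (\<Sum>l<K. h i l * g l r) * h' r j)"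
    by (simp add: sum_distrib_left sum_distrib_right mult.assoc) (rule sum.swap)
  also have "\<dots> = (\<Sum>r<K. inf_id i r * h' r j)"
    using K(1) ij by (intro sum.cong) (auto simp: GL_pair_def)
  also have "\<dots> = h' i j" using ij by simp
  finally show "h i j = h' i j" .
qed

lemma GL_pair_GL_inf:
  assumes "GL_pair N g h"
  shows "g \<in> GL_inf" "GL_inv g = h"
proof -
  have *: "x \<in> GL_inf" if "GL_pair N x y" for x y :: "'a inf_matrix"
    using that GL_pair_finitary GL_pair_sym GL_pair_inf_mult unfolding GL_inf_def by blast
  show "g \<in> GL_inf" using * assms by blast
  show "GL_inv g = h"
    unfolding GL_inv_def
  proof (rule the_equality)
    show "h \<in> GL_inf \<and> inf_mult g h = inf_id \<and> inf_mult h g = inf_id"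
      using assms * GL_pair_sym GL_pair_inf_mult by blast
    fix h' assume h': "h' \<in> GL_inf \<and> inf_mult g h' = inf_id \<and> inf_mult h' g = inf_id"
    then obtain M where "GL_pair M g h'"
      using GL_pair_of_finitary[of g h'] GL_pair_finitary[OF assms] by (auto simp: GL_inf_def)
    then show "h' = h" using GL_pair_unique assms by blast
  qed
qed

lemma GL_inf_pair:
  assumes "g \<in> GL_inf"
  obtains N where "GL_pair N g (GL_inv g)"
proof -
  obtain h where h: "g \<in> finitary_integral" "h \<in> finitary_integral" "inf_mult g h = inf_id" "inf_mult h g = inf_id"
    using assms by (auto simp: GL_inf_def)
  then obtain N where "GL_pair N g h" using GL_pair_of_finitary by blast
  then show ?thesis using GL_pair_GL_inf(2) that by blast
qed

lemma GL_act_eq: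
  assumes g: "GL_pair N g g'" and h: "GL_pair N h h'" and K: "N \<le> K" "i < K" "j < K"
  shows "GL_act g h M i j = (\<Sum>a<K. \<Sum>b<K. g i a * M a b * h' b j)"
proof -
  have gK: "GL_pair K g g'" and hK: "GL_pair K h h'" using g h K by (auto intro: GL_pair_mono)
  have "GL_act g h M i j = (\<Sum>b<K. inf_mult g M i b * h' b j)"
    unfolding GL_act_def GL_pair_GL_inf(2)[OF h] using hK K
    by (intro inf_mult_eq_sum) (auto simp: GL_pair_def inf_id_def)
  also have "\<dots> = (\<Sum>b<K. (\<Sum>a<K. g i a * M a b) * h' b j)"
  proof (intro sum.cong refl arg_cong2[where f="(*)"])
    fix b
    show "inf_mult g M i b = (\<Sum>a<K. g i a * M a b)"
      using gK K by (intro inf_mult_eq_sum) (auto simp: GL_pair_def inf_id_def)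
  qed
  also have "\<dots> = (\<Sum>a<K. \<Sum>b<K. g i a * M a b * h' b j)"
    by (simp add: sum_distrib_right) (rule sum.swap)
  finally show ?thesis .
qed

definition block_mult :: "nat \<Rightarrow> 'a::nonarch_local_field inf_matrix \<Rightarrow> 'a inf_matrix \<Rightarrow> 'a inf_matrix" where
  "block_mult N A B i j = (if i < N \<and> j < N then \<Sum>l<N. A i l * B l j else inf_id i j)"

lemma sum_mult_assoc:
  fixes B :: "'a::nonarch_local_field inf_matrix"
  shows "(\<Sum>l<N. (\<Sum>k<N. x k * B k l) * y l) = (\<Sum>k<N. x k * (\<Sum>l<N. B k l * y l))"
  by (simp add: sum_distrib_left sum_distrib_right mult.assoc) (rule sum.swap)

lemma GL_pair_block_mult:
  assumes g: "GL_pair N g g'" and h: "GL_pair N h h'"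
  shows "GL_pair N (block_mult N g h) (block_mult N h' g')"
proof -
  have *: "(\<Sum>l<N. block_mult N g h i l * block_mult N h' g' l j) = inf_id i j"
    if g: "GL_pair N g g'" and h: "GL_pair N h h'" and ij: "i < N" "j < N" for g g' h h' :: "'a inf_matrix" and i j
  proof -
    have "(\<Sum>l<N. block_mult N g h i l * block_mult N h' g' l j) =
        (\<Sum>l<N. (\<Sum>k<N. g i k * h k l) * (\<Sum>r<N. h' l r * g' r j))"
      using ij by (intro sum.cong) (auto simp: block_mult_def)
    also have "\<dots> = (\<Sum>k<N. g i k * (\<Sum>l<N. h k l * (\<Sum>r<N. h' l r * g' r j)))"
      by (rule sum_mult_assoc)
    also have "\<dots> = (\<Sum>k<N. g i k * (\<Sum>r<N. (\<Sum>l<N. h k l * h' l r) * g' r j))"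
      by (simp only: sum_mult_assoc)
    also have "\<dots> = (\<Sum>k<N. g i k * (\<Sum>r<N. inf_id k r * g' r j))"
      using h by (intro sum.cong arg_cong2[where f="(*)"] refl) (auto simp: GL_pair_def)
    also have "\<dots> = (\<Sum>k<N. g i k * g' k j)" by simp
    also have "\<dots> = inf_id i j" using g ij by (simp add: GL_pair_def)
    finally show ?thesis .
  qed
  have "block_mult N A B i j \<in> ring_of_integers"
    if "\<And>i j. A i j \<in> ring_of_integers" "\<And>i j. B i j \<in> ring_of_integers" for A B :: "'a inf_matrix" and i j
    using that by (simp add: block_mult_def inf_id_def)
  then show ?thesis
    using *[OF g h] *[OF GL_pair_sym[OF h] GL_pair_sym[OF g]] g h
    unfolding GL_pair_def by (auto simp: block_mult_def)
qed

lemma GL_pair_id: "GL_pair N inf_id inf_id"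
  by (auto simp: GL_pair_def) (auto simp: inf_id_def)

section \<open>Explicit invertible matrices and completion of rows\<close>

lemma GL_pair_perm:
  assumes "\<And>i. \<sigma> (\<sigma> i) = i" "\<And>i. N \<le> i \<Longrightarrow> \<sigma> i = i"
  shows "GL_pair N (\<lambda>i. inf_id (\<sigma> i)) (\<lambda>i. inf_id (\<sigma> i))"
proof -
  have "\<sigma> i < N" if "i < N" for i using assms that by (metis not_less)
  moreover have "i = \<sigma> i" if "N \<le> \<sigma> i" for i using assms that by metis
  ultimately show ?thesis
    using assms by (auto simp: GL_pair_def) (auto simp: inf_id_def)
qed

text \<open>Nonzero entries have their row in \<open>P\<close> and their column outside it, so
  \<open>u\<close> squares to zero and \<open>1 - u\<close> is the inverse of
  \<open>1 + u\<close>.\<close>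

lemma GL_pair_unipotent:
  fixes u :: "'a::nonarch_local_field inf_matrix"
  assumes u: "\<And>i j. u i j \<in> ring_of_integers" "\<And>i j. N \<le> i \<or> N \<le> j \<Longrightarrow> u i j = 0"
    and P: "\<And>i j. u i j \<noteq> 0 \<Longrightarrow> i \<in> P \<and> j \<notin> P"
  shows "GL_pair N (\<lambda>i j. inf_id i j + u i j) (\<lambda>i j. inf_id i j - u i j)"
proof -
  have uu: "u i l * u l j = 0" for i l j using P[of i l] P[of l j] by auto
  have "(\<Sum>l<N. (inf_id i l + u i l) * (inf_id l j - u l j)) = inf_id i j"
    "(\<Sum>l<N. (inf_id i l - u i l) * (inf_id l j + u l j)) = inf_id i j"
    if "i < N" "j < N" for i j
    using that by (simp_all add: ring_distribs sum.distrib sum_subtractf uu)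
  then show ?thesis
    using u by (auto simp: GL_pair_def) (auto simp: inf_id_def)
qed

lemma GL_pair_diag:
  fixes u :: "nat \<Rightarrow> 'a::nonarch_local_field"
  assumes "\<And>i. abs_val (u i) = 1"
  shows "GL_pair N (\<lambda>i j. if i = j \<and> i < N then u i else inf_id i j)
    (\<lambda>i j. if i = j \<and> i < N then 1 / u i else inf_id i j)"
proof -
  have u0: "u i \<noteq> 0" for i using assms[of i] by force
  define d where "d v i j = (if i = j \<and> i < N then v i else inf_id i j)" for v :: "nat \<Rightarrow> 'a" and i j
  have *: "(\<Sum>l<N. d v i l * d w l j) = inf_id i j"
    if "i < N" "j < N" "\<And>i. v i * w i = 1" for i j and v w :: "nat \<Rightarrow> 'a"
  proof -
    have "(\<Sum>l<N. d v i l * d w l j) = (\<Sum>l<N. inf_id i l * (v i * d w l j))"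
      using that by (intro sum.cong) (auto simp: inf_id_def d_def)
    also have "\<dots> = inf_id i j"
      using that by (simp, auto simp: inf_id_def d_def)
    finally show ?thesis .
  qed
  have dO: "d v i j \<in> ring_of_integers" if "\<And>i. abs_val (v i) = 1" for v i j
    using that by (simp add: d_def inf_id_def mem_ring_of_integers)
  have "d u i j \<in> ring_of_integers" "d (\<lambda>i. 1 / u i) i j \<in> ring_of_integers" for i j
    using assms by (auto intro!: dO simp: abs_val_divide)
  moreover have "d v i j = inf_id i j" if "N \<le> i \<or> N \<le> j" for v i j
    using that by (auto simp: d_def)
  ultimately have "GL_pair N (d u) (d (\<lambda>i. 1 / u i))"
    unfolding GL_pair_def using *[of _ _ u "\<lambda>i. 1 / u i"] *[of _ _ "\<lambda>i. 1 / u i" u] u0 by simp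
  moreover have "d v = (\<lambda>i j. if i = j \<and> i < N then v i else inf_id i j)" for v
    by (simp add: d_def fun_eq_iff)
  ultimately show ?thesis by simp
qed

text \<open>Gaussian elimination of the last unknown: the pivot \<open>1 + E m m\<close> is a unit,
  and the reduced system has again coefficients of absolute value below \<open>1\<close> and an
  integral right-hand side.\<close>

lemma solve_near_identity:
  fixes E :: "'a::nonarch_local_field inf_matrix"
  assumes "\<And>i t. i < m \<Longrightarrow> t < m \<Longrightarrow> abs_val (E i t) < 1" "\<And>i. i < m \<Longrightarrow> abs_val (y i) \<le> 1"
  shows "\<exists>z. (\<forall>i. abs_val (z i) \<le> 1) \<and> (\<forall>i<m. z i + (\<Sum>t<m. E i t * z t) = y i)"
  using assms
proof (induction m arbitrary: E y)
  case 0
  then show ?case by (intro exI[of _ "\<lambda>_. 0"]) auto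
next
  case (Suc m)
  define p where "p = 1 + E m m"
  have p: "abs_val p = 1"
    using abs_val_add_eq[of "E m m" 1] Suc.prems(1)[of m m] by (simp add: p_def add.commute)
  then have p0: "p \<noteq> 0" by force
  define E' where "E' i t = E i t - E i m * E m t / p" for i t
  define y' where "y' i = y i - E i m * y m / p" for i
  have "abs_val (E' i t) < 1" if "i < m" "t < m" for i t
  proof -
    have "abs_val (E i m * E m t / p) < 1"
      using Suc.prems(1)[of i m] Suc.prems(1)[of m t] that p mult_strict_mono[of "abs_val (E i m)" 1 "abs_val (E m t)" 1]
      by (simp add: abs_val_divide abs_val_mult)
    then have "abs_val (E i t + - (E i m * E m t / p)) < 1"
      using that Suc.prems(1)[of i t] by (intro abs_val_add_less) auto
    then show ?thesis by (simp add: E'_def)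
  qed
  moreover have "abs_val (y' i) \<le> 1" if "i < m" for i
    unfolding y'_def using Suc.prems(1)[of i m] Suc.prems(2)[of i] Suc.prems(2)[of m] that p
    by (intro abs_val_diff_le) (auto simp: abs_val_divide abs_val_mult intro: mult_le_one)
  ultimately obtain z where z: "\<And>i. abs_val (z i) \<le> 1" "\<And>i. i < m \<Longrightarrow> z i + (\<Sum>t<m. E' i t * z t) = y' i"
    using Suc.IH by blast
  define w where "w = (y m - (\<Sum>t<m. E m t * z t)) / p"
  have w: "abs_val w \<le> 1"
  proof -
    have "abs_val (E m t * z t) \<le> 1" if "t < m" for t
      unfolding abs_val_mult using Suc.prems(1)[of m t] z(1)[of t] that by (intro mult_le_one) auto
    then show ?thesis
      unfolding w_def abs_val_divide p using Suc.prems(2)[of m]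
      by (auto intro!: abs_val_diff_le abs_val_sum_le)
  qed
  have eq: "w * p = y m - (\<Sum>t<m. E m t * z t)" using p0 by (simp add: w_def)
  show ?case
  proof (intro exI[of _ "\<lambda>i. if i = m then w else z i"] conjI allI impI)
    show "abs_val (if i = m then w else z i) \<le> 1" for i using w z by auto
    fix i assume i: "i < Suc m"
    have s: "(\<Sum>t<Suc m. E i t * (if t = m then w else z t)) = (\<Sum>t<m. E i t * z t) + E i m * w" by simp
    show "(if i = m then w else z i) + (\<Sum>t<Suc m. E i t * (if t = m then w else z t)) = y i"
    proof (cases "i = m")
      case True
      then show ?thesis using eq unfolding s by (simp add: p_def algebra_simps)
    next
      case False
      then have im: "i < m" using i by simp
      have "(\<Sum>t<m. E' i t * z t) = (\<Sum>t<m. E i t * z t) - E i m / p * (\<Sum>t<m. E m t * z t)"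
        by (simp add: E'_def left_diff_distrib sum_subtractf sum_distrib_left mult.assoc)
      also have "(\<Sum>t<m. E m t * z t) = y m - w * p" using eq by simp
      finally show ?thesis using z(2)[OF im] False p0 unfolding s
        by (simp add: y'_def field_simps) (simp flip: distrib_left)
    qed
  qed
qed

text \<open>Solving for the columns of the identity gives an integral right inverse; the same for
  the transpose gives a left inverse, and associativity makes the two agree.\<close>

lemma ex_GL_pair_near_identity:
  fixes B :: "'a::nonarch_local_field inf_matrix"
  assumes "m \<le> N" and B: "\<And>i t. i < m \<Longrightarrow> t < m \<Longrightarrow> abs_val (B i t - inf_id i t) < 1"
    "\<And>i t. m \<le> i \<or> m \<le> t \<Longrightarrow> B i t = inf_id i t"
  shows "\<exists>C. GL_pair N B C"
proof -
  have BO: "B i t \<in> ring_of_integers" for i t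
  proof (cases "i < m \<and> t < m")
    case True
    have "abs_val (B i t - inf_id i t + inf_id i t) \<le> 1"
      using B(1) True by (intro abs_val_add_le) (auto simp: inf_id_def less_imp_le)
    then show ?thesis by (simp add: mem_ring_of_integers)
  qed (use B(2) in \<open>auto simp: inf_id_def\<close>)
  have right: "\<exists>C. (\<forall>i j. C i j \<in> ring_of_integers) \<and> (\<forall>i j. m \<le> i \<or> m \<le> j \<longrightarrow> C i j = inf_id i j) \<and>
      (\<forall>i<m. \<forall>j<m. (\<Sum>l<m. B i l * C l j) = inf_id i j)"
    if B: "\<And>i t. i < m \<Longrightarrow> t < m \<Longrightarrow> abs_val (B i t - inf_id i t) < 1" for B :: "'a inf_matrix"
  proof -
    have "\<exists>z. (\<forall>i. abs_val (z i) \<le> 1) \<and> (\<forall>i<m. z i + (\<Sum>t<m. (B i t - inf_id i t) * z t) = inf_id i j)" for j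
      using B by (intro solve_near_identity) (auto simp: inf_id_def)
    then obtain Z where Z: "\<And>j i. abs_val (Z j i) \<le> 1"
      "\<And>j i. i < m \<Longrightarrow> Z j i + (\<Sum>t<m. (B i t - inf_id i t) * Z j t) = inf_id i j"
      by metis
    define C where "C i j = (if i < m \<and> j < m then Z j i else inf_id i j)" for i j
    have "(\<Sum>l<m. B i l * C l j) = inf_id i j" if "i < m" "j < m" for i j
    proof -
      have "(\<Sum>l<m. B i l * C l j) = (\<Sum>l<m. B i l * Z j l)"
        using that by (intro sum.cong) (auto simp: C_def)
      also have "\<dots> = Z j i + (\<Sum>t<m. (B i t - inf_id i t) * Z j t)"
        using that by (simp add: left_diff_distrib sum_subtractf)
      finally show ?thesis using Z(2) that by simp
    qed
    then show ?thesis using Z(1)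
      by (intro exI[of _ C]) (auto simp: C_def mem_ring_of_integers inf_id_def)
  qed
  obtain C where C: "\<And>i j. C i j \<in> ring_of_integers" "\<And>i j. m \<le> i \<or> m \<le> j \<Longrightarrow> C i j = inf_id i j"
      "\<And>i j. i < m \<Longrightarrow> j < m \<Longrightarrow> (\<Sum>l<m. B i l * C l j) = inf_id i j"
    using right[OF B(1)] by blast
  obtain D' where D': "\<And>i j. i < m \<Longrightarrow> j < m \<Longrightarrow> (\<Sum>l<m. B l i * D' l j) = inf_id i j"
  proof -
    have "abs_val (B t i - inf_id i t) < 1" if "i < m" "t < m" for i t
      using B(1)[OF that(2,1)] by (simp add: inf_id_sym)
    then show ?thesis using right[of "\<lambda>i j. B j i"] that by blast
  qed
  define D where "D i j = D' j i" for i j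
  have D: "(\<Sum>l<m. D i l * B l j) = inf_id i j" if "i < m" "j < m" for i j
    using D'[OF that(2,1)] inf_id_sym[of i j, where ?'a='a] by (simp add: D_def mult.commute)
  have DC: "D i j = C i j" if ij: "i < m" "j < m" for i j
  proof -
    have "D i j = (\<Sum>l<m. D i l * inf_id l j)" using ij by simp
    also have "\<dots> = (\<Sum>l<m. D i l * (\<Sum>r<m. B l r * C r j))"
      using C(3) ij by (intro sum.cong) auto
    also have "\<dots> = (\<Sum>r<m. (\<Sum>l<m. D i l * B l r) * C r j)" by (rule sum_mult_assoc[symmetric])
    also have "\<dots> = (\<Sum>r<m. inf_id i r * C r j)" using D ij by (intro sum.cong) auto
    finally show ?thesis using ij by simp
  qed
  have "(\<Sum>l<m. C i l * B l j) = inf_id i j" if "i < m" "j < m" for i j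
    using D[OF that] DC that by simp
  then have "GL_pair m B C"
    using C BO B(2) by (simp add: GL_pair_def)
  then show ?thesis using GL_pair_mono assms(1) by blast
qed

text \<open>Exchanging the good column block with the first one turns the prescribed rows into
  \<open>B\<close> followed by the columns in \<open>u\<close>, with \<open>B\<close> invertible.
  These are the first \<open>m\<close> rows of the product of \<open>1 + u\<close> and
  \<open>B\<close>, because \<open>B\<close> is the identity on the columns where \<open>u\<close>
  lives. The exchange is then undone from the right.\<close>

lemma ex_GL_pair_rows:
  fixes x :: "'a::nonarch_local_field inf_matrix"
  assumes N: "b * m + m \<le> N" and x: "\<And>i a. x i a \<in> ring_of_integers"
    and near: "\<And>i t. i < m \<Longrightarrow> t < m \<Longrightarrow> abs_val (x i (b * m + t) - inf_id i t) < 1"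
  shows "\<exists>g h. GL_pair N g h \<and> (\<forall>i<m. \<forall>a<N. g i a = x i a)"
proof -
  have mN: "m \<le> N" using N by simp
  define \<sigma> where "\<sigma> i = (if i < m then b * m + i else if b * m \<le> i \<and> i < b * m + m then i - b * m else i)" for i
  define c where "c = b * m"
  \<comment> \<open>The good block is the first one or disjoint from it, so the exchange
    \<open>\<sigma>\<close> is an involution.\<close>
  have c: "c = 0 \<or> m \<le> c" "c + m \<le> N" unfolding c_def using N by (cases b, auto)
  have \<sigma>: "\<sigma> (\<sigma> i) = i" "N \<le> i \<Longrightarrow> \<sigma> i = i" for i
    using c unfolding \<sigma>_def c_def[symmetric] by auto
  then have \<sigma>N: "\<sigma> i < N" if "i < N" for i using that by (metis not_less)
  define B where "B i t = (if i < m \<and> t < m then x i (b * m + t) else inf_id i t)" for i t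
  have "abs_val (B i t - inf_id i t) < 1" if "i < m" "t < m" for i t
    using near[OF that] that by (simp add: B_def)
  moreover have "B i t = inf_id i t" if "m \<le> i \<or> m \<le> t" for i t
    using that by (auto simp: B_def)
  ultimately obtain C where C: "GL_pair N B C"
    using ex_GL_pair_near_identity[OF mN, of B] by blast
  define u where "u i a = (if i < m \<and> m \<le> a \<and> a < N then x i (\<sigma> a) else 0)" for i a
  have U: "GL_pair N (\<lambda>i j. inf_id i j + u i j) (\<lambda>i j. inf_id i j - u i j)"
    using mN x by (intro GL_pair_unipotent[of _ _ "{..<m}"]) (auto simp: u_def split: if_splits)
  have P: "GL_pair N (\<lambda>i. inf_id (\<sigma> i)) (\<lambda>i. inf_id (\<sigma> i))"
    using \<sigma> by (intro GL_pair_perm) auto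
  let ?UB = "block_mult N (\<lambda>i j. inf_id i j + u i j) B"
  have UB: "?UB i a = x i (\<sigma> a)" if "i < m" "a < N" for i a
  proof -
    have "?UB i a = B i a + (\<Sum>l<N. u i l * B l a)"
      using that mN by (simp add: block_mult_def ring_distribs sum.distrib)
    also have "(\<Sum>l<N. u i l * B l a) = (\<Sum>l<N. u i l * inf_id l a)"
      by (intro sum.cong) (auto simp: u_def B_def)
    also have "\<dots> = u i a" using that by simp
    finally have "?UB i a = B i a + u i a" .
    moreover have "B i a + u i a = x i (\<sigma> a)"
      using that mN by (auto simp: u_def B_def \<sigma>_def inf_id_def)
    ultimately show ?thesis by (rule trans)
  qed
  have "block_mult N ?UB (\<lambda>i. inf_id (\<sigma> i)) i a = x i a" if "i < m" "a < N" for i a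
  proof -
    have *: "inf_id (\<sigma> l) a = (inf_id l (\<sigma> a) :: 'a)" for l
      using \<sigma>(1) by (auto simp: inf_id_def)
    show ?thesis using that mN \<sigma>N[of a] UB \<sigma>(1) by (simp add: block_mult_def[of _ ?UB] *)
  qed
  then show ?thesis using GL_pair_block_mult[OF GL_pair_block_mult[OF U C] P] by blast
qed

text \<open>The inverse of the completed matrix supplies integral preimages. This is the
  surjectivity that \<open>distr_haar_pow_surj\<close> asks for when a Haar vector is multiplied by
  the rows \<open>x\<close>.\<close>

lemma GL_pair_rows_surj:
  fixes x :: "'a::nonarch_local_field inf_matrix"
  assumes g: "GL_pair N g h" and m: "m \<le> N" and x: "\<And>i a. i < m \<Longrightarrow> a < N \<Longrightarrow> g i a = x i a"
    and y: "\<And>i. y i \<in> ring_of_integers"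
  shows "\<exists>z. (\<forall>a. z a \<in> ring_of_integers) \<and> (\<forall>i<m. (\<Sum>a<N. x i a * z a) = y i)"
proof (intro exI conjI allI impI)
  define z where "z a = (\<Sum>l<N. h a l * y l)" for a
  show "z a \<in> ring_of_integers" for a
    using g y by (auto simp: z_def GL_pair_def)
  fix i assume i: "i < m"
  have "(\<Sum>a<N. x i a * z a) = (\<Sum>a<N. g i a * (\<Sum>l<N. h a l * y l))"
    using x i by (simp add: z_def)
  also have "\<dots> = (\<Sum>l<N. (\<Sum>a<N. g i a * h a l) * y l)"
    by (simp add: sum_distrib_left sum_distrib_right mult.assoc) (rule sum.swap)
  also have "\<dots> = (\<Sum>l<N. inf_id i l * y l)"
    using g i m by (intro sum.cong) (auto simp: GL_pair_def)
  also have "\<dots> = y i" using i m by simp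
  finally show "(\<Sum>a<N. x i a * z a) = y i" .
qed

section \<open>Smith normal form\<close>

definition block_equiv :: "nat \<Rightarrow> 'a::nonarch_local_field inf_matrix \<Rightarrow> 'a inf_matrix \<Rightarrow> bool" where
  "block_equiv N A B \<longleftrightarrow> (\<exists>g g' h h'. GL_pair N g g' \<and> GL_pair N h h' \<and>
     (\<forall>i<N. \<forall>j<N. B i j = (\<Sum>a<N. g i a * (\<Sum>b<N. A a b * h b j))))"

lemma block_equiv_trans:
  assumes "block_equiv N A B" "block_equiv N B C"
  shows "block_equiv N A C"
proof -
  obtain g g' h h' where 1: "GL_pair N g g'" "GL_pair N h h'"
    "\<And>i j. i < N \<Longrightarrow> j < N \<Longrightarrow> B i j = (\<Sum>a<N. g i a * (\<Sum>b<N. A a b * h b j))"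
    using assms(1) unfolding block_equiv_def by blast
  obtain x x' y y' where 2: "GL_pair N x x'" "GL_pair N y y'"
    "\<And>i j. i < N \<Longrightarrow> j < N \<Longrightarrow> C i j = (\<Sum>a<N. x i a * (\<Sum>b<N. B a b * y b j))"
    using assms(2) unfolding block_equiv_def by blast
  have "C i j = (\<Sum>a<N. block_mult N x g i a * (\<Sum>b<N. A a b * block_mult N h y b j))"
    if ij: "i < N" "j < N" for i j
  proof -
    have "C i j = (\<Sum>a<N. x i a * (\<Sum>b<N. (\<Sum>c<N. g a c * (\<Sum>d<N. A c d * h d b)) * y b j))"
      using 1 2 ij by simp
    also have "\<dots> = (\<Sum>a<N. x i a * (\<Sum>c<N. g a c * (\<Sum>d<N. A c d * (\<Sum>b<N. h d b * y b j))))"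
      by (simp only: sum_mult_assoc)
    also have "\<dots> = (\<Sum>c<N. (\<Sum>a<N. x i a * g a c) * (\<Sum>d<N. A c d * (\<Sum>b<N. h d b * y b j)))"
      by (rule sum_mult_assoc[symmetric])
    finally show ?thesis using ij by (simp add: block_mult_def)
  qed
  then show ?thesis
    unfolding block_equiv_def using GL_pair_block_mult[OF 2(1) 1(1)] GL_pair_block_mult[OF 1(2) 2(2)] by blast
qed

lemma block_equiv_left:
  assumes "GL_pair N g g'" "\<And>i j. i < N \<Longrightarrow> j < N \<Longrightarrow> B i j = (\<Sum>a<N. g i a * A a j)"
  shows "block_equiv N A B"
  unfolding block_equiv_def using assms GL_pair_id[of N] by (intro exI[of _ g] exI[of _ g'] exI[of _ inf_id]) auto

lemma block_equiv_right:
  assumes "GL_pair N h h'" "\<And>i j. i < N \<Longrightarrow> j < N \<Longrightarrow> B i j = (\<Sum>b<N. A i b * h b j)"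
  shows "block_equiv N A B"
  unfolding block_equiv_def
  using assms GL_pair_id[of N] 
  by (intro exI[of _ inf_id] exI[of _ h] exI[of _ h']) auto

lemma block_equiv_refl: "block_equiv N A A"
  by (rule block_equiv_left[OF GL_pair_id]) simp

text \<open>One step of the diagonalisation: an entry of largest absolute value in the remaining
  block is moved to position \<open>t\<close>. All quotients by this pivot are integral, so clearing
  its row and column stays inside the invertible integral matrices. The domination hypothesis is
  carried along to make the final diagonal decreasing in absolute value.\<close>

lemma smith_step:
  fixes A :: "'a::nonarch_local_field inf_matrix"
  assumes t: "t < N"
    and diag: "\<And>i j. i < N \<Longrightarrow> j < N \<Longrightarrow> i \<noteq> j \<Longrightarrow> i < t \<or> j < t \<Longrightarrow> A i j = 0"
    and dom: "\<And>s i j. s < t \<Longrightarrow> s \<le> i \<Longrightarrow> i < N \<Longrightarrow> s \<le> j \<Longrightarrow> j < N \<Longrightarrow> abs_val (A i j) \<le> abs_val (A s s)"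
  obtains B where "block_equiv N A B"
    "\<And>i j. i < N \<Longrightarrow> j < N \<Longrightarrow> i \<noteq> j \<Longrightarrow> i < Suc t \<or> j < Suc t \<Longrightarrow> B i j = 0"
    "\<And>s i j. s < Suc t \<Longrightarrow> s \<le> i \<Longrightarrow> i < N \<Longrightarrow> s \<le> j \<Longrightarrow> j < N \<Longrightarrow> abs_val (B i j) \<le> abs_val (B s s)"
proof -
  let ?S = "{t..<N} \<times> {t..<N}"
  let ?v = "\<lambda>p. abs_val (A (fst p) (snd p))"
  have "Max (?v ` ?S) \<in> ?v ` ?S" using t by (intro Max_in) auto
  then obtain r c where rc: "r \<in> {t..<N}" "c \<in> {t..<N}" "abs_val (A r c) = Max (?v ` ?S)"
    by auto
  have max: "abs_val (A i j) \<le> abs_val (A r c)" if "i \<in> {t..<N}" "j \<in> {t..<N}" for i j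
    unfolding rc(3) using that by (intro Max_ge) force+
  define \<sigma> where "\<sigma> i = (if i = t then r else if i = r then t else i)" for i
  define \<tau> where "\<tau> i = (if i = t then c else if i = c then t else i)" for i
  have \<sigma>: "\<sigma> (\<sigma> i) = i" "N \<le> i \<Longrightarrow> \<sigma> i = i" "i < t \<Longrightarrow> \<sigma> i = i" "t \<le> i \<Longrightarrow> t \<le> \<sigma> i" "i < N \<Longrightarrow> \<sigma> i < N" for i
    using rc t by (auto simp: \<sigma>_def)
  have \<tau>: "\<tau> (\<tau> i) = i" "N \<le> i \<Longrightarrow> \<tau> i = i" "i < t \<Longrightarrow> \<tau> i = i" "t \<le> i \<Longrightarrow> t \<le> \<tau> i" "i < N \<Longrightarrow> \<tau> i < N" for i
    using rc t by (auto simp: \<tau>_def)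
  define A1 where "A1 i j = A (\<sigma> i) (\<tau> j)" for i j
  have "block_equiv N A (\<lambda>i. A (\<sigma> i))"
    using \<sigma> by (intro block_equiv_left[OF GL_pair_perm[of \<sigma>]]) auto
  moreover have "block_equiv N (\<lambda>i. A (\<sigma> i)) A1"
  proof (rule block_equiv_right[OF GL_pair_perm[of \<tau>]])
    fix i j assume "i < N" "j < N"
    have "inf_id (\<tau> b) j = (inf_id b (\<tau> j) :: 'a)" for b using \<tau>(1) by (auto simp: inf_id_def)
    then show "A1 i j = (\<Sum>b<N. A (\<sigma> i) b * inf_id (\<tau> b) j)"
      using \<tau>(5)[OF \<open>j < N\<close>] by (simp add: A1_def)
  qed (use \<tau> in auto)
  ultimately have eq1: "block_equiv N A A1" by (rule block_equiv_trans)
  have diag1: "A1 i j = 0" if "i < N" "j < N" "i \<noteq> j" "i < t \<or> j < t" for i j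
    unfolding A1_def
  proof (rule diag)
    show "\<sigma> i < N" "\<tau> j < N" using that \<sigma> \<tau> by auto
    show "\<sigma> i < t \<or> \<tau> j < t" using that \<sigma>(3) \<tau>(3) by auto
    show "\<sigma> i \<noteq> \<tau> j"
      using that \<sigma>(3)[of i] \<tau>(3)[of j] \<sigma>(4)[of i] \<tau>(4)[of j] by (cases "i < t"; cases "j < t") auto
  qed
  have dom1: "abs_val (A1 i j) \<le> abs_val (A1 s s)" if "s \<le> t" "s \<le> i" "i < N" "s \<le> j" "j < N" for s i j
  proof (cases "s = t")
    case True
    then have "abs_val (A1 i j) \<le> abs_val (A r c)"
      unfolding A1_def using that \<sigma>(4,5) \<tau>(4,5) by (intro max) auto
    then show ?thesis using True by (simp add: A1_def \<sigma>_def \<tau>_def)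
  next
    case False
    then have s: "s < t" using that by simp
    have "s \<le> \<sigma> i" "s \<le> \<tau> j"
      using that s \<sigma>(3,4)[of i] \<tau>(3,4)[of j] by (metis le_trans less_imp_le not_less)+
    then show ?thesis unfolding A1_def using that s \<sigma>(3,5) \<tau>(3,5) dom[OF s, of "\<sigma> i" "\<tau> j"] by simp
  qed
  show ?thesis
  proof (cases "A1 t t = 0")
    case True
    \<comment> \<open>If the largest entry vanishes, so does the whole remaining block, and there is
      nothing left to clear.\<close>
    then have z: "A1 i j = 0" if "t \<le> i" "i < N" "t \<le> j" "j < N" for i j
      using dom1[of t i j] that abs_val_nonneg[of "A1 i j"] by (metis abs_val_0 abs_val_eq_0 le_refl order_antisym)
    show ?thesis
    proof (rule that[OF eq1])
      show "A1 i j = 0" if "i < N" "j < N" "i \<noteq> j" "i < Suc t \<or> j < Suc t" for i j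
        using diag1[OF that(1-3)] z[of i j] that by (cases "i < t \<or> j < t") auto
    qed (use dom1 in auto)
  next
    case p: False
    define u where "u i a = (if a = t \<and> t < i \<and> i < N then - A1 i t / A1 t t else 0)" for i a
    define w where "w b j = (if b = t \<and> t < j \<and> j < N then - A1 t j / A1 t t else 0)" for b j
    have q1: "abs_val (A1 i t / A1 t t) \<le> 1" "abs_val (A1 t i / A1 t t) \<le> 1" if "t < i" "i < N" for i
      using dom1[of t i t] dom1[of t t i] that t p by (simp_all add: abs_val_divide divide_le_eq_1)
    have U: "GL_pair N (\<lambda>i j. inf_id i j + u i j) (\<lambda>i j. inf_id i j - u i j)"
      using q1 t by (intro GL_pair_unipotent[of _ _ "- {t}"]) (auto simp: u_def mem_ring_of_integers abs_val_divide split: if_splits)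
    have W: "GL_pair N (\<lambda>i j. inf_id i j + w i j) (\<lambda>i j. inf_id i j - w i j)"
      using q1 t by (intro GL_pair_unipotent[of _ _ "{t}"]) (auto simp: w_def mem_ring_of_integers abs_val_divide split: if_splits)
    define A2 where "A2 i j = A1 i j + u i t * A1 t j" for i j
    define B where "B i j = A2 i j + A2 i t * w t j" for i j
    have su: "(\<Sum>a<N. u i a * f a) = u i t * f t" for i and f :: "nat \<Rightarrow> 'a"
    proof -
      have "(\<Sum>a<N. u i a * f a) = (\<Sum>a\<in>{t}. u i a * f a)"
        using t by (intro sum.mono_neutral_right) (auto simp: u_def)
      then show ?thesis by simp
    qed
    have sw: "(\<Sum>a<N. f a * w a i) = f t * w t i" for i and f :: "nat \<Rightarrow> 'a"
    proof -
      have "(\<Sum>a<N. f a * w a i) = (\<Sum>a\<in>{t}. f a * w a i)"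
        using t by (intro sum.mono_neutral_right) (auto simp: w_def)
      then show ?thesis by simp
    qed
    have "block_equiv N A1 A2"
      by (rule block_equiv_left[OF U]) (simp add: ring_distribs sum.distrib su A2_def)
    moreover have "block_equiv N A2 B"
      by (rule block_equiv_right[OF W]) (simp add: ring_distribs sum.distrib sw B_def)
    ultimately have eq: "block_equiv N A B" using eq1 block_equiv_trans by blast
    have A2t: "A2 i t = (if i = t then A1 t t else 0)" if "i < N" for i
      using that diag1[of i t] t p by (cases i t rule: linorder_cases) (auto simp: A2_def u_def)
    \<comment> \<open>Row and column \<open>t\<close> are cleared and the remaining block becomes
      the Schur complement of the pivot. Its entries keep the old bounds, since the correction is an
      integral multiple of an entry that already satisfies them.\<close>
    have B_eq: "B i j = (if i < t \<or> j < t then A1 i j else if i = t \<or> j = t then (if i = j then A1 t t else 0)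
        else A1 i j - A1 i t / A1 t t * A1 t j)" if ij: "i < N" "j < N" for i j
    proof -
      have "u i t * A1 t j = 0" if "i < t \<or> j < t"
        using that diag1[of t j] t ij by (auto simp: u_def)
      moreover have "w t j = 0" if "j \<le> t" using that by (auto simp: w_def)
      ultimately show ?thesis
        using A2t[OF ij(1)] A2t[OF t] ij t p unfolding B_def
        by (cases i t rule: linorder_cases; cases j t rule: linorder_cases)
          (auto simp: A2_def u_def w_def)
    qed
    have Bss: "B s s = A1 s s" if "s \<le> t" for s using B_eq[of s s] that t by auto
    have "B i j = 0" if "i < N" "j < N" "i \<noteq> j" "i < Suc t \<or> j < Suc t" for i j
      using B_eq[of i j] diag1[of i j] that by auto
    moreover have "abs_val (B i j) \<le> abs_val (B s s)"
      if s: "s < Suc t" and i: "s \<le> i" "i < N" and j: "s \<le> j" "j < N" for s i j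
    proof -
      have A: "abs_val (A1 i j) \<le> abs_val (A1 s s)" "abs_val (A1 t t) \<le> abs_val (A1 s s)"
        "abs_val (A1 t j) \<le> abs_val (A1 s s)"
        using dom1 s i j t by auto
      have "abs_val (A1 i t / A1 t t * A1 t j) \<le> abs_val (A1 s s)" if "t < i"
        using mult_mono[OF q1(1)[OF that i(2)] A(3)] unfolding abs_val_mult by simp
      then show ?thesis
        using A B_eq[OF i(2) j(2)] Bss[of s] s by (auto intro: abs_val_diff_le)
    qed
    ultimately show ?thesis using eq by (intro that[of B]) auto
  qed
qed

lemma smith_normal_form:
  fixes A :: "'a::nonarch_local_field inf_matrix"
  obtains d where "block_equiv N A (\<lambda>i j. if i = j then d i else 0)"
    "\<And>i j. i \<le> j \<Longrightarrow> j < N \<Longrightarrow> abs_val (d j) \<le> abs_val (d i)"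
proof -
  define P where "P t B \<longleftrightarrow>
    (\<forall>i j. i < N \<longrightarrow> j < N \<longrightarrow> i \<noteq> j \<longrightarrow> i < t \<or> j < t \<longrightarrow> B i j = 0) \<and>
    (\<forall>s i j. s < t \<longrightarrow> s \<le> i \<longrightarrow> i < N \<longrightarrow> s \<le> j \<longrightarrow> j < N \<longrightarrow> abs_val (B i j) \<le> abs_val (B s s))"
    for t and B :: "'a inf_matrix"
  have step: "\<exists>C. block_equiv N B C \<and> P (Suc t) C" if t: "t < N" and B: "P t B" for t B
  proof (rule smith_step[OF t, of B])
    show "B i j = 0" if "i < N" "j < N" "i \<noteq> j" "i < t \<or> j < t" for i j
      using B that unfolding P_def by blast
    show "abs_val (B i j) \<le> abs_val (B s s)" if "s < t" "s \<le> i" "i < N" "s \<le> j" "j < N" for s i j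
      using B that unfolding P_def by blast
    fix C assume "block_equiv N B C"
      "\<And>i j. i < N \<Longrightarrow> j < N \<Longrightarrow> i \<noteq> j \<Longrightarrow> i < Suc t \<or> j < Suc t \<Longrightarrow> C i j = 0"
      "\<And>s i j. s < Suc t \<Longrightarrow> s \<le> i \<Longrightarrow> i < N \<Longrightarrow> s \<le> j \<Longrightarrow> j < N \<Longrightarrow> abs_val (C i j) \<le> abs_val (C s s)"
    then show "\<exists>C. block_equiv N B C \<and> P (Suc t) C"
      unfolding P_def by (intro exI[of _ C] conjI allI impI) (assumption | rule refl)+
  qed
  have "\<exists>B. block_equiv N A B \<and> P t B" if "t \<le> N" for t
    using that
  proof (induction t)
    case 0
    then show ?case using block_equiv_refl[of N A] by (intro exI[of _ A]) (simp add: P_def)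
  next
    case (Suc t)
    then show ?case using step[of t] block_equiv_trans[of N A] by (metis Suc_leD Suc_le_lessD)
  qed
  from this[OF order.refl] obtain B where B: "block_equiv N A B" "P N B"
    by blast
  show ?thesis
  proof (rule that[of "\<lambda>i. B i i"])
    have "block_equiv N B (\<lambda>i j. if i = j then B i i else 0)"
      using B(2) unfolding P_def by (intro block_equiv_left[OF GL_pair_id]) simp
    then show "block_equiv N A (\<lambda>i j. if i = j then B i i else 0)"
      using B(1) block_equiv_trans by blast
    show "abs_val (B j j) \<le> abs_val (B i i)" if "i \<le> j" "j < N" for i j
      using B(2) that unfolding P_def by simp
  qed
qed

section \<open>The parameter space\<close>

lemma Fin_less_iff [simp]: "Fin a < Fin b \<longleftrightarrow> a < b" "MInfty < Fin b" "\<not> x < MInfty" "\<not> Fin a \<le> MInfty"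
  by (auto simp: less_int_minf_def)

lemma MInfty_le [simp]: "MInfty \<le> x" and le_MInfty_iff [simp]: "x \<le> MInfty \<longleftrightarrow> x = MInfty"
  by simp (cases x; simp)

lemma MInfty_less_iff: "MInfty < x \<longleftrightarrow> (\<exists>a. x = Fin a)"
  by (cases x) auto

lemma lessThan_Fin: "{..<Fin c} = {..Fin (c - 1)}"
proof -
  have "x < Fin c \<longleftrightarrow> x \<le> Fin (c - 1)" for x by (cases x) auto
  then show ?thesis by auto
qed

lemma open_atMost_Fin: "open {..Fin c}"
  using lessThan_Fin[of "c + 1"] open_lessThan[of "Fin (c + 1)"] by simp

lemma open_singleton_Fin: "open {Fin c}"
proof -
  have "{Fin c} = {..Fin c} \<inter> {Fin (c - 1)<..}"
  proof -
    have "x \<le> Fin c \<and> Fin (c - 1) < x \<longleftrightarrow> x = Fin c" for x by (cases x) auto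
    then show ?thesis by auto
  qed
  then show ?thesis using open_atMost_Fin by (simp add: open_Int)
qed

text \<open>If bounded below by an integer, a decreasing sequence attains its minimum and stays
  there; otherwise it falls below every integer. In both cases \<open>lim k\<close> is a true limit
  and not an unspecified value.\<close>

lemma decseq_int_minf_cases:
  assumes k: "decseq (k :: nat \<Rightarrow> int_minf)"
  obtains (finite) c N where "lim k = Fin c" "\<And>n. n \<ge> N \<Longrightarrow> k n = Fin c"
  | (infinite) "lim k = MInfty" "\<And>c. \<exists>N. \<forall>n\<ge>N. k n \<le> Fin c"
proof (cases "\<exists>c. \<forall>n. Fin c \<le> k n")
  case True
  then obtain b where b: "\<And>n. Fin b \<le> k n" by blast
  have "\<exists>f. \<forall>n. k n = Fin (f n)"
  proof (rule choice, rule allI)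
    show "\<exists>a. k n = Fin a" for n using b[of n] by (cases "k n") auto
  qed
  then obtain f where f: "\<And>n. k n = Fin (f n)" by blast
  \<comment> \<open>The heights \<open>nat (f n - b)\<close> above the lower bound are natural
    numbers; at an index of least height the sequence can no longer decrease.\<close>
  define m where "m = (LEAST m. m \<in> range (\<lambda>n. nat (f n - b)))"
  have "m \<in> range (\<lambda>n. nat (f n - b))" unfolding m_def by (rule LeastI_ex) blast
  then obtain N where N: "m = nat (f N - b)" by blast
  have "k n = Fin (f N)" if "n \<ge> N" for n
  proof -
    have "m \<le> nat (f n - b)" unfolding m_def by (rule Least_le) blast
    moreover have "b \<le> f n" "b \<le> f N" using b f by (metis less_eq_int_minf.simps(3))+
    moreover have "f n \<le> f N" using decseqD[OF k that] f by simp
    ultimately show ?thesis using N f by simp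
  qed
  moreover from this have "k \<longlonglongrightarrow> Fin (f N)"
    by (intro tendsto_eventually) (auto simp: eventually_sequentially)
  then have "lim k = Fin (f N)" by (rule limI)
  ultimately show ?thesis using finite by blast
next
  case False
  have *: "\<exists>N. \<forall>n\<ge>N. k n \<le> Fin c" for c
  proof -
    obtain N where "\<not> Fin c \<le> k N" using False by blast
    then have "k N \<le> Fin c" by simp
    then show ?thesis using decseqD[OF k] by (meson order_trans)
  qed
  have "k \<longlonglongrightarrow> MInfty"
  proof (rule order_tendstoI)
    fix a assume "MInfty < a"
    then obtain c where c: "a = Fin c" by (auto simp: MInfty_less_iff)
    obtain N where N: "\<forall>n\<ge>N. k n \<le> Fin (c - 1)" using * by blast
    have "k n < a" if "n \<ge> N" for n
      using N that lessThan_Fin[of c] c by blast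
    then show "\<forall>\<^sub>F x in sequentially. k x < a" by (auto simp: eventually_sequentially)
  qed simp
  then have "lim k = MInfty" by (rule limI)
  then show ?thesis using infinite * by blast
qed

lemma decseq_lim_le: "decseq (k :: nat \<Rightarrow> int_minf) \<Longrightarrow> lim k \<le> k n"
proof (cases rule: decseq_int_minf_cases, assumption)
  fix c N assume k: "decseq k" "lim k = Fin c" "\<And>n. n \<ge> N \<Longrightarrow> k n = Fin c"
  then show ?thesis using decseqD[OF k(1), of n "max n N"] by (metis max.cobounded1 max.cobounded2)
qed auto

lemma decseq_shift: "decseq (k :: nat \<Rightarrow> int_minf) \<Longrightarrow> decseq (\<lambda>n. k (n + N))"
  by (simp add: decseq_def)

lemma lim_shift: "decseq (k :: nat \<Rightarrow> int_minf) \<Longrightarrow> lim (\<lambda>n. k (n + N)) = lim k"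
proof -
  assume k: "decseq k"
  have "k \<longlonglongrightarrow> lim k"
    using k
  proof (cases rule: decseq_int_minf_cases)
    case (finite c M)
    then show ?thesis by (intro tendsto_eventually eventually_sequentiallyI[of M]) simp
  next
    case infinite
    show ?thesis unfolding infinite(1)
    proof (rule order_tendstoI)
      fix a assume "MInfty < a"
      then obtain c where c: "a = Fin c" by (auto simp: MInfty_less_iff)
      obtain M where "\<forall>n\<ge>M. k n \<le> Fin (c - 1)" using infinite by blast
      then show "\<forall>\<^sub>F x in sequentially. k x < a"
        using lessThan_Fin[of c] c by (auto simp: eventually_sequentially)
    qed simp
  qed
  then show ?thesis by (intro limI LIMSEQ_ignore_initial_segment)
qed

section \<open>The random matrices\<close>

text \<open>Renumbering \<open>X\<close> and \<open>Y\<close> while keeping \<open>Z\<close> makes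
  the tail of the defining sum a random matrix for the shifted parameter, which has the same limit.
  Bounds for whole matrices then apply to tails.\<close>

fun shift_vars :: "nat \<Rightarrow> (var_label \<Rightarrow> 'a) \<Rightarrow> var_label \<Rightarrow> 'a" where
  "shift_vars N \<omega> (XVar n i) = \<omega> (XVar (n + N) i)"
| "shift_vars N \<omega> (YVar n j) = \<omega> (YVar (n + N) j)"
| "shift_vars N \<omega> (ZVar i j) = \<omega> (ZVar i j)"

context uniformized_field
begin

lemma abs_val_neg_power_Fin [simp]: "abs_val (neg_power \<pi> (Fin s)) = q powi s"
  by (simp add: abs_val_pi_power_int)

lemma abs_val_neg_power_le: "x \<le> Fin s \<Longrightarrow> abs_val (neg_power \<pi> x) \<le> q powi s"
  by (cases x) (simp_all del: neg_power.simps(2))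

definition rm_term :: "(nat \<Rightarrow> int_minf) \<Rightarrow> (var_label \<Rightarrow> 'a) \<Rightarrow> nat \<Rightarrow> nat \<Rightarrow> nat \<Rightarrow> 'a" where
  "rm_term k \<omega> i j n =
     (if k n > lim k then neg_power \<pi> (k n) * \<omega> (XVar n i) * \<omega> (YVar n j) else 0)"

lemma random_matrix_eq:
  "random_matrix \<pi> k \<omega> i j = (\<Sum>n. rm_term k \<omega> i j n) + neg_power \<pi> (lim k) * \<omega> (ZVar i j)"
  by (simp add: random_matrix_def rm_term_def)

lemma abs_val_rm_term_le:
  assumes "\<omega> \<in> space haar_pow"
  shows "abs_val (rm_term k \<omega> i j n) \<le> abs_val (neg_power \<pi> (k n))"
proof -
  have "abs_val (\<omega> (XVar n i)) * abs_val (\<omega> (YVar n j)) \<le> 1"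
    using abs_val_haar_pow[OF assms] by (intro mult_le_one) auto
  then show ?thesis by (simp add: rm_term_def abs_val_mult mult.assoc mult_left_le)
qed

lemma summable_rm_term:
  assumes \<omega>: "\<omega> \<in> space haar_pow" and k: "decseq k"
  shows "summable (rm_term k \<omega> i j)"
proof (rule summable_nonarch)
  show "rm_term k \<omega> i j \<longlonglongrightarrow> 0"
    using k
  proof (cases rule: decseq_int_minf_cases)
    case (finite c N)
    then have "rm_term k \<omega> i j n = 0" if "n \<ge> N" for n using that by (simp add: rm_term_def)
    then show ?thesis by (intro tendsto_eventually eventually_sequentiallyI[of N])
  next
    case infinite
    show ?thesis
    proof (rule tendstoI)
      fix e :: real assume "0 < e"
      then obtain m where m: "1 / q ^ m < e" by (rule inverse_q_power_lt)
      obtain N where N: "\<forall>n\<ge>N. k n \<le> Fin (- int m)" using infinite by blast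
      have "dist (rm_term k \<omega> i j n) 0 < e" if "n \<ge> N" for n
      proof -
        have "abs_val (rm_term k \<omega> i j n) \<le> q powi (- int m)"
          using abs_val_rm_term_le[OF \<omega>] abs_val_neg_power_le N that by (meson order_trans)
        then show ?thesis using m by (simp add: abs_val_conv_dist power_int_minus inverse_eq_divide)
      qed
      then show "\<forall>\<^sub>F n in sequentially. dist (rm_term k \<omega> i j n) 0 < e"
        by (auto simp: eventually_sequentially)
    qed
  qed
qed

lemma random_matrix_split:
  assumes \<omega>: "\<omega> \<in> space haar_pow" and k: "decseq k"
  shows "random_matrix \<pi> k \<omega> i j = (\<Sum>n<N. rm_term k \<omega> i j n) +
    random_matrix \<pi> (\<lambda>n. k (n + N)) (shift_vars N \<omega>) i j"
proof -
  have "rm_term (\<lambda>n. k (n + N)) (shift_vars N \<omega>) i j = (\<lambda>n. rm_term k \<omega> i j (n + N))"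
    by (rule ext) (simp add: rm_term_def lim_shift[OF k])
  then show ?thesis
    using suminf_split_nonarch(2)[OF summable_rm_term[OF \<omega> k], of i j N]
    by (simp add: random_matrix_eq lim_shift[OF k])
qed

text \<open>Every summand is at most the size given by the first, largest parameter, and the
  ultrametric inequality preserves this bound. Applied to a shifted parameter it controls the tail;
  applied to \<open>k\<close> itself it confines the matrix to a compact set.\<close>

lemma abs_val_random_matrix_le:
  assumes \<omega>: "\<omega> \<in> space haar_pow" and k: "decseq k" and s: "k 0 \<le> Fin s"
  shows "abs_val (random_matrix \<pi> k \<omega> i j) \<le> q powi s"
  unfolding random_matrix_eq
proof (rule abs_val_add_le)
  have "k n \<le> Fin s" for n using decseqD[OF k, of 0 n] s by simp
  then show "abs_val (\<Sum>n. rm_term k \<omega> i j n) \<le> q powi s"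
    using order_trans[OF abs_val_rm_term_le[OF \<omega>] abs_val_neg_power_le]
    by (intro abs_val_suminf_le summable_rm_term[OF \<omega> k]) auto
  have "lim k \<le> Fin s" using decseq_lim_le[OF k, of 0] s by simp
  then have "abs_val (neg_power \<pi> (lim k)) \<le> q powi s" by (rule abs_val_neg_power_le)
  then show "abs_val (neg_power \<pi> (lim k) * \<omega> (ZVar i j)) \<le> q powi s"
    using abs_val_haar_pow[OF \<omega>, of "ZVar i j"] mult_left_le[of "abs_val (\<omega> (ZVar i j))" "abs_val (neg_power \<pi> (lim k))"]
    by (simp add: abs_val_mult)
qed

lemma shift_vars_space: "\<omega> \<in> space haar_pow \<Longrightarrow> shift_vars N \<omega> \<in> space (haar_pow :: (var_label \<Rightarrow> 'a) measure)"
  unfolding in_space_haar_pow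
proof
  fix v assume "\<forall>i. \<omega> i \<in> (ring_of_integers :: 'a set)"
  then show "shift_vars N \<omega> v \<in> ring_of_integers" by (cases v) auto
qed

lemma measurable_random_matrix_entry:
  assumes k: "decseq k"
  shows "(\<lambda>\<omega>. random_matrix \<pi> k \<omega> i j) \<in> borel_measurable haar_pow"
  unfolding random_matrix_eq
proof (intro borel_measurable_add borel_measurable_mult_nonarch borel_measurable_const measurable_haar_pow_component)
  show "(\<lambda>\<omega>. \<Sum>n. rm_term k \<omega> i j n) \<in> borel_measurable haar_pow"
  proof (rule borel_measurable_LIMSEQ_metric)
    show "(\<lambda>N. \<Sum>n<N. rm_term k \<omega> i j n) \<longlonglongrightarrow> (\<Sum>n. rm_term k \<omega> i j n)" if "\<omega> \<in> space haar_pow" for \<omega>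
      by (rule summable_LIMSEQ[OF summable_rm_term[OF that k]])
    show "(\<lambda>\<omega>. \<Sum>n<N. rm_term k \<omega> i j n) \<in> borel_measurable haar_pow" for N
      unfolding rm_term_def by (intro borel_measurable_sum) simp
  qed
qed

lemma borel_measurable_inf_matrixI:
  fixes f :: "'b \<Rightarrow> 'a inf_matrix"
  shows "(\<And>i j. (\<lambda>x. f x i j) \<in> borel_measurable M) \<Longrightarrow> f \<in> borel_measurable M"
  by (intro measurable_coordinatewise_then_product)

lemma continuous_on_entry: "continuous_on UNIV (\<lambda>M::'b \<Rightarrow> 'c \<Rightarrow> 'd::topological_space. M i j)"
  by (rule continuous_on_compose2[OF continuous_on_product_coordinates[of j] continuous_on_product_coordinates[of i]]) simp

lemma measurable_inf_matrix_entry [measurable]: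
  "(\<lambda>M::'a inf_matrix. M i j) \<in> borel_measurable borel"
  by (rule borel_measurable_continuous_onI[OF continuous_on_entry])

lemma measurable_random_matrix [measurable]:
  "decseq k \<Longrightarrow> random_matrix \<pi> k \<in> borel_measurable haar_pow"
  by (intro borel_measurable_inf_matrixI measurable_random_matrix_entry)

lemma mu_eq: "mu \<pi> k = distr haar_pow borel (random_matrix \<pi> k)"
  by (simp add: mu_def var_space_eq)

lemma mu_borel_probs: "decseq k \<Longrightarrow> mu \<pi> k \<in> borel_probs"
  unfolding borel_probs_def mu_eq
  using prob_space.prob_space_distr[OF prob_space_haar_pow measurable_random_matrix] by auto

lemma integral_mu:
  fixes f :: "'a inf_matrix \<Rightarrow> real"
  assumes "decseq k" "f \<in> borel_measurable borel"
  shows "(\<integral>M. f M \<partial>mu \<pi> k) = (\<integral>\<omega>. f (random_matrix \<pi> k \<omega>) \<partial>haar_pow)"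
  unfolding mu_eq using assms by (intro integral_distr) auto

end

section \<open>Invariance\<close>

text \<open>The indices where row \<open>i\<close> of an element of level \<open>N\<close> may be
  nonzero. With it one formula for the action covers indices inside and outside the block.\<close>

definition vrange :: "nat \<Rightarrow> nat \<Rightarrow> nat set" where
  "vrange N i = (if i < N then {..<N} else {i})"

lemma finite_vrange [simp]: "finite (vrange N i)"
  by (simp add: vrange_def)

lemma GL_pair_vrange_left:
  fixes f :: "nat \<Rightarrow> 'a::nonarch_local_field"
  assumes g: "GL_pair N g g'"
  shows "(\<Sum>a\<in>vrange N i. g i a * (\<Sum>c\<in>vrange N a. g' a c * f c)) = f i"
proof (cases "i < N")
  case True
  have "(\<Sum>a\<in>vrange N i. g i a * (\<Sum>c\<in>vrange N a. g' a c * f c)) =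
      (\<Sum>a<N. g i a * (\<Sum>c<N. g' a c * f c))"
    using True by (simp add: vrange_def)
  also have "\<dots> = (\<Sum>c<N. (\<Sum>a<N. g i a * g' a c) * f c)"
    by (rule sum_mult_assoc[symmetric])
  also have "\<dots> = (\<Sum>c<N. inf_id i c * f c)"
    using g True by (intro sum.cong) (auto simp: GL_pair_def)
  finally show ?thesis using True by simp
next
  case False
  then have "g i i = 1" "g' i i = 1" using g by (auto simp: GL_pair_def inf_id_def)
  then show ?thesis using False by (simp add: vrange_def)
qed

lemma GL_pair_vrange_right:
  fixes f :: "nat \<Rightarrow> 'a::nonarch_local_field"
  assumes "GL_pair N h h'"
  shows "(\<Sum>b\<in>vrange N j. h' b j * (\<Sum>d\<in>vrange N b. h d b * f d)) = f j"
  using GL_pair_vrange_left[OF GL_pair_transpose[OF GL_pair_sym[OF assms]]] .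

lemma GL_act_vrange:
  assumes g: "GL_pair N g g'" and h: "GL_pair N h h'"
  shows "GL_act g h M i j = (\<Sum>b\<in>vrange N j. h' b j * (\<Sum>a\<in>vrange N i. g i a * M a b))"
proof -
  have z: "h' b j = 0" if "b \<notin> vrange N j" for b
    using h that by (auto simp: GL_pair_def inf_id_def vrange_def split: if_splits)
  have z': "g i a = 0" if "a \<notin> vrange N i" for a
    using g that by (auto simp: GL_pair_def inf_id_def vrange_def split: if_splits)
  have "GL_act g h M i j = (\<Sum>b\<in>vrange N j. inf_mult g M i b * h' b j)"
    unfolding GL_act_def GL_pair_GL_inf(2)[OF h] using z by (intro inf_mult_eq_sum) auto
  also have "\<dots> = (\<Sum>b\<in>vrange N j. (\<Sum>a\<in>vrange N i. g i a * M a b) * h' b j)"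
    using z' by (intro sum.cong refl arg_cong2[where f="(*)"] inf_mult_eq_sum) auto
  finally show ?thesis by (simp add: mult.commute)
qed

text \<open>The action lifted from matrices to random variables: \<open>X\<close> is multiplied on
  one side, \<open>Y\<close> on the other, \<open>Z\<close> on both. For invertible factors this is
  an additive bijection, so it preserves Haar measure, and invariance of \<open>mu\<close> follows
  from \<open>random_matrix_GL_vars\<close>.\<close>

fun GL_vars :: "nat \<Rightarrow> 'a::nonarch_local_field inf_matrix \<Rightarrow> 'a inf_matrix \<Rightarrow>
    (var_label \<Rightarrow> 'a) \<Rightarrow> var_label \<Rightarrow> 'a" where
  "GL_vars N g h \<omega> (XVar n i) = (\<Sum>a\<in>vrange N i. g i a * \<omega> (XVar n a))"
| "GL_vars N g h \<omega> (YVar n j) = (\<Sum>b\<in>vrange N j. h b j * \<omega> (YVar n b))"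
| "GL_vars N g h \<omega> (ZVar i j) =
    (\<Sum>b\<in>vrange N j. h b j * (\<Sum>a\<in>vrange N i. g i a * \<omega> (ZVar a b)))"

lemma GL_vars_inverse:
  assumes g: "GL_pair N g g'" and h: "GL_pair N h h'"
  shows "GL_vars N g h' (GL_vars N g' h \<omega>) = \<omega>"
proof
  fix v
  show "GL_vars N g h' (GL_vars N g' h \<omega>) v = \<omega> v"
  proof (cases v)
    case (ZVar i j)
    have "(\<Sum>a\<in>vrange N i. g i a * (\<Sum>d\<in>vrange N b. h d b * (\<Sum>c\<in>vrange N a. g' a c * \<omega> (ZVar c d)))) =
        (\<Sum>d\<in>vrange N b. h d b * \<omega> (ZVar i d))" for b
    proof -
      have "(\<Sum>a\<in>vrange N i. g i a * (\<Sum>d\<in>vrange N b. h d b * (\<Sum>c\<in>vrange N a. g' a c * \<omega> (ZVar c d)))) =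
        (\<Sum>d\<in>vrange N b. h d b * (\<Sum>a\<in>vrange N i. g i a * (\<Sum>c\<in>vrange N a. g' a c * \<omega> (ZVar c d))))"
        unfolding sum_distrib_left[of "g _ _"] sum_distrib_left[of "h _ b"]
        by (subst sum.swap) (simp add: mult.left_commute)
      then show ?thesis by (simp only: GL_pair_vrange_left[OF g])
    qed
    then show ?thesis using GL_pair_vrange_right[OF h, of j] by (simp add: ZVar)
  qed (simp_all add: GL_pair_vrange_left[OF g] GL_pair_vrange_right[OF h])
qed

context uniformized_field
begin

lemma measurable_GL_vars:
  fixes g h :: "'a inf_matrix"
  assumes "\<And>i j. g i j \<in> ring_of_integers" "\<And>i j. h i j \<in> ring_of_integers"
  shows "GL_vars N g h \<in> haar_pow \<rightarrow>\<^sub>M haar_pow"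
proof (rule measurable_haar_powI)
  show "(\<lambda>\<omega>. GL_vars N g h \<omega> v) \<in> borel_measurable haar_pow" for v
    by (cases v) (simp_all add: borel_measurable_sum)
  show "GL_vars N g h \<omega> v \<in> ring_of_integers" if "\<omega> \<in> space haar_pow" for \<omega> v
    using that assms by (cases v) (auto simp: in_space_haar_pow)
qed

lemma distr_GL_vars:
  fixes g h :: "'a inf_matrix"
  assumes g: "GL_pair N g g'" and h: "GL_pair N h h'"
  shows "distr haar_pow haar_pow (GL_vars N g h') = haar_pow"
proof (rule distr_haar_pow_surj)
  have O: "g i j \<in> ring_of_integers" "g' i j \<in> ring_of_integers" "h i j \<in> ring_of_integers" "h' i j \<in> ring_of_integers" for i j
    using g h by (auto simp: GL_pair_def)
  show "GL_vars N g h' \<in> haar_pow \<rightarrow>\<^sub>M haar_pow" using O by (intro measurable_GL_vars)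
  show "GL_vars N g h' (\<lambda>i. x i + y i) v = GL_vars N g h' x v + GL_vars N g h' y v" for x y v
    by (cases v) (simp_all add: ring_distribs sum.distrib)
  fix y :: "var_label \<Rightarrow> 'a" assume "y \<in> space haar_pow"
  then have "GL_vars N g' h y \<in> space haar_pow"
    by (rule measurable_space[OF measurable_GL_vars[OF O(2,3)]])
  then show "\<exists>x\<in>space haar_pow. GL_vars N g h' x = y"
    using GL_vars_inverse[OF g h] by blast
qed

lemma random_matrix_GL_vars:
  fixes g h :: "'a inf_matrix"
  assumes g: "GL_pair N g g'" and h: "GL_pair N h h'" and k: "decseq k" and \<omega>: "\<omega> \<in> space haar_pow"
  shows "random_matrix \<pi> k (GL_vars N g h' \<omega>) = GL_act g h (random_matrix \<pi> k \<omega>)"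
proof (intro ext)
  fix i j
  have O: "g i j \<in> ring_of_integers" "h' i j \<in> ring_of_integers" for i j
    using g h by (auto simp: GL_pair_def)
  have T: "GL_vars N g h' \<omega> \<in> space haar_pow"
    using measurable_space[OF measurable_GL_vars[OF O] \<omega>] .
  have t: "rm_term k (GL_vars N g h' \<omega>) i j n =
      (\<Sum>b\<in>vrange N j. h' b j * (\<Sum>a\<in>vrange N i. g i a * rm_term k \<omega> a b n))" for n
  proof (cases "k n > lim k")
    case True
    then show ?thesis
      by (simp add: rm_term_def sum_distrib_left sum_distrib_right mult_ac) (rule sum.swap)
  qed (simp add: rm_term_def)
  have "(\<lambda>n. \<Sum>b\<in>vrange N j. h' b j * (\<Sum>a\<in>vrange N i. g i a * rm_term k \<omega> a b n)) sums
      (\<Sum>b\<in>vrange N j. h' b j * (\<Sum>a\<in>vrange N i. g i a * suminf (rm_term k \<omega> a b)))"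
    by (intro sums_sum sums_mult_nonarch summable_sums summable_rm_term \<omega> k)
  then have "suminf (rm_term k (GL_vars N g h' \<omega>) i j) =
      (\<Sum>b\<in>vrange N j. h' b j * (\<Sum>a\<in>vrange N i. g i a * suminf (rm_term k \<omega> a b)))"
    using ext[of "rm_term k (GL_vars N g h' \<omega>) i j", OF t] by (simp add: sums_iff)
  moreover have "neg_power \<pi> (lim k) * GL_vars N g h' \<omega> (ZVar i j) =
      (\<Sum>b\<in>vrange N j. h' b j * (\<Sum>a\<in>vrange N i. g i a * (neg_power \<pi> (lim k) * \<omega> (ZVar a b))))"
    by (simp add: sum_distrib_left mult_ac)
  ultimately show "random_matrix \<pi> k (GL_vars N g h' \<omega>) i j = GL_act g h (random_matrix \<pi> k \<omega>) i j"
    unfolding GL_act_vrange[OF g h] random_matrix_eq by (simp add: ring_distribs sum.distrib)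
qed

lemma measurable_GL_act:
  assumes g: "GL_pair N g g'" and h: "GL_pair N h h'"
  shows "GL_act g h \<in> (borel :: 'a inf_matrix measure) \<rightarrow>\<^sub>M borel"
  by (rule borel_measurable_inf_matrixI) (simp add: GL_act_vrange[OF g h] borel_measurable_sum)

lemma GL_inf_common_pair:
  assumes "g \<in> (GL_inf :: 'a inf_matrix set)" "h \<in> GL_inf"
  obtains N where "GL_pair N g (GL_inv g)" "GL_pair N h (GL_inv h)"
proof -
  obtain N M where "GL_pair N g (GL_inv g)" "GL_pair M h (GL_inv h)"
    using assms GL_inf_pair by metis
  then show ?thesis using that[of "max N M"] GL_pair_mono by (metis max.cobounded1 max.cobounded2)
qed

lemma GL_invariant_mu:
  assumes k: "decseq k"
  shows "GL_invariant (mu \<pi> k)"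
  unfolding GL_invariant_def
proof (intro ballI)
  fix g h :: "'a inf_matrix" assume "g \<in> GL_inf" "h \<in> GL_inf"
  then obtain N where gh: "GL_pair N g (GL_inv g)" "GL_pair N h (GL_inv h)"
    by (rule GL_inf_common_pair)
  have O: "g i j \<in> ring_of_integers" "GL_inv h i j \<in> ring_of_integers" for i j
    using gh by (auto simp: GL_pair_def)
  have rm: "random_matrix \<pi> k \<in> haar_pow \<rightarrow>\<^sub>M borel" using k by (rule measurable_random_matrix)
  have "distr (mu \<pi> k) borel (GL_act g h) = distr haar_pow borel (\<lambda>\<omega>. GL_act g h (random_matrix \<pi> k \<omega>))"
    unfolding mu_eq by (subst distr_distr[OF measurable_GL_act[OF gh] rm]) (simp add: comp_def)
  also have "\<dots> = distr haar_pow borel (\<lambda>\<omega>. random_matrix \<pi> k (GL_vars N g (GL_inv h) \<omega>))"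
    using random_matrix_GL_vars[OF gh k] by (intro distr_cong) auto
  also have "\<dots> = distr (distr haar_pow haar_pow (GL_vars N g (GL_inv h))) borel (random_matrix \<pi> k)"
    by (subst distr_distr[OF rm measurable_GL_vars[OF O]]) (simp add: comp_def)
  also have "\<dots> = mu \<pi> k" by (simp add: distr_GL_vars[OF gh] mu_eq)
  finally show "distr (mu \<pi> k) borel (GL_act g h) = mu \<pi> k" .
qed

section \<open>Ergodicity\<close>

definition corner_set :: "nat \<Rightarrow> 'a inf_matrix set \<Rightarrow> bool" where
  "corner_set m B \<longleftrightarrow> B \<in> sets borel \<and>
     (\<forall>M M'. (\<forall>i<m. \<forall>j<m. M i j = M' i j) \<longrightarrow> (M \<in> B \<longleftrightarrow> M' \<in> B))"

lemma corner_set_mono: "corner_set m B \<Longrightarrow> m \<le> n \<Longrightarrow> corner_set n B"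
proof -
  assume B: "corner_set m B" and "m \<le> n"
  have "M \<in> B \<longleftrightarrow> M' \<in> B" if "\<forall>i<n. \<forall>j<n. M i j = M' i j" for M M'
  proof -
    have "\<forall>i<m. \<forall>j<m. M i j = M' i j" using that \<open>m \<le> n\<close> by simp
    then show ?thesis using B unfolding corner_set_def by blast
  qed
  then show ?thesis using B unfolding corner_set_def by blast
qed

text \<open>The sets that can be approximated in measure by events of a finite corner form a
  sigma-algebra; finite unions approximate countable ones by continuity of the measure.\<close>

lemma corner_set_approx:
  fixes \<mu> :: "'a inf_matrix measure"
  assumes "prob_space \<mu>" and sets: "sets \<mu> = sets borel" and A: "A \<in> sets borel" and e: "0 < e"
  shows "\<exists>m B. corner_set m B \<and> measure \<mu> (sym_diff A B) < e"
proof -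
  interpret prob_space \<mu> by fact
  define S where "S = {A \<in> sets borel. \<forall>e>0. \<exists>m B. corner_set m B \<and> measure \<mu> (sym_diff A B) < e}"
  have meas: "A \<in> S \<Longrightarrow> A \<in> sets \<mu>" for A by (auto simp: S_def sets)
  have cmeas: "corner_set m B \<Longrightarrow> B \<in> sets \<mu>" for m B by (auto simp: corner_set_def sets)
  have approx: "\<exists>m B. corner_set m B \<and> measure \<mu> (sym_diff A B) < e" if "A \<in> S" "0 < e" for A e
    using that by (simp add: S_def)
  have empty: "{} \<in> S"
    by (auto simp: S_def corner_set_def intro!: exI[of _ "{}"])
  have union: "A \<union> A' \<in> S" if AA: "A \<in> S" "A' \<in> S" for A A'
    unfolding S_def
  proof (intro CollectI conjI allI impI)
    show "A \<union> A' \<in> sets borel" using AA by (auto simp: S_def)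
    fix e :: real assume "0 < e"
    then obtain m B m' B' where B: "corner_set m B" "measure \<mu> (sym_diff A B) < e / 2"
      "corner_set m' B'" "measure \<mu> (sym_diff A' B') < e / 2"
      using approx[OF AA(1), of "e / 2"] approx[OF AA(2), of "e / 2"] by auto
    have [measurable]: "A \<in> sets \<mu>" "A' \<in> sets \<mu>" "B \<in> sets \<mu>" "B' \<in> sets \<mu>"
      using AA B meas cmeas by auto
    have "measure \<mu> (sym_diff (A \<union> A') (B \<union> B')) \<le> measure \<mu> (sym_diff A B \<union> sym_diff A' B')"
      by (intro finite_measure_mono) auto
    also have "\<dots> \<le> measure \<mu> (sym_diff A B) + measure \<mu> (sym_diff A' B')"
      by (intro measure_Un_le) auto
    also have "\<dots> < e" using B by simp
    finally have "measure \<mu> (sym_diff (A \<union> A') (B \<union> B')) < e" .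
    moreover have "corner_set (max m m') (B \<union> B')"
      using corner_set_mono[OF B(1), of "max m m'"] corner_set_mono[OF B(3), of "max m m'"]
      unfolding corner_set_def by auto
    ultimately show "\<exists>n C. corner_set n C \<and> measure \<mu> (sym_diff (A \<union> A') C) < e" by blast
  qed
  have compl: "UNIV - A \<in> S" if AS: "A \<in> S" for A
    unfolding S_def
  proof (intro CollectI conjI allI impI)
    show "UNIV - A \<in> sets borel" using AS by (auto simp: S_def)
    fix e :: real assume "0 < e"
    then obtain m B where B: "corner_set m B" "measure \<mu> (sym_diff A B) < e"
      using approx[OF AS] by blast
    have "sym_diff (UNIV - A) (UNIV - B) = sym_diff A B" by auto
    moreover have "corner_set m (UNIV - B)" using B(1) unfolding corner_set_def by auto
    ultimately show "\<exists>n C. corner_set n C \<and> measure \<mu> (sym_diff (UNIV - A) C) < e"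
      using B(2) by metis
  qed
  have count: "(\<Union>n. A n) \<in> S" if AS: "\<And>n::nat. A n \<in> S" for A
    unfolding S_def
  proof (intro CollectI conjI allI impI)
    show "(\<Union>n. A n) \<in> sets borel" using AS by (auto simp: S_def)
    fix e :: real assume e: "0 < e"
    define U where "U n = (\<Union>i<n. A i)" for n
    have U: "U n \<in> S" for n
    proof (induction n)
      case (Suc n)
      have "U (Suc n) = U n \<union> A n" by (auto simp: U_def less_Suc_eq)
      then show ?case using union[OF Suc AS] by simp
    qed (simp add: U_def empty)
    have UU: "(\<Union>n. U n) = (\<Union>n. A n)" by (auto simp: U_def)
    have "(\<lambda>n. measure \<mu> (U n)) \<longlonglongrightarrow> measure \<mu> (\<Union>n. U n)"
      using meas[OF U] by (intro finite_Lim_measure_incseq incseq_SucI) (auto simp: U_def lessThan_Suc)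
    then obtain n where n: "measure \<mu> (\<Union>n. A n) - e / 2 < measure \<mu> (U n)"
      using order_tendstoD(1)[of _ "measure \<mu> (\<Union>n. A n)" sequentially "measure \<mu> (\<Union>n. A n) - e / 2"] e UU
      by (metis (no_types, lifting) diff_less_eq eventually_sequentially half_gt_zero less_add_same_cancel1 order.refl)
    obtain m B where B: "corner_set m B" "measure \<mu> (sym_diff (U n) B) < e / 2"
      using approx[OF U half_gt_zero[OF e]] by blast
    have Usub: "U n \<subseteq> (\<Union>n. A n)" by (auto simp: U_def)
    have [measurable]: "(\<Union>n. A n) \<in> sets \<mu>" "U n \<in> sets \<mu>" "B \<in> sets \<mu>"
      using meas[OF AS] meas[OF U] cmeas[OF B(1)] by auto
    have "measure \<mu> (sym_diff (\<Union>n. A n) B) \<le> measure \<mu> (((\<Union>n. A n) - U n) \<union> sym_diff (U n) B)"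
      using Usub by (intro finite_measure_mono) auto
    also have "\<dots> \<le> measure \<mu> ((\<Union>n. A n) - U n) + measure \<mu> (sym_diff (U n) B)"
      by (intro measure_Un_le) auto
    also have "measure \<mu> ((\<Union>n. A n) - U n) = measure \<mu> (\<Union>n. A n) - measure \<mu> (U n)"
      using Usub by (intro finite_measure_Diff) auto
    finally have "measure \<mu> (sym_diff (\<Union>n. A n) B) < e" using n B by simp
    then show "\<exists>n C. corner_set n C \<and> measure \<mu> (sym_diff (\<Union>n. A n) C) < e" using B by blast
  qed
  have sig: "sigma_algebra UNIV S"
    unfolding sigma_algebra_iff2 using empty compl count by (auto simp: image_subset_iff)
  define N where "N = sigma UNIV S"
  have N: "sets N = S" "space N = UNIV"
    using sigma_algebra.sigma_sets_eq[OF sig] by (simp_all add: N_def)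
  \<comment> \<open>All entries are measurable for the sigma-algebra of approximable sets, so the
    identity map is Borel measurable on it; that is, every Borel set is approximable.\<close>
  have "(\<lambda>M. M) \<in> N \<rightarrow>\<^sub>M borel"
  proof (rule borel_measurable_inf_matrixI, rule measurableI)
    fix i j and X :: "'a set" assume X: "X \<in> sets borel"
    have c: "corner_set (Suc (max i j)) ((\<lambda>M. M i j) -` X)"
      using measurable_sets[OF measurable_inf_matrix_entry X, of i j] by (auto simp: corner_set_def)
    then have "(\<lambda>M. M i j) -` X \<in> S"
      unfolding S_def using c by (auto simp: corner_set_def intro!: exI[of _ "Suc (max i j)"] exI[of _ "(\<lambda>M. M i j) -` X"])
    then show "(\<lambda>M. M i j) -` X \<inter> space N \<in> sets N" using N by simp
  qed simp
  from measurable_sets[OF this A] have "A \<in> S" using N by simp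
  then show ?thesis using approx e by blast
qed

text \<open>The permutation that swaps the first two index blocks of length \<open>m\<close> belongs
  to the group. It fixes the invariant set \<open>A\<close> and moves an approximating corner event
  \<open>B\<close> to an event \<open>B'\<close> about a disjoint block. So the measure of
  \<open>A\<close> is close to that of \<open>B \<inter> B'\<close>, which is the square of the
  measure of \<open>B\<close> and thus close to the square of that of \<open>A\<close>.\<close>

lemma ergodic_mu:
  assumes k: "decseq k" and A: "A \<in> sets borel" "GL_invariant_set A"
  shows "measure (mu \<pi> k) A = 0 \<or> measure (mu \<pi> k) A = 1"
proof -
  let ?\<mu> = "mu \<pi> k"
  have \<mu>: "prob_space ?\<mu>" "sets ?\<mu> = sets borel"
    using mu_borel_probs[OF k] by (auto simp: borel_probs_def)
  interpret prob_space ?\<mu> by fact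
  have sp: "space ?\<mu> = UNIV" using sets_eq_imp_space_eq[OF \<mu>(2)] by simp
  interpret H: prob_space "haar_pow :: (var_label \<Rightarrow> 'a) measure" by (rule prob_space_haar_pow)
  have rm[measurable]: "random_matrix \<pi> k \<in> haar_pow \<rightarrow>\<^sub>M borel" using k by (rule measurable_random_matrix)
  let ?a = "measure ?\<mu> A"
  \<comment> \<open>A contribution \<open>2 * e\<close> comes from replacing \<open>A\<close> by
    \<open>B \<inter> B'\<close>, another \<open>2 * e\<close> from replacing the square of the
    measure of \<open>B\<close> by that of \<open>A\<close>.\<close>
  have bound: "\<bar>?a - ?a * ?a\<bar> \<le> 4 * e" if e: "0 < e" for e
  proof -
    obtain m B where B: "corner_set m B" "measure ?\<mu> (sym_diff A B) < e"
      using corner_set_approx[OF \<mu> A(1) e] by blast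
    have Bs[measurable]: "B \<in> sets borel" using B by (auto simp: corner_set_def)
    define \<sigma> where "\<sigma> i = (if i < m then i + m else if i < 2 * m then i - m else i)" for i
    have \<sigma>: "\<sigma> (\<sigma> i) = i" "2 * m \<le> i \<Longrightarrow> \<sigma> i = i" for i by (auto simp: \<sigma>_def)
    define P where "P i = (inf_id (\<sigma> i) :: nat \<Rightarrow> 'a)" for i
    have P: "GL_pair (2 * m) P P" unfolding P_def using \<sigma> by (intro GL_pair_perm)
    define \<tau> where "\<tau> = GL_act P P"
    have \<tau>: "\<tau> M i j = M (\<sigma> i) (\<sigma> j)" for M i j
    proof -
      have \<sigma>v: "\<sigma> i \<in> vrange (2 * m) i" for i by (auto simp: vrange_def \<sigma>_def)
      have "P b j = inf_id b (\<sigma> j)" for b using \<sigma>(1) by (auto simp: P_def inf_id_def)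
      then show ?thesis
        unfolding \<tau>_def GL_act_vrange[OF P P] using \<sigma>v
        by (simp add: P_def) (simp add: mult.commute[of "inf_id _ (\<sigma> j)"])
    qed
    have \<tau>m[measurable]: "\<tau> \<in> borel \<rightarrow>\<^sub>M borel" unfolding \<tau>_def by (rule measurable_GL_act[OF P P])
    have \<tau>\<tau>: "\<tau> (\<tau> M) = M" for M by (intro ext) (simp add: \<tau> \<sigma>)
    have \<tau>A: "\<tau> -` A = A"
    proof -
      have "\<tau> ` A = A" using A(2) GL_pair_GL_inf(1)[OF P] by (simp add: GL_invariant_set_def \<tau>_def)
      then show ?thesis using \<tau>\<tau> by (metis (no_types, lifting) image_eqI set_eqI vimage_eq imageE)
    qed
    have inv: "measure ?\<mu> (\<tau> -` C) = measure ?\<mu> C" if C: "C \<in> sets borel" for C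
    proof -
      have "distr ?\<mu> borel \<tau> = ?\<mu>"
        using GL_invariant_mu[OF k] GL_pair_GL_inf(1)[OF P] by (simp add: GL_invariant_def \<tau>_def)
      moreover have "\<tau> \<in> ?\<mu> \<rightarrow>\<^sub>M borel" using \<mu>(2) by (simp cong: measurable_cong_sets)
      ultimately show ?thesis using measure_distr[of \<tau> ?\<mu> borel C] C sp by simp
    qed
    define B' where "B' = \<tau> -` B"
    have B's[measurable]: "B' \<in> sets borel"
      using measurable_sets[OF \<tau>m Bs] by (simp add: B'_def)
    have sdB: "measure ?\<mu> (sym_diff A B') < e"
    proof -
      have "sym_diff A B' = \<tau> -` sym_diff A B" using \<tau>A by (auto simp: B'_def)
      then show ?thesis using inv[of "sym_diff A B"] A Bs B(2) by simp
    qed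
    have meq: "measure ?\<mu> C = (\<integral>\<omega>. indicator C (random_matrix \<pi> k \<omega>) \<partial>haar_pow)" if C: "C \<in> sets borel" for C
    proof -
      have "measure ?\<mu> C = (\<integral>M. indicator C M \<partial>?\<mu>)" using C \<mu>(2) by simp
      then show ?thesis using integral_mu[OF k, of "indicator C"] C by simp
    qed
    have indep: "measure ?\<mu> (B \<inter> B') = measure ?\<mu> B * measure ?\<mu> B'"
    proof -
      \<comment> \<open>The summation index \<open>n\<close> is unrestricted: only row and column
        indices separate the two diagonal blocks. The off-diagonal variables \<open>Z\<close> lie
        outside \<open>S\<close> and enter neither event.\<close>
      define S where "S = {v. case v of XVar n i \<Rightarrow> i < m | YVar n j \<Rightarrow> j < m | ZVar i j \<Rightarrow> i < m \<and> j < m}"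
      have "measure ?\<mu> (B \<inter> B') =
          (\<integral>\<omega>. indicator B (random_matrix \<pi> k \<omega>) * indicator B' (random_matrix \<pi> k \<omega>) \<partial>haar_pow)"
        by (simp add: meq indicator_inter_arith)
      also have "\<dots> = (\<integral>\<omega>. indicator B (random_matrix \<pi> k \<omega>) \<partial>haar_pow) *
          (\<integral>\<omega>. indicator B' (random_matrix \<pi> k \<omega>) \<partial>haar_pow)"
      proof (rule integral_mult_indep[where S=S and B=1 and B'=1])
        show "indicator B (random_matrix \<pi> k x) = (indicator B (random_matrix \<pi> k y) :: real)"
          if "\<And>i. i \<in> S \<Longrightarrow> x i = y i" for x y
        proof -
          have "random_matrix \<pi> k x i j = random_matrix \<pi> k y i j" if "i < m" "j < m" for i j
            using \<open>\<And>i. i \<in> S \<Longrightarrow> x i = y i\<close> that by (simp add: random_matrix_def S_def cong: if_cong)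
          then have "random_matrix \<pi> k x \<in> B \<longleftrightarrow> random_matrix \<pi> k y \<in> B"
            using B(1) unfolding corner_set_def by blast
          then show ?thesis by (simp add: indicator_def)
        qed
        show "indicator B' (random_matrix \<pi> k x) = (indicator B' (random_matrix \<pi> k y) :: real)"
          if "\<And>i. i \<notin> S \<Longrightarrow> x i = y i" for x y
        proof -
          have "\<tau> (random_matrix \<pi> k x) i j = \<tau> (random_matrix \<pi> k y) i j" if "i < m" "j < m" for i j
            using \<open>\<And>i. i \<notin> S \<Longrightarrow> x i = y i\<close> that
            by (simp add: random_matrix_def S_def \<tau> \<sigma>_def cong: if_cong)
          then have "\<tau> (random_matrix \<pi> k x) \<in> B \<longleftrightarrow> \<tau> (random_matrix \<pi> k y) \<in> B"
            using B(1) unfolding corner_set_def by blast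
          then show ?thesis by (simp add: indicator_def B'_def)
        qed
      qed (auto simp: indicator_def)
      finally show ?thesis by (simp add: meq)
    qed
    have BB: "measure ?\<mu> B' = measure ?\<mu> B" unfolding B'_def by (rule inv[OF Bs])
    have sd: "\<bar>measure ?\<mu> A - measure ?\<mu> C\<bar> \<le> measure ?\<mu> (sym_diff A C)" if C: "C \<in> sets borel" for C
    proof -
      have 1: "measure ?\<mu> A \<le> measure ?\<mu> (C \<union> sym_diff A C)"
        using A C \<mu>(2) by (intro finite_measure_mono) auto
      have 2: "measure ?\<mu> C \<le> measure ?\<mu> (A \<union> sym_diff A C)"
        using A C \<mu>(2) by (intro finite_measure_mono) auto
      have 3: "measure ?\<mu> (D \<union> sym_diff A C) \<le> measure ?\<mu> D + measure ?\<mu> (sym_diff A C)" if "D \<in> sets borel" for D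
        using A C \<mu>(2) that by (intro measure_Un_le) auto
      show ?thesis using 1 2 3[of A] 3[of C] A C by (simp add: abs_le_iff)
    qed
    have 1: "\<bar>?a - measure ?\<mu> B\<bar> \<le> e" using sd[OF Bs] B(2) by simp
    have 2: "\<bar>?a - measure ?\<mu> (B \<inter> B')\<bar> \<le> 2 * e"
    proof -
      have "measure ?\<mu> (sym_diff A (B \<inter> B')) \<le> measure ?\<mu> (sym_diff A B \<union> sym_diff A B')"
        using A Bs B's \<mu>(2) by (intro finite_measure_mono) auto
      also have "\<dots> \<le> measure ?\<mu> (sym_diff A B) + measure ?\<mu> (sym_diff A B')"
        using A Bs B's \<mu>(2) by (intro measure_Un_le) auto
      finally show ?thesis using sd[of "B \<inter> B'"] B(2) sdB by simp
    qed
    have 3: "\<bar>measure ?\<mu> B * measure ?\<mu> B - ?a * ?a\<bar> \<le> 2 * e"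
    proof -
      have "measure ?\<mu> B * measure ?\<mu> B - ?a * ?a = (measure ?\<mu> B - ?a) * (measure ?\<mu> B + ?a)"
        by (simp add: algebra_simps)
      then have "\<bar>measure ?\<mu> B * measure ?\<mu> B - ?a * ?a\<bar> = \<bar>?a - measure ?\<mu> B\<bar> * \<bar>measure ?\<mu> B + ?a\<bar>"
        by (simp add: abs_mult abs_minus_commute)
      also have "\<dots> \<le> e * 2"
        using 1 e add_mono[OF prob_le_1[of B] prob_le_1[of A]] by (intro mult_mono) auto
      finally show ?thesis by simp
    qed
    show ?thesis using 2 3 indep BB by (simp add: abs_le_iff)
  qed
  have "?a - ?a * ?a = 0"
  proof (rule ccontr)
    assume n: "?a - ?a * ?a \<noteq> 0"
    then have "0 < \<bar>?a - ?a * ?a\<bar> / 8" by simp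
    from bound[OF this] n show False by simp
  qed
  then have "?a * (1 - ?a) = 0" by (simp add: algebra_simps)
  then show ?thesis by auto
qed

lemma mu_P_erg: "decseq k \<Longrightarrow> mu \<pi> k \<in> P_erg"
  unfolding P_erg_def using mu_borel_probs GL_invariant_mu ergodic_mu by auto

end

section \<open>Recovering the parameter\<close>

lemma int_minf_eqI:
  assumes "\<And>l. x \<le> Fin l \<longleftrightarrow> y \<le> Fin l"
  shows "x = y"
proof -
  have "\<exists>l. a \<le> Fin l \<and> \<not> b \<le> Fin l" if "a < b" for a b
  proof (cases b)
    case (Fin c)
    then show ?thesis using that by (cases a) (auto intro!: exI[of _ "c - 1"])
  qed (use that in simp)
  then show ?thesis using assms by (metis linorder_cases)
qed

lemma continuous_on_of_bool_clopen:
  assumes "open A" "closed (A :: 'b::topological_space set)"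
  shows "continuous_on UNIV (\<lambda>x. of_bool (x \<in> A) :: real)"
proof -
  have "(\<lambda>x. of_bool (x \<in> A) :: real) -` B \<in> {{}, A, - A, UNIV}" for B
    by (cases "0 \<in> B"; cases "1 \<in> B") (auto simp: of_bool_def split: if_splits)
  moreover have "open S" if "S \<in> {{}, A, - A, UNIV}" for S
    using that assms by auto
  ultimately show ?thesis
    by (simp add: continuous_on_open_vimage)
qed

lemma integral_of_bool:
  assumes "{x \<in> space M. P x} \<in> sets M"
  shows "(\<integral>x. of_bool (P x) \<partial>M) = measure M {x \<in> space M. P x}"
proof -
  have "(\<integral>x. of_bool (P x) \<partial>M) = (\<integral>x. indicator {x \<in> space M. P x} x \<partial>M)"
    by (intro Bochner_Integration.integral_cong) (auto simp: indicator_def)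
  also have "\<dots> = measure M ({x \<in> space M. P x} \<inter> space M)" by simp
  also have "{x \<in> space M. P x} \<inter> space M = {x \<in> space M. P x}" by auto
  finally show ?thesis .
qed

lemma continuous_map_weak_integral:
  fixes f :: "'b::topological_space \<Rightarrow> real"
  assumes "continuous_on UNIV f" "bounded (range f)"
  shows "continuous_map weak_topology euclidean (\<lambda>\<mu>. \<integral>x. f x \<partial>\<mu>)"
proof -
  let ?G = "{{\<mu> \<in> borel_probs. (\<integral>x. f x \<partial>\<mu>) \<in> U} | (f :: 'b \<Rightarrow> real) U.
        continuous_on UNIV f \<and> bounded (range f) \<and> open U}"
  have top: "topspace (weak_topology :: 'b measure topology) = \<Union>?G"
    unfolding weak_topology_def by simp
  have sub: "topspace (weak_topology :: 'b measure topology) \<subseteq> borel_probs"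
    unfolding top by auto
  show ?thesis unfolding continuous_map
  proof (intro conjI allI impI)
    fix U :: "real set" assume "openin euclidean U"
    then have "{\<mu> \<in> borel_probs. (\<integral>x. f x \<partial>\<mu>) \<in> U} \<in> ?G"
      using assms by auto
    then have op: "openin weak_topology {\<mu> \<in> borel_probs. (\<integral>x. f x \<partial>\<mu>) \<in> U}"
      unfolding weak_topology_def by (rule topology_generated_by_Basis)
    moreover have "{\<mu> \<in> topspace weak_topology. (\<integral>x. f x \<partial>\<mu>) \<in> U} = {\<mu> \<in> borel_probs. (\<integral>x. f x \<partial>\<mu>) \<in> U}"
      using sub openin_subset[OF op] by auto
    ultimately show "openin weak_topology {\<mu> \<in> topspace weak_topology. (\<integral>x. f x \<partial>\<mu>) \<in> U}" by simp
  qed simp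
qed

text \<open>The positive part of the difference to \<open>l\<close>, and \<open>0\<close> for a
  vanishing coefficient. It is the number of leading digits of an integral variable that must vanish
  so that its multiple by the \<open>\<pi>\<close>-power of exponent minus the first argument has
  absolute value at most \<open>q powi l\<close>.\<close>

fun excess :: "int_minf \<Rightarrow> int \<Rightarrow> nat" where
  "excess MInfty l = 0"
| "excess (Fin a) l = nat (a - l)"

context uniformized_field
begin

definition phi_fun :: "int \<Rightarrow> 'a \<Rightarrow> real" where
  "phi_fun l x = (q * of_bool (abs_val x \<le> q powi l) - of_bool (abs_val x \<le> q powi (l + 1))) / (q - 1)"

text \<open>Given the variables \<open>X\<close>, an entry of the random matrix is uniformly distributed on a ball
  \<open>{x. |x| \<le> q\<^sup>R}\<close>; \<open>phi_fun l\<close> is chosen such that its mean over this ball is \<open>1\<close> if \<open>R \<le> l\<close> and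
  \<open>0\<close> otherwise. Hence \<open>phi\<close> is the distribution function of \<open>R\<close>.\<close>

definition phi :: "'a inf_matrix measure \<Rightarrow> int \<Rightarrow> real" where
  "phi \<mu> l = (\<integral>M. phi_fun l (M 0 0) \<partial>\<mu>)"

lemma q_powi_pos: "0 < q powi l"
  by (rule zero_less_power_int[OF q_pos])

lemma q_powi_less_iff [simp]: "q powi m < q powi n \<longleftrightarrow> m < n"
  by (metis q_powi_le_iff not_le)

lemma abs_phi_fun_le: "\<bar>phi_fun l x\<bar> \<le> 1"
proof -
  have "abs_val x \<le> q powi l \<Longrightarrow> abs_val x \<le> q powi (l + 1)"
    using q_powi_le_iff[of l "l + 1"] by linarith
  then show ?thesis using q_ge_2 by (auto simp: phi_fun_def)
qed

lemma phi_fun_eq_1: "abs_val x \<le> q powi l \<Longrightarrow> phi_fun l x = 1"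
proof -
  assume x: "abs_val x \<le> q powi l"
  also have "q powi l \<le> q powi (l + 1)" by simp
  finally show ?thesis using x q_gt_1 by (simp add: phi_fun_def)
qed

lemma continuous_on_phi_fun: "continuous_on UNIV (phi_fun l)"
proof -
  have "continuous_on UNIV (\<lambda>x::'a. of_bool (abs_val x \<le> q powi s) :: real)" for s
    using continuous_on_of_bool_clopen[OF open_cball_nonarch[OF q_powi_pos] closed_cball, of 0 s]
    by (simp add: cball_eq_abs_val)
  then show ?thesis unfolding phi_fun_def using q_gt_1 by (intro continuous_intros) auto
qed

lemma continuous_on_phi_fun_entry: "continuous_on UNIV (\<lambda>M::'a inf_matrix. phi_fun l (M i j))"
  by (rule continuous_on_compose2[OF continuous_on_phi_fun continuous_on_entry]) simp

lemma measurable_phi_fun [measurable]: "phi_fun l \<in> borel_measurable borel"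
  by (rule borel_measurable_continuous_onI[OF continuous_on_phi_fun])

lemma measurable_abs_val [measurable]: "abs_val \<in> borel_measurable (borel :: 'a measure)"
  by (intro borel_measurable_continuous_onI continuous_on_abs_val continuous_on_id)

lemma cball_in_haar_sets:
  assumes "c \<in> (ring_of_integers :: 'a set)"
  shows "cball c (1 / q ^ n) \<in> sets haar_integers"
  unfolding sets_haar_integers sets_integers_generated using assms by (intro sigma_sets.Basic) auto

lemma measure_coord_ball:
  assumes "c \<in> (ring_of_integers :: 'a set)"
  shows "measure (haar_pow :: ('i \<Rightarrow> 'a) measure) {\<omega> \<in> space haar_pow. abs_val (\<omega> v - c) \<le> 1 / q ^ n} = (1 / q) ^ n"
proof -
  have "emeasure (haar_pow :: ('i \<Rightarrow> 'a) measure) {\<omega> \<in> space haar_pow. \<forall>j\<in>{v}. \<omega> j \<in> cball c (1 / q ^ n)} =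
      (\<Prod>j\<in>{v}. emeasure haar_integers (cball c (1 / q ^ n)))"
    using cball_in_haar_sets[OF assms] by (intro emeasure_haar_pow_Collect) auto
  moreover have "{\<omega> \<in> space haar_pow. \<forall>j\<in>{v}. \<omega> j \<in> cball c (1 / q ^ n)} =
      {\<omega> \<in> space (haar_pow :: ('i \<Rightarrow> 'a) measure). abs_val (\<omega> v - c) \<le> 1 / q ^ n}"
    by (auto simp: cball_eq_abs_val)
  ultimately have "emeasure (haar_pow :: ('i \<Rightarrow> 'a) measure) {\<omega> \<in> space haar_pow. abs_val (\<omega> v - c) \<le> 1 / q ^ n} = ennreal ((1 / q) ^ n)"
    by (simp add: emeasure_haar_cball[OF assms])
  then show ?thesis by (simp add: measure_def)
qed

lemma q_powi_minus_nat: "q powi (- int n) = 1 / q ^ n"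
  by (simp add: power_int_minus inverse_eq_divide)

text \<open>The value \<open>a * \<omega> v + r\<close> is uniform on the ball of radius
  \<open>abs_val a\<close> around \<open>r\<close>. If this ball contains \<open>0\<close>, it
  contains both test balls, whose masses differ exactly by the factor \<open>q\<close>, so the
  combination cancels; this uses that \<open>abs_val a\<close> is at least
  \<open>q powi (l + 1)\<close>. If it does not contain \<open>0\<close>, all values have size
  \<open>abs_val r\<close> and miss both test balls.\<close>

lemma phi_fun_avg_zero:
  fixes v :: 'i
  assumes a: "q powi l < abs_val a"
  shows "(\<integral>\<omega>. phi_fun l (a * \<omega> v + r) \<partial>(haar_pow :: ('i \<Rightarrow> 'a) measure)) = 0"
proof -
  interpret H: prob_space "haar_pow :: ('i \<Rightarrow> 'a) measure" by (rule prob_space_haar_pow)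
  have a0: "a \<noteq> 0" using a q_powi_pos[of l] by (metis abs_val_0 not_less_iff_gr_or_eq)
  then obtain e where e: "abs_val a = q powi e" by (rule abs_val_values)
  have le: "l + 1 \<le> e" using a unfolding abs_val_gt_iff e by simp
  define P where "P s = measure (haar_pow :: ('i \<Rightarrow> 'a) measure)
    {\<omega> \<in> space haar_pow. abs_val (a * \<omega> v + r) \<le> q powi s}" for s
  have sets[measurable]: "{\<omega> \<in> space haar_pow. abs_val (a * \<omega> v + r) \<le> q powi s} \<in> sets (haar_pow :: ('i \<Rightarrow> 'a) measure)" for s
    by measurable
  have "(\<integral>\<omega>. phi_fun l (a * \<omega> v + r) \<partial>(haar_pow :: ('i \<Rightarrow> 'a) measure)) = (q * P l - P (l + 1)) / (q - 1)"
  proof -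
    have i: "integrable (haar_pow :: ('i \<Rightarrow> 'a) measure) (\<lambda>\<omega>. of_bool (abs_val (a * \<omega> v + r) \<le> q powi s) :: real)" for s
      by (rule H.integrable_const_bound[of _ 1]) auto
    show ?thesis unfolding phi_fun_def P_def
      by (subst integral_of_bool[symmetric, OF sets])+ (simp add: i)
  qed
  also have "q * P l = P (l + 1)"
  proof (cases "abs_val r \<le> abs_val a")
    case True
    define c where "c = - (r / a)"
    have c: "c \<in> ring_of_integers"
      using True a0 by (simp add: c_def mem_ring_of_integers abs_val_divide)
    have P: "P s = (1 / q) ^ nat (e - s)" if "s \<le> e" for s
    proof -
      have "abs_val (a * x + r) \<le> q powi s \<longleftrightarrow> abs_val (x - c) \<le> 1 / q ^ nat (e - s)" for x
      proof -
        have "a * x + r = a * (x - c)" using a0 by (simp add: c_def field_simps)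
        then have "abs_val (a * x + r) = q powi e * abs_val (x - c)" by (simp add: abs_val_mult e)
        moreover have "q powi s = q powi e * (1 / q ^ nat (e - s))"
          using that q_powi_minus_nat[of "nat (e - s)"] power_int_add[of q e "s - e"] by simp
        ultimately show ?thesis by (simp only: mult_le_cancel_left_pos[OF q_powi_pos])
      qed
      then show ?thesis unfolding P_def using measure_coord_ball[OF c, of v "nat (e - s)"] by simp
    qed
    have "nat (e - l) = Suc (nat (e - (l + 1)))" using le by simp
    then show ?thesis using P[of l] P[of "l + 1"] le by simp
  next
    case False
    have "P s = 0" if "s \<le> e" for s
    proof -
      have "\<not> abs_val (a * \<omega> v + r) \<le> q powi s" if \<omega>: "\<omega> \<in> space haar_pow" for \<omega> :: "'i \<Rightarrow> 'a"
      proof -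
        have 1: "abs_val (a * \<omega> v) \<le> abs_val a"
          using abs_val_haar_pow[OF \<omega>, of v] by (simp add: abs_val_mult mult_left_le)
        then have "abs_val (a * \<omega> v + r) = abs_val r" using False by (intro abs_val_add_eq) simp
        moreover have "q powi s \<le> q powi e" using \<open>s \<le> e\<close> by simp
        ultimately show ?thesis using False unfolding e by linarith
      qed
      then have "{\<omega> \<in> space haar_pow. abs_val (a * \<omega> v + r) \<le> q powi s} = ({} :: ('i \<Rightarrow> 'a) set)" by blast
      then show ?thesis unfolding P_def by (simp only: measure_empty)
    qed
    then show ?thesis using le by simp
  qed
  finally show ?thesis by simp
qed

text \<open>Conditioning on all coordinates except \<open>v\<close> leaves an affine function of one
  uniform variable. Wherever the weight \<open>w\<close> is nonzero, the coefficient is large enough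
  for the average to vanish.\<close>

lemma integral_phi_fun_zero:
  fixes F :: "('i \<Rightarrow> 'a) \<Rightarrow> real" and v :: 'i
  assumes F: "F \<in> borel_measurable haar_pow" "\<And>\<omega>. \<omega> \<in> space haar_pow \<Longrightarrow> \<bar>F \<omega>\<bar> \<le> 1"
    and eq: "\<And>\<omega> y. \<omega> \<in> space haar_pow \<Longrightarrow> y \<in> ring_of_integers \<Longrightarrow>
      F ((fun_upd \<omega> (v) y)) = phi_fun l (a \<omega> * y + r \<omega>) * w \<omega>"
    and a: "\<And>\<omega>. \<omega> \<in> space haar_pow \<Longrightarrow> w \<omega> \<noteq> 0 \<Longrightarrow> q powi l < abs_val (a \<omega>)"
  shows "(\<integral>\<omega>. F \<omega> \<partial>haar_pow) = 0"
proof -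
  have m: "merge_coords (- {v}) (x, y) = x(v := y v)" for x y :: "'i \<Rightarrow> 'a"
    by (rule ext) (simp add: merge_coords_def)
  have "(\<integral>y. F (merge_coords (- {v}) (x, y)) \<partial>haar_pow) = 0" if x: "x \<in> space haar_pow" for x
  proof -
    have "(\<integral>y. F (merge_coords (- {v}) (x, y)) \<partial>haar_pow) =
        (\<integral>y. phi_fun l (a x * y v + r x) * w x \<partial>haar_pow)"
      unfolding m using eq[OF x] by (intro Bochner_Integration.integral_cong) (auto simp: in_space_haar_pow)
    also have "\<dots> = 0"
      using phi_fun_avg_zero[OF a[OF x]] by (cases "w x = 0") auto
    finally show ?thesis .
  qed
  then have "(\<integral>x. (\<integral>y. F (merge_coords (- {v}) (x, y)) \<partial>haar_pow) \<partial>haar_pow) = (\<integral>x. 0 \<partial>(haar_pow :: ('i \<Rightarrow> 'a) measure))"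
    by (intro Bochner_Integration.integral_cong) auto
  then show ?thesis using integral_merge_coords(1)[OF F] by simp
qed

lemma phi_mu: "decseq k \<Longrightarrow> phi (mu \<pi> k) l = (\<integral>\<omega>. phi_fun l (random_matrix \<pi> k \<omega> 0 0) \<partial>haar_pow)"
  unfolding phi_def by (rule integral_mu) auto

lemma abs_phi_le:
  assumes "\<mu> \<in> borel_probs"
  shows "\<bar>phi \<mu> l\<bar> \<le> 1"
proof -
  interpret prob_space \<mu> using assms by (simp add: borel_probs_def)
  have s[measurable_cong]: "sets \<mu> = sets borel" using assms by (simp add: borel_probs_def)
  have m: "(\<lambda>M. phi_fun l (M 0 0)) \<in> borel_measurable \<mu>" by measurable
  have "\<bar>phi \<mu> l\<bar> \<le> (\<integral>M. \<bar>phi_fun l (M 0 0)\<bar> \<partial>\<mu>)"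
    unfolding phi_def by (rule integral_abs_bound)
  also have "\<dots> \<le> (\<integral>M. 1 \<partial>\<mu>)"
    using abs_phi_fun_le m by (intro integral_mono integrable_const_bound[of _ 1] AE_I2) auto
  finally show ?thesis by (simp add: prob_space)
qed

text \<open>The entry contains \<open>Z\<close> with a coefficient larger than
  \<open>q powi l\<close>, so averaging over this one variable already gives
  \<open>0\<close>.\<close>

lemma phi_mu_zero:
  assumes k: "decseq k" and l: "Fin l < lim k"
  shows "phi (mu \<pi> k) l = 0"
  unfolding phi_mu[OF k]
proof (rule integral_phi_fun_zero[where v="ZVar 0 0" and l=l and w="\<lambda>_. 1"
      and a="\<lambda>_. neg_power \<pi> (lim k)" and r="\<lambda>\<omega>. \<Sum>n. rm_term k \<omega> 0 0 n"])
  show "(\<lambda>\<omega>. phi_fun l (random_matrix \<pi> k \<omega> 0 0)) \<in> borel_measurable haar_pow"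
    using measurable_random_matrix_entry[OF k] by measurable
  show "q powi l < abs_val (neg_power \<pi> (lim k))"
  proof (cases "lim k")
    case (Fin c)
    then show ?thesis using l q_powi_le_iff[of c l] by (simp del: neg_power.simps q_powi_le_iff flip: not_le)
  qed (use l in simp)
  show "phi_fun l (random_matrix \<pi> k ((fun_upd \<omega> (ZVar 0 0) y)) 0 0) =
      phi_fun l (neg_power \<pi> (lim k) * y + (\<Sum>n. rm_term k \<omega> 0 0 n)) * 1" for \<omega> y
    by (simp add: random_matrix_eq rm_term_def add.commute cong: if_cong)
qed (rule abs_phi_fun_le)

text \<open>Isolates the affine dependence of the entry on a single variable \<open>Y\<close>, in
  the form required for averaging over it.\<close>

lemma random_matrix_upd_Y:
  assumes k: "decseq k" and \<omega>: "\<omega> \<in> space haar_pow" and y: "y \<in> ring_of_integers" and j: "lim k < k j"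
  shows "random_matrix \<pi> k ((fun_upd \<omega> (YVar j 0) y)) 0 0 =
    neg_power \<pi> (k j) * \<omega> (XVar j 0) * y + random_matrix \<pi> k ((fun_upd \<omega> (YVar j 0) 0)) 0 0"
proof -
  let ?x = "neg_power \<pi> (k j) * \<omega> (XVar j 0) * y"
  have s: "(fun_upd \<omega> (YVar j 0) 0) \<in> space haar_pow" using \<omega> by (simp add: in_space_haar_pow)
  have "(\<lambda>n. (if n = j then ?x else 0) + rm_term k ((fun_upd \<omega> (YVar j 0) 0)) 0 0 n) sums
      (?x + suminf (rm_term k ((fun_upd \<omega> (YVar j 0) 0)) 0 0))"
    by (intro sums_add summable_sums summable_rm_term s k) (rule sums_single)
  moreover have "(\<lambda>n. (if n = j then ?x else 0) + rm_term k ((fun_upd \<omega> (YVar j 0) 0)) 0 0 n) =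
      rm_term k ((fun_upd \<omega> (YVar j 0) y)) 0 0"
    using j by (auto simp: rm_term_def fun_eq_iff)
  ultimately show ?thesis by (simp add: random_matrix_eq sums_iff add.assoc)
qed

lemma neg_power_ball_iff:
  assumes "abs_val (x::'a) \<le> 1"
  shows "abs_val (neg_power \<pi> b * x) \<le> q powi l \<longleftrightarrow> abs_val x \<le> 1 / q ^ excess b l"
proof (cases b)
  case MInfty
  then show ?thesis using assms q_powi_pos[of l] by simp
next
  case (Fin a)
  show ?thesis
  proof (cases "a \<le> l")
    case True
    then have "q powi a * abs_val x \<le> q powi l * 1"
      using assms q_powi_pos[of l] by (intro mult_mono) auto
    then show ?thesis using True assms Fin by (simp add: abs_val_mult del: neg_power.simps)
  next
    case False
    then have "q powi l = q powi a * (1 / q ^ nat (a - l))"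
      using q_powi_minus_nat[of "nat (a - l)"] power_int_add[of q a "l - a"] by simp
    then show ?thesis
      unfolding Fin abs_val_mult abs_val_neg_power_Fin excess.simps
      by (simp only: mult_le_cancel_left_pos[OF q_powi_pos])
  qed
qed

text \<open>The weight \<open>g j\<close> asks that the first \<open>j\<close> coefficients of the
  variables \<open>Y\<close> lie in the ball of radius \<open>q powi l\<close>. Inserting these
  conditions one at a time does not change the integral: where condition \<open>j\<close> fails,
  averaging over its \<open>Y\<close> gives \<open>0\<close>. Once all \<open>K\<close> conditions
  hold, the entry lies in the ball, \<open>phi_fun\<close> is \<open>1\<close>, and what remains is
  the probability of independent events about \<open>X\<close>.\<close>

lemma phi_mu_prod:
  assumes k: "decseq k" and l: "lim k \<le> Fin l" and K: "k K \<le> Fin l"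
  shows "phi (mu \<pi> k) l = (\<Prod>n<K. (1 / q) ^ excess (k n) l)"
proof -
  interpret H: prob_space "haar_pow :: (var_label \<Rightarrow> 'a) measure" by (rule prob_space_haar_pow)
  define g where "g j \<omega> = (of_bool (\<forall>n<j. abs_val (neg_power \<pi> (k n) * \<omega> (XVar n 0)) \<le> q powi l) :: real)"
    for j and \<omega> :: "var_label \<Rightarrow> 'a"
  define E where "E j = (\<integral>\<omega>. phi_fun l (random_matrix \<pi> k \<omega> 0 0) * g j \<omega> \<partial>haar_pow)" for j
  have rm[measurable]: "(\<lambda>\<omega>. random_matrix \<pi> k \<omega> 0 0) \<in> borel_measurable haar_pow"
    by (rule measurable_random_matrix_entry[OF k])
  have gm[measurable]: "g j \<in> borel_measurable haar_pow" for j
    unfolding g_def by measurable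
  have g01: "g j \<omega> \<in> {0, 1}" for j \<omega> by (auto simp: g_def)
  have int: "integrable haar_pow (\<lambda>\<omega>. phi_fun l (random_matrix \<pi> k \<omega> 0 0) * g j \<omega>)" for j
  proof (rule H.integrable_const_bound[of _ 1])
    show "AE \<omega> in haar_pow. norm (phi_fun l (random_matrix \<pi> k \<omega> 0 0) * g j \<omega>) \<le> 1"
    proof (rule AE_I2)
      fix \<omega> show "norm (phi_fun l (random_matrix \<pi> k \<omega> 0 0) * g j \<omega>) \<le> 1"
        using abs_phi_fun_le[of l "random_matrix \<pi> k \<omega> 0 0"] g01[of j \<omega>] by auto
    qed
  qed measurable
  have gS: "g (Suc j) \<omega> = g j \<omega> * of_bool (abs_val (neg_power \<pi> (k j) * \<omega> (XVar j 0)) \<le> q powi l)" for j \<omega>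
    by (auto simp: g_def less_Suc_eq)
  have step: "E (Suc j) = E j" for j
  proof (cases "k j \<le> Fin l")
    case True
    have "g (Suc j) \<omega> = g j \<omega>" if "\<omega> \<in> space haar_pow" for \<omega>
    proof -
      have "excess (k j) l = 0" using True by (cases "k j") auto
      then show ?thesis
        using neg_power_ball_iff[OF abs_val_haar_pow[OF that], of "k j" "XVar j 0" l] abs_val_haar_pow[OF that, of "XVar j 0"]
        by (simp add: gS)
    qed
    then show ?thesis unfolding E_def by (intro Bochner_Integration.integral_cong) auto
  next
    case False
    then have lim: "lim k < k j" using l by simp
    have "(\<integral>\<omega>. phi_fun l (random_matrix \<pi> k \<omega> 0 0) * (g j \<omega> - g (Suc j) \<omega>) \<partial>haar_pow) = 0"
    proof (rule integral_phi_fun_zero[where v="YVar j 0" and w="\<lambda>\<omega>. g j \<omega> - g (Suc j) \<omega>"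
          and a="\<lambda>\<omega>. neg_power \<pi> (k j) * \<omega> (XVar j 0)"
          and r="\<lambda>\<omega>. random_matrix \<pi> k ((fun_upd \<omega> (YVar j 0) 0)) 0 0"])
      show "\<bar>phi_fun l (random_matrix \<pi> k \<omega> 0 0) * (g j \<omega> - g (Suc j) \<omega>)\<bar> \<le> 1" for \<omega>
        using abs_phi_fun_le[of l "random_matrix \<pi> k \<omega> 0 0"] g01[of j \<omega>] by (auto simp: gS)
      show "phi_fun l (random_matrix \<pi> k ((fun_upd \<omega> (YVar j 0) y)) 0 0) * (g j ((fun_upd \<omega> (YVar j 0) y)) - g (Suc j) ((fun_upd \<omega> (YVar j 0) y))) =
          phi_fun l (neg_power \<pi> (k j) * \<omega> (XVar j 0) * y + random_matrix \<pi> k ((fun_upd \<omega> (YVar j 0) 0)) 0 0) * (g j \<omega> - g (Suc j) \<omega>)"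
        if "\<omega> \<in> space haar_pow" "y \<in> ring_of_integers" for \<omega> y
        unfolding random_matrix_upd_Y[OF k that lim] by (simp add: g_def)
      show "q powi l < abs_val (neg_power \<pi> (k j) * \<omega> (XVar j 0))" if "g j \<omega> - g (Suc j) \<omega> \<noteq> 0" for \<omega>
        using that by (auto simp: gS of_bool_def split: if_splits)
    qed measurable
    then show ?thesis
      unfolding E_def right_diff_distrib by (subst (asm) Bochner_Integration.integral_diff[OF int int]) simp
  qed
  have "phi (mu \<pi> k) l = E 0"
    unfolding phi_mu[OF k] E_def by (simp add: g_def)
  also have "\<dots> = E K" using step by (induction K) auto
  also have "\<dots> = (\<integral>\<omega>. g K \<omega> \<partial>haar_pow)"
    unfolding E_def
  proof (intro Bochner_Integration.integral_cong refl)
    fix \<omega> :: "var_label \<Rightarrow> 'a" assume \<omega>: "\<omega> \<in> space haar_pow"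
    show "phi_fun l (random_matrix \<pi> k \<omega> 0 0) * g K \<omega> = g K \<omega>"
    proof (cases "g K \<omega> = 0")
      case False
      then have le: "abs_val (neg_power \<pi> (k n) * \<omega> (XVar n 0)) \<le> q powi l" if "n < K" for n
        using that by (auto simp: g_def)
      have "abs_val (rm_term k \<omega> 0 0 n) \<le> q powi l" if "n < K" for n
        using mult_mono[OF le[OF that] abs_val_haar_pow[OF \<omega>, of "YVar n 0"]] q_powi_pos[of l]
        by (simp add: rm_term_def abs_val_mult)
      then have "abs_val (\<Sum>n<K. rm_term k \<omega> 0 0 n) \<le> q powi l"
        using q_powi_pos[of l] by (intro abs_val_sum_le) auto
      \<comment> \<open>The terms from \<open>K\<close> on cannot leave the ball, because their
        parameters are at most \<open>k K\<close>.\<close>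
      moreover have "abs_val (random_matrix \<pi> (\<lambda>n. k (n + K)) (shift_vars K \<omega>) 0 0) \<le> q powi l"
        using K by (intro abs_val_random_matrix_le shift_vars_space \<omega> decseq_shift k) simp
      ultimately have "abs_val (random_matrix \<pi> k \<omega> 0 0) \<le> q powi l"
        unfolding random_matrix_split[OF \<omega> k, of _ _ K] by (rule abs_val_add_le)
      then show ?thesis by (simp add: phi_fun_eq_1)
    qed simp
  qed
  also have "\<dots> = measure haar_pow {\<omega> \<in> space haar_pow. \<forall>n<K. abs_val (neg_power \<pi> (k n) * \<omega> (XVar n 0)) \<le> q powi l}"
    unfolding g_def by (rule integral_of_bool) measurable
  also have "\<dots> = (\<Prod>n<K. (1 / q) ^ excess (k n) l)"
  proof -
    define F where "F v = (case v of XVar n i \<Rightarrow> cball (0::'a) (1 / q ^ excess (k n) l) | _ \<Rightarrow> {})" for v :: var_label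
    let ?J = "(\<lambda>n. XVar n 0) ` {..<K}"
    have "{\<omega> \<in> space haar_pow. \<forall>n<K. abs_val (neg_power \<pi> (k n) * \<omega> (XVar n 0)) \<le> q powi l} =
        {\<omega> \<in> space haar_pow. \<forall>j\<in>?J. \<omega> j \<in> F j}"
    proof (intro Collect_cong conj_cong refl)
      fix \<omega> :: "var_label \<Rightarrow> 'a" assume "\<omega> \<in> space haar_pow"
      then show "(\<forall>n<K. abs_val (neg_power \<pi> (k n) * \<omega> (XVar n 0)) \<le> q powi l) \<longleftrightarrow> (\<forall>j\<in>?J. \<omega> j \<in> F j)"
        by (simp add: neg_power_ball_iff[OF abs_val_haar_pow] F_def cball_eq_abs_val) auto
    qed
    moreover have "emeasure haar_pow {\<omega> \<in> space haar_pow. \<forall>j\<in>?J. \<omega> j \<in> F j} = (\<Prod>j\<in>?J. emeasure haar_integers (F j))"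
      by (intro emeasure_haar_pow_Collect) (auto simp: F_def intro!: cball_in_haar_sets)
    moreover have "(\<Prod>j\<in>?J. emeasure haar_integers (F j)) = (\<Prod>n<K. ennreal ((1 / q) ^ excess (k n) l))"
      by (subst prod.reindex) (auto simp: inj_on_def F_def emeasure_haar_cball)
    ultimately show ?thesis by (simp add: measure_def prod_ennreal prod_nonneg)
  qed
  finally show ?thesis .
qed

text \<open>Here \<open>c\<close> is the number of indices with \<open>k n > Fin l\<close>. Passing
  from \<open>l + 1\<close> to \<open>l\<close> costs each of them one more factor
  \<open>1 / q\<close> and leaves the other indices unaffected.\<close>

lemma phi_mu_ratio:
  assumes k: "decseq k" and l: "lim k \<le> Fin l"
  obtains c where "phi (mu \<pi> k) l = (1 / q) ^ c * phi (mu \<pi> k) (l + 1)" "0 < phi (mu \<pi> k) (l + 1)"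
    "\<And>j. k j \<le> Fin l \<longleftrightarrow> c \<le> j"
proof -
  define c where "c = (LEAST n. k n \<le> Fin l)"
  have "\<exists>n. k n \<le> Fin l"
    using k
  proof (cases rule: decseq_int_minf_cases)
    case (finite c N)
    then show ?thesis using l by (metis order.refl)
  next
    case infinite
    then show ?thesis by blast
  qed
  then have c: "k c \<le> Fin l" unfolding c_def by (rule LeastI_ex)
  have iff: "k j \<le> Fin l \<longleftrightarrow> c \<le> j" for j
  proof
    show "k j \<le> Fin l \<Longrightarrow> c \<le> j" unfolding c_def by (rule Least_le)
    show "c \<le> j \<Longrightarrow> k j \<le> Fin l" using decseqD[OF k, of c j] c by simp
  qed
  have le: "x \<le> Fin l \<Longrightarrow> x \<le> Fin (l + 1)" for x by (cases x) auto
  have p: "phi (mu \<pi> k) (l + 1) = (\<Prod>n<c. (1 / q) ^ excess (k n) (l + 1))"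
    by (rule phi_mu_prod[OF k le[OF l] le[OF c]])
  have "phi (mu \<pi> k) l = (\<Prod>n<c. (1 / q) ^ excess (k n) l)"
    by (rule phi_mu_prod[OF k l c])
  also have "\<dots> = (\<Prod>n<c. (1 / q) * (1 / q) ^ excess (k n) (l + 1))"
  proof (rule prod.cong)
    fix n assume "n \<in> {..<c}"
    then have "\<not> k n \<le> Fin l" using iff by simp
    then have "excess (k n) l = Suc (excess (k n) (l + 1))" by (cases "k n") auto
    then show "(1 / q) ^ excess (k n) l = (1 / q) * (1 / q) ^ excess (k n) (l + 1)" by simp
  qed simp
  also have "\<dots> = (1 / q) ^ c * phi (mu \<pi> k) (l + 1)"
    unfolding p by (simp only: prod.distrib prod_constant card_lessThan)
  finally have "phi (mu \<pi> k) l = (1 / q) ^ c * phi (mu \<pi> k) (l + 1)" .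
  moreover have "0 < phi (mu \<pi> k) (l + 1)" unfolding p by (intro prod_pos) simp
  ultimately show ?thesis using iff by (rule that)
qed

text \<open>Consecutive powers of \<open>1 / q\<close> differ by a factor of at most
  \<open>1 / 2\<close>, and \<open>2 / 3\<close> lies strictly between that and \<open>1\<close>; so
  a strict inequality decides between \<open>c \<le> j\<close> and \<open>c > j\<close>.\<close>

lemma inverse_q_power_le_iff: "2 / 3 * (1 / q) ^ j < (1 / q) ^ c \<longleftrightarrow> c \<le> j"
proof
  assume "c \<le> j"
  then have "(1 / q) ^ j \<le> (1 / q) ^ c" using q_gt_1 by (intro power_decreasing) auto
  moreover have "0 < (1 / q) ^ j" by simp
  ultimately show "2 / 3 * (1 / q) ^ j < (1 / q) ^ c" by linarith
next
  assume *: "2 / 3 * (1 / q) ^ j < (1 / q) ^ c"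
  show "c \<le> j"
  proof (rule ccontr)
    assume "\<not> c \<le> j"
    then have "(1 / q) ^ c \<le> (1 / q) ^ Suc j" using q_gt_1 by (intro power_decreasing) auto
    also have "\<dots> \<le> 1 / 2 * (1 / q) ^ j" using q_ge_2 by (simp add: field_simps)
    finally have "(1 / q) ^ c \<le> 1 / 2 * (1 / q) ^ j" .
    moreover have "0 < (1 / q) ^ j" by simp
    ultimately show False using * by linarith
  qed
qed

lemma le_Fin_iff_phi:
  assumes k: "decseq k"
  shows "k j \<le> Fin l \<longleftrightarrow> 2 / 3 * (1 / q) ^ j * phi (mu \<pi> k) (l + 1) < phi (mu \<pi> k) l"
proof (cases "lim k \<le> Fin l")
  case True
  obtain c where c: "phi (mu \<pi> k) l = (1 / q) ^ c * phi (mu \<pi> k) (l + 1)" "0 < phi (mu \<pi> k) (l + 1)"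
    "\<And>j. k j \<le> Fin l \<longleftrightarrow> c \<le> j" by (rule phi_mu_ratio[OF k True], rule that)
  show ?thesis
    unfolding c(1,3) mult_less_cancel_right_pos[OF c(2)] inverse_q_power_le_iff ..
next
  case False
  then have "\<not> k j \<le> Fin l" using decseq_lim_le[OF k, of j] by (meson order_trans)
  moreover have "phi (mu \<pi> k) l = 0" using False by (intro phi_mu_zero[OF k]) simp
  moreover have "0 \<le> phi (mu \<pi> k) (l + 1)"
  proof (cases "lim k \<le> Fin (l + 1)")
    case True
    then show ?thesis by (rule phi_mu_ratio[OF k]) (simp add: phi_mu_prod) 
  next
    case False
    then show ?thesis using phi_mu_zero[OF k, of "l + 1"] by simp
  qed
  ultimately show ?thesis by (simp add: mult_less_0_iff not_less)
qed

text \<open>The negation of \<open>le_Fin_iff_phi\<close> is not an open condition, so a separate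
  strict inequality is required. Below \<open>lim k\<close> both sides may vanish at
  \<open>l\<close> itself; the inequality then holds at the jump, where \<open>l' + 1\<close> equals
  the limit and \<open>phi\<close> turns from \<open>0\<close> to a positive value. This is why some
  \<open>l' \<ge> l\<close> is allowed.\<close>

lemma less_Fin_iff_phi:
  assumes k: "decseq k"
  shows "Fin l < k j \<longleftrightarrow> (\<exists>l'\<ge>l. phi (mu \<pi> k) l' < 2 / 3 * (1 / q) ^ j * phi (mu \<pi> k) (l' + 1))"
proof
  assume lk: "Fin l < k j"
  show "\<exists>l'\<ge>l. phi (mu \<pi> k) l' < 2 / 3 * (1 / q) ^ j * phi (mu \<pi> k) (l' + 1)"
  proof (cases "lim k \<le> Fin l")
    case True
    obtain c where c: "phi (mu \<pi> k) l = (1 / q) ^ c * phi (mu \<pi> k) (l + 1)" "0 < phi (mu \<pi> k) (l + 1)"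
      "\<And>j. k j \<le> Fin l \<longleftrightarrow> c \<le> j" by (rule phi_mu_ratio[OF k True], rule that)
    have "j < c" using lk c(3)[of j] by (simp flip: not_le)
    then have "(1 / q) ^ c \<le> (1 / q) ^ Suc j" using q_gt_1 by (intro power_decreasing) auto
    also have "\<dots> \<le> 1 / 2 * (1 / q) ^ j" using q_ge_2 by (simp add: field_simps)
    also have "\<dots> < 2 / 3 * (1 / q) ^ j" by (intro mult_strict_right_mono) auto
    finally have "(1 / q) ^ c * phi (mu \<pi> k) (l + 1) < 2 / 3 * (1 / q) ^ j * phi (mu \<pi> k) (l + 1)"
      using c(2) by (rule mult_strict_right_mono)
    then show ?thesis using c(1) by auto
  next
    case False
    then obtain c where c: "lim k = Fin c" "l < c" by (cases "lim k") auto
    have "phi (mu \<pi> k) (c - 1) = 0" using c by (intro phi_mu_zero[OF k]) simp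
    moreover have "0 < phi (mu \<pi> k) c"
    proof (rule phi_mu_ratio[OF k, of c])
      fix d assume d: "phi (mu \<pi> k) c = (1 / q) ^ d * phi (mu \<pi> k) (c + 1)" "0 < phi (mu \<pi> k) (c + 1)"
      then show ?thesis by simp
    qed (simp add: c)
    ultimately show ?thesis using c by (intro exI[of _ "c - 1"]) simp
  qed
next
  assume "\<exists>l'\<ge>l. phi (mu \<pi> k) l' < 2 / 3 * (1 / q) ^ j * phi (mu \<pi> k) (l' + 1)"
  then obtain l' where l': "l \<le> l'" "phi (mu \<pi> k) l' < 2 / 3 * (1 / q) ^ j * phi (mu \<pi> k) (l' + 1)" by blast
  then have "\<not> k j \<le> Fin l'" using le_Fin_iff_phi[OF k, of j l'] by simp
  then show "Fin l < k j" using l'(1) by (cases "k j") auto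
qed

section \<open>Injectivity and continuity of the inverse\<close>

lemma inj_on_mu: "inj_on (mu \<pi>) Delta"
proof (rule inj_onI, rule ext)
  fix k k' j assume k: "k \<in> Delta" "k' \<in> Delta" "mu \<pi> k = mu \<pi> k'"
  then have "k j \<le> Fin l \<longleftrightarrow> k' j \<le> Fin l" for l
    using le_Fin_iff_phi[of k j l] le_Fin_iff_phi[of k' j l] by (simp add: Delta_def)
  then show "k j = k' j" by (rule int_minf_eqI)
qed

text \<open>If \<open>k 0\<close> exceeded \<open>l\<close>, at least one factor
  \<open>1 / q\<close>, hence at most \<open>1 / 2\<close>, would enter \<open>phi\<close>. This
  confines the parameters of approximating measures to a compact set.\<close>

lemma first_le_of_phi:
  assumes k: "decseq k" and "1 / 2 < phi (mu \<pi> k) l"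
  shows "k 0 \<le> Fin l"
proof (rule ccontr)
  assume n: "\<not> k 0 \<le> Fin l"
  have "lim k \<le> Fin l"
    using phi_mu_zero[OF k, of l] assms(2) by force
  then obtain c where c: "phi (mu \<pi> k) l = (1 / q) ^ c * phi (mu \<pi> k) (l + 1)"
    "\<And>j. k j \<le> Fin l \<longleftrightarrow> c \<le> j" "0 < phi (mu \<pi> k) (l + 1)" using phi_mu_ratio[OF k] by metis
  have "(1 / q) ^ c \<le> (1 / q) ^ 1" using c(2)[of 0] n q_gt_1 by (intro power_decreasing) auto
  also have "\<dots> \<le> 1 / 2" using q_ge_2 by (simp add: field_simps)
  finally have "(1 / q) ^ c * phi (mu \<pi> k) (l + 1) \<le> 1 / 2 * 1"
    using abs_phi_le[OF mu_borel_probs[OF k], of "l + 1"] c(3)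
    by (intro mult_mono) (auto simp: abs_le_iff)
  then show False using c(1) assms(2) by simp
qed

lemma continuous_map_phi: "continuous_map weak_topology euclidean (\<lambda>\<mu>. phi \<mu> l)"
  unfolding phi_def
proof (rule continuous_map_weak_integral[OF continuous_on_phi_fun_entry])
  show "bounded (range (\<lambda>M. phi_fun l (M 0 0)))"
    using abs_phi_fun_le by (auto simp: bounded_iff)
qed

text \<open>The order topology is generated by half-lines, and membership of
  \<open>g \<mu> j\<close> in one is expressed by strict inequalities between values of
  \<open>phi\<close>, which are weakly continuous in \<open>\<mu>\<close>.\<close>

lemma continuous_map_mu_inverse:
  assumes X: "X = subtopology weak_topology (mu \<pi> ` Delta)" and g: "\<And>k. k \<in> Delta \<Longrightarrow> g (mu \<pi> k) = k"
  shows "continuous_map X (top_of_set Delta) g"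
proof -
  have top: "topspace X \<subseteq> mu \<pi> ` Delta" by (simp add: X)
  have phi: "continuous_map X euclidean (\<lambda>\<mu>. phi \<mu> l)" for l
    unfolding X by (rule continuous_map_from_subtopology[OF continuous_map_phi])
  have lt: "openin X {\<mu> \<in> topspace X. h \<mu> < h' \<mu>}"
    if "continuous_map X euclidean h" "continuous_map X euclidean h'" for h h' :: "_ \<Rightarrow> real"
  proof -
    have "continuous_map X euclidean (\<lambda>\<mu>. h' \<mu> - h \<mu>)" by (intro continuous_map_diff that)
    then have "openin X {\<mu> \<in> topspace X. h' \<mu> - h \<mu> \<in> {0<..}}"
      by (rule openin_continuous_map_preimage) simp
    then show ?thesis by simp
  qed
  have m: "continuous_map X euclidean (\<lambda>\<mu>. c * phi \<mu> l)" for c l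
    by (intro continuous_map_real_mult_left phi)
  have le_open: "openin X {\<mu> \<in> topspace X. g \<mu> j \<le> Fin l}" for j l
  proof -
    have "{\<mu> \<in> topspace X. g \<mu> j \<le> Fin l} = {\<mu> \<in> topspace X. 2 / 3 * (1 / q) ^ j * phi \<mu> (l + 1) < phi \<mu> l}"
      using top g le_Fin_iff_phi[of _ j l] by (auto simp: Delta_def)
    then show ?thesis using lt[OF m phi] by (simp only:)
  qed
  have gt_open: "openin X {\<mu> \<in> topspace X. Fin l < g \<mu> j}" for j l
  proof -
    have "{\<mu> \<in> topspace X. Fin l < g \<mu> j} =
        (\<Union>l'\<in>{l..}. {\<mu> \<in> topspace X. phi \<mu> l' < 2 / 3 * (1 / q) ^ j * phi \<mu> (l' + 1)})"
    proof -
      have "Fin l < g \<mu> j \<longleftrightarrow> (\<exists>l'\<ge>l. phi \<mu> l' < 2 / 3 * (1 / q) ^ j * phi \<mu> (l' + 1))"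
        if "\<mu> \<in> topspace X" for \<mu>
      proof -
        obtain k where k: "k \<in> Delta" "\<mu> = mu \<pi> k" using top \<open>\<mu> \<in> topspace X\<close> by blast
        then show ?thesis using g[OF k(1)] less_Fin_iff_phi[of k l j] by (simp only: Delta_def mem_Collect_eq)
      qed
      then show ?thesis by blast
    qed
    then show ?thesis using lt[OF phi m] by (simp only:) (intro openin_Union, blast)
  qed
  have comp: "openin X {\<mu> \<in> topspace X. g \<mu> j \<in> U}" if "open U" for U j
    using that unfolding open_generated_order
  proof induction
    case UNIV
    then show ?case by simp
  next
    case (Int a b)
    then have "openin X ({\<mu> \<in> topspace X. g \<mu> j \<in> a} \<inter> {\<mu> \<in> topspace X. g \<mu> j \<in> b})" by blast
    moreover have "{\<mu> \<in> topspace X. g \<mu> j \<in> a} \<inter> {\<mu> \<in> topspace X. g \<mu> j \<in> b} = {\<mu> \<in> topspace X. g \<mu> j \<in> a \<inter> b}" by blast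
    ultimately show ?case by simp
  next
    case (UN K)
    then have "openin X (\<Union>a\<in>K. {\<mu> \<in> topspace X. g \<mu> j \<in> a})" by blast
    moreover have "(\<Union>a\<in>K. {\<mu> \<in> topspace X. g \<mu> j \<in> a}) = {\<mu> \<in> topspace X. g \<mu> j \<in> \<Union>K}" by blast
    ultimately show ?case by simp
  next
    case (Basis s)
    then consider a where "s = {..<a}" | a where "s = {a<..}" by blast
    then show ?case
    proof cases
      case 1
      show ?thesis
      proof (cases a)
        case (Fin c)
        then show ?thesis using 1 le_open[of j "c - 1"] lessThan_Fin[of c] by simp
      qed (simp add: 1)
    next
      case 2
      show ?thesis
      proof (cases a)
        case MInfty
        \<comment> \<open>The half-line above \<open>MInfty\<close> is the union of the half-lines
          above the integers, for which openness is already known.\<close>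
        have "MInfty < x \<longleftrightarrow> (\<exists>l. Fin l < x)" for x
        proof (cases x)
          case (Fin b)
          then show ?thesis using Fin_less_iff(1)[of "b - 1" b] by (metis Fin_less_iff(2) diff_add_cancel zle_add1_eq_le order.refl)
        qed simp
        then have "{\<mu> \<in> topspace X. g \<mu> j \<in> s} = (\<Union>l. {\<mu> \<in> topspace X. Fin l < g \<mu> j})"
          using 2 MInfty by auto
        then show ?thesis using gt_open by auto
      next
        case (Fin c)
        then show ?thesis using 2 gt_open[of c j] by simp
      qed
    qed
  qed
  have "continuous_map X euclidean g"
    unfolding euclidean_product_topology[symmetric] continuous_map_componentwise_UNIV
    using comp by (simp add: continuous_map)
  then show ?thesis
    using top g by (auto simp: continuous_map_in_subtopology)
qed

end

section \<open>Random rectangular matrices that extend to invertible ones\<close>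

text \<open>The entry in row \<open>i\<close> and column \<open>a\<close> is the variable \<open>lab i a\<close>. A square block congruent to the
  identity modulo the maximal ideal makes the matrix extendable, and with many columns such a
  block exists with high probability.\<close>

definition has_unit_block :: "(nat \<Rightarrow> nat \<Rightarrow> 'i) \<Rightarrow> nat \<Rightarrow> nat \<Rightarrow> ('i \<Rightarrow> 'a::nonarch_local_field) \<Rightarrow> bool" where
  "has_unit_block lab m J \<omega> \<longleftrightarrow>
     (\<exists>b<J. \<forall>i<m. \<forall>t<m. abs_val (\<omega> (lab i (b * m + t)) - inf_id i t) < 1)"

context uniformized_field
begin

lemma has_unit_block_rows:
  assumes \<omega>: "\<omega> \<in> space (haar_pow :: ('i \<Rightarrow> 'a) measure)" and "has_unit_block lab m J \<omega>"
  obtains g h where "GL_pair (J * m) g h" "m \<le> J * m" "\<And>i a. i < m \<Longrightarrow> a < J * m \<Longrightarrow> g i a = \<omega> (lab i a)"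
proof -
  obtain b where b: "b < J" "\<And>i t. i < m \<Longrightarrow> t < m \<Longrightarrow> abs_val (\<omega> (lab i (b * m + t)) - inf_id i t) < 1"
    using assms(2) unfolding has_unit_block_def by blast
  have le: "b * m + m \<le> J * m"
    using b(1) mult_le_mono1[of "Suc b" J m] by simp
  have "\<exists>g h. GL_pair (J * m) g h \<and> (\<forall>i<m. \<forall>a<J * m. g i a = \<omega> (lab i a))"
    using \<omega> b(2) by (intro ex_GL_pair_rows[OF le]) (auto simp: in_space_haar_pow)
  moreover have "m \<le> J * m" using le by linarith
  ultimately show ?thesis using that by blast
qed

lemma measurable_abs_val_diff_less:
  "Measurable.pred (haar_pow :: ('i \<Rightarrow> 'a) measure) (\<lambda>\<omega>. abs_val (\<omega> v - c) < r)"
  by (intro borel_measurable_pred_less borel_measurable_const measurable_compose[OF _ measurable_abs_val]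
      borel_measurable_diff_nonarch measurable_haar_pow_component)

lemma measurable_has_unit_block [measurable]:
  "Measurable.pred (haar_pow :: ('i \<Rightarrow> 'a) measure) (has_unit_block lab m J)"
proof -
  have "has_unit_block lab m J = (\<lambda>\<omega>::'i \<Rightarrow> 'a. \<exists>b\<in>{..<J}. \<forall>i\<in>{..<m}. \<forall>t\<in>{..<m}.
      abs_val (\<omega> (lab i (b * m + t)) - inf_id i t) < 1)"
    by (auto simp: has_unit_block_def fun_eq_iff)
  then show ?thesis
    using measurable_abs_val_diff_less by (simp only:) (intro pred_intros_finite(3,4) finite_lessThan)
qed

text \<open>The \<open>J\<close> column blocks involve disjoint sets of variables. Each is congruent
  to the identity with probability \<open>(1 / q) ^ (m * m)\<close>, one factor for each entry, so
  the failures multiply.\<close>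

lemma prob_not_unit_block:
  fixes lab :: "nat \<Rightarrow> nat \<Rightarrow> 'i"
  assumes inj: "\<And>i a i' a'. lab i a = lab i' a' \<Longrightarrow> i = i' \<and> a = a'"
  shows "(\<integral>\<omega>. of_bool (\<not> has_unit_block lab m J \<omega>) \<partial>(haar_pow :: ('i \<Rightarrow> 'a) measure)) =
    (1 - (1 / q) ^ (m * m)) ^ J"
proof (induction J)
  case 0
  interpret H: prob_space "haar_pow :: ('i \<Rightarrow> 'a) measure" by (rule prob_space_haar_pow)
  show ?case by (simp add: has_unit_block_def H.prob_space)
next
  case (Suc J)
  interpret H: prob_space "haar_pow :: ('i \<Rightarrow> 'a) measure" by (rule prob_space_haar_pow)
  define E where "E \<omega> \<longleftrightarrow> (\<forall>i<m. \<forall>t<m. abs_val (\<omega> (lab i (J * m + t)) - inf_id i t) < 1)" for \<omega> :: "'i \<Rightarrow> 'a"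
  have [measurable]: "Measurable.pred haar_pow E"
  proof -
    have "E = (\<lambda>\<omega>. \<forall>i\<in>{..<m}. \<forall>t\<in>{..<m}. abs_val (\<omega> (lab i (J * m + t)) - inf_id i t) < 1)"
      by (auto simp: E_def fun_eq_iff)
    then show ?thesis
      using measurable_abs_val_diff_less by (simp only:) (intro pred_intros_finite(3,4) finite_lessThan)
  qed
  have of_bool_Suc: "(of_bool (\<not> has_unit_block lab m (Suc J) \<omega>) :: real) =
      of_bool (\<not> has_unit_block lab m J \<omega>) * of_bool (\<not> E \<omega>)" for \<omega> :: "'i \<Rightarrow> 'a"
    by (auto simp: has_unit_block_def E_def less_Suc_eq)
  have "(\<integral>\<omega>. (of_bool (\<not> has_unit_block lab m (Suc J) \<omega>) :: real) \<partial>(haar_pow :: ('i \<Rightarrow> 'a) measure)) =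
      (\<integral>\<omega>. of_bool (\<not> has_unit_block lab m J \<omega>) \<partial>(haar_pow :: ('i \<Rightarrow> 'a) measure)) *
      (\<integral>\<omega>. of_bool (\<not> E \<omega>) \<partial>(haar_pow :: ('i \<Rightarrow> 'a) measure))"
    unfolding of_bool_Suc
  proof (rule integral_mult_indep[where S="{lab i a |i a. a < J * m}" and B=1 and B'=1])
    fix x y :: "'i \<Rightarrow> 'a"
    show "(of_bool (\<not> has_unit_block lab m J x) :: real) = of_bool (\<not> has_unit_block lab m J y)"
      if "\<And>i. i \<in> {lab i a |i a. a < J * m} \<Longrightarrow> x i = y i"
    proof -
      have "x (lab i (b * m + t)) = y (lab i (b * m + t))" if "b < J" "t < m" for i b t
      proof -
        have "b * m + t < J * m" using that mult_le_mono1[of "Suc b" J m] by simp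
        then show ?thesis using \<open>\<And>i. i \<in> {lab i a |i a. a < J * m} \<Longrightarrow> x i = y i\<close> by blast
      qed
      then have "has_unit_block lab m J x \<longleftrightarrow> has_unit_block lab m J y"
        unfolding has_unit_block_def by (intro ex_cong1 conj_cong refl all_cong1 imp_cong) simp
      then show ?thesis by simp
    qed
    show "(of_bool (\<not> E x) :: real) = of_bool (\<not> E y)"
      if "\<And>i. i \<notin> {lab i a |i a. a < J * m} \<Longrightarrow> x i = y i"
    proof -
      have "x (lab i (J * m + t)) = y (lab i (J * m + t))" for i t
        using inj that[of "lab i (J * m + t)"] by force
      then show ?thesis by (simp add: E_def)
    qed
  qed auto
  also have "(\<integral>\<omega>. (of_bool (\<not> E \<omega>) :: real) \<partial>(haar_pow :: ('i \<Rightarrow> 'a) measure)) = 1 - (1 / q) ^ (m * m)"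
  proof -
    have "(\<integral>\<omega>. (of_bool (\<not> E \<omega>) :: real) \<partial>(haar_pow :: ('i \<Rightarrow> 'a) measure)) = measure haar_pow {\<omega> \<in> space haar_pow. \<not> E \<omega>}"
      by (rule integral_of_bool) measurable
    also have "\<dots> = 1 - measure haar_pow {\<omega> \<in> space haar_pow. E \<omega>}"
      by (rule H.prob_neg) measurable
    also have "measure haar_pow {\<omega> \<in> space haar_pow. E \<omega>} = (1 / q) ^ (m * m)"
    proof -
      \<comment> \<open>Diagonal labels must lie near \<open>1\<close>, the others near
        \<open>0\<close>. The radius is \<open>1 / q ^ 1\<close> because an absolute value below
        \<open>1\<close> is at most \<open>1 / q\<close>.\<close>
      define F where "F v = (if \<exists>t<m. v = lab t (J * m + t) then cball (1::'a) (1 / q ^ 1) else cball 0 (1 / q ^ 1))" for v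
      let ?f = "\<lambda>(i, t). lab i (J * m + t)"
      let ?I = "{..<m} \<times> {..<m}"
      have F: "F (lab i (J * m + t)) = cball (inf_id i t) (1 / q ^ 1)" if "i < m" "t < m" for i t
      proof -
        have "(\<exists>t'<m. lab i (J * m + t) = lab t' (J * m + t')) \<longleftrightarrow> i = t"
          using that inj by (metis add_left_cancel)
        then show ?thesis by (simp add: F_def inf_id_def)
      qed
      have Fs: "F v \<in> sets haar_integers" "emeasure haar_integers (F v) = ennreal (1 / q)" for v
        using cball_in_haar_sets[of "1::'a" 1] cball_in_haar_sets[of "0::'a" 1]
          emeasure_haar_cball[of "1::'a" 1] emeasure_haar_cball[of "0::'a" 1] by (auto simp: F_def)
      have "{\<omega> \<in> space haar_pow. E \<omega>} = {\<omega> \<in> space haar_pow. \<forall>j\<in>?f ` ?I. \<omega> j \<in> F j}"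
        unfolding E_def abs_val_less_1_iff by (auto simp: F cball_eq_abs_val)
      moreover have "emeasure haar_pow {\<omega> \<in> space haar_pow. \<forall>j\<in>?f ` ?I. \<omega> j \<in> F j} = (\<Prod>j\<in>?f ` ?I. emeasure haar_integers (F j))"
        using Fs by (intro emeasure_haar_pow_Collect) auto
      moreover have "(\<Prod>j\<in>?f ` ?I. emeasure haar_integers (F j)) = ennreal ((1 / q) ^ (m * m))"
      proof -
        have "inj_on ?f ?I" using inj by (fastforce simp: inj_on_def)
        then have "card (?f ` ?I) = m * m" by (simp add: card_image card_cartesian_product)
        then show ?thesis by (simp add: Fs ennreal_power)
      qed
      ultimately show ?thesis by (simp add: measure_def)
    qed
    finally show ?thesis .
  qed
  finally show ?case using Suc.IH by simp
qed

lemma prob_not_unit_block_tendsto: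
  "(\<lambda>J. (1 - (1 / q) ^ (m * m)) ^ J) \<longlonglongrightarrow> 0"
proof (rule LIMSEQ_power_zero)
  have "0 < (1 / q) ^ (m * m)" "(1 / q) ^ (m * m) \<le> 1"
    using q_gt_1 by (auto intro: power_le_one)
  then show "norm (1 - (1 / q) ^ (m * m)) < 1" by simp
qed

section \<open>Continuity of the parametrisation\<close>

text \<open>Since the rows \<open>x\<close> extend to an invertible matrix, multiplying the Haar
  distributed \<open>Y\<close> by them gives a Haar distributed corner. The integral shift
  \<open>w\<close> is a translation and leaves the law unchanged.\<close>

lemma integral_uniform_product:
  fixes f :: "(nat \<times> nat \<Rightarrow> 'a) \<Rightarrow> real" and x :: "nat \<Rightarrow> nat \<Rightarrow> 'a"
  assumes g: "GL_pair N g h" "m \<le> N" "\<And>i a. i < m \<Longrightarrow> a < N \<Longrightarrow> g i a = x i a"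
    and x: "\<And>i a. x i a \<in> ring_of_integers" and w: "\<And>i j. w i j \<in> ring_of_integers"
    and f: "f \<in> borel_measurable haar_pow"
    and corner: "\<And>z z'. (\<And>i j. i < m \<Longrightarrow> j < m \<Longrightarrow> z (i, j) = z' (i, j)) \<Longrightarrow> f z = f z'"
  shows "(\<integral>\<omega>. f (\<lambda>(i, j). (\<Sum>a<N. x i a * \<omega> (YVar (N0 + a) j)) + w i j) \<partial>haar_pow) = (\<integral>z. f z \<partial>haar_pow)"
proof -
  \<comment> \<open>Outside the corner, where \<open>f\<close> does not look, the variables
    \<open>Z\<close> serve as filler: they make \<open>T\<close> surjective onto the full
    power.\<close>
  define T where "T \<omega> = (\<lambda>(i, j). if i < m \<and> j < m then \<Sum>a<N. x i a * \<omega> (YVar (N0 + a) j) else \<omega> (ZVar i j))"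
    for \<omega> :: "var_label \<Rightarrow> 'a"
  define w' where "w' = (\<lambda>(i, j). w i j)"
  have w': "w' \<in> space haar_pow" using w by (simp add: in_space_haar_pow w'_def split_def)
  have Tm: "T \<in> haar_pow \<rightarrow>\<^sub>M haar_pow"
  proof (rule measurable_haar_powI)
    fix p
    show "(\<lambda>\<omega>. T \<omega> p) \<in> borel_measurable haar_pow"
      unfolding T_def split_def by (cases "fst p < m \<and> snd p < m") (simp_all add: borel_measurable_sum)
    show "T \<omega> p \<in> ring_of_integers" if "\<omega> \<in> space haar_pow" for \<omega>
      using that x by (auto simp: T_def split_def in_space_haar_pow)
  qed
  have surj: "\<exists>\<omega>\<in>space haar_pow. T \<omega> = y" if y: "y \<in> space haar_pow" for y
  proof -
    have "\<exists>z. (\<forall>a. z a \<in> ring_of_integers) \<and> (\<forall>i<m. (\<Sum>a<N. x i a * z a) = y (i, j))" for j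
      using y by (intro GL_pair_rows_surj[OF g]) (auto simp: in_space_haar_pow)
    then obtain Z where Z: "\<And>j a. Z j a \<in> ring_of_integers"
      "\<And>i j. i < m \<Longrightarrow> (\<Sum>a<N. x i a * Z j a) = y (i, j)" by metis
    define \<omega> where "\<omega> v = (case v of XVar n i \<Rightarrow> 0 | YVar n j \<Rightarrow> Z j (n - N0) | ZVar i j \<Rightarrow> y (i, j))" for v
    have "\<omega> \<in> space haar_pow"
      using y Z(1) by (auto simp: in_space_haar_pow \<omega>_def split: var_label.split)
    moreover have "T \<omega> = y"
      using Z(2) by (auto simp: T_def \<omega>_def fun_eq_iff)
    ultimately show ?thesis by blast
  qed
  have fw: "(\<lambda>z. f (\<lambda>p. z p + w' p)) \<in> borel_measurable haar_pow"
    by (rule measurable_compose[OF measurable_haar_pow_add f]) (auto simp: w')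
  have "(\<integral>\<omega>. f (\<lambda>(i, j). (\<Sum>a<N. x i a * \<omega> (YVar (N0 + a) j)) + w i j) \<partial>haar_pow) =
      (\<integral>\<omega>. f (\<lambda>p. T \<omega> p + w' p) \<partial>haar_pow)"
    by (intro Bochner_Integration.integral_cong refl corner) (simp add: T_def w'_def)
  also have "\<dots> = (\<integral>z. f (\<lambda>p. z p + w' p) \<partial>haar_pow)"
  proof (rule integral_haar_pow_surj[OF Tm _ surj fw])
    show "T (\<lambda>v. x v + y v) p = T x p + T y p" for x y p
      by (cases p) (simp add: T_def ring_distribs sum.distrib)
  qed
  also have "\<dots> = (\<integral>z. f z \<partial>distr haar_pow haar_pow (\<lambda>z p. z p + w' p))"
    using w' by (intro integral_distr[symmetric] f measurable_haar_pow_add) auto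
  also have "\<dots> = (\<integral>z. f z \<partial>haar_pow)" by (simp add: distr_haar_pow_add[OF w'])
  finally show ?thesis .
qed

lemma abs_integral_le_const:
  fixes f :: "'b \<Rightarrow> real"
  assumes "prob_space M" "\<And>x. \<bar>f x\<bar> \<le> B"
  shows "\<bar>\<integral>x. f x \<partial>M\<bar> \<le> B"
proof -
  interpret prob_space M by fact
  have B0: "0 \<le> B" using assms(2)[of undefined] by linarith
  show ?thesis
  proof (cases "integrable M f")
    case True
    have "\<bar>\<integral>x. f x \<partial>M\<bar> \<le> (\<integral>x. \<bar>f x\<bar> \<partial>M)" by (rule integral_abs_bound)
    also have "\<dots> \<le> (\<integral>x. B \<partial>M)" using True assms(2) by (intro integral_mono) auto
    finally show ?thesis by (simp add: prob_space)
  qed (simp add: not_integrable_integral_eq B0)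
qed

definition corner_fun :: "nat \<Rightarrow> ('a inf_matrix \<Rightarrow> real) \<Rightarrow> bool" where
  "corner_fun m f \<longleftrightarrow> f \<in> borel_measurable borel \<and>
     (\<forall>M M'. (\<forall>i<m. \<forall>j<m. M i j = M' i j) \<longrightarrow> f M = f M')"

lemma random_matrix_finite_lim:
  assumes \<omega>: "\<omega> \<in> space haar_pow" and k: "decseq k" and N0: "\<And>n. n \<ge> N0 \<Longrightarrow> k n = Fin c" "\<And>n. n < N0 \<Longrightarrow> Fin c < k n"
  shows "random_matrix \<pi> k \<omega> i j =
    (\<Sum>n<N0. neg_power \<pi> (k n) * \<omega> (XVar n i) * \<omega> (YVar n j)) + neg_power \<pi> (Fin c) * \<omega> (ZVar i j)"
proof -
  have "k \<longlonglongrightarrow> Fin c" by (intro tendsto_eventually eventually_sequentiallyI[of N0] N0)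
  then have lim: "lim k = Fin c" by (rule limI)
  have "lim (\<lambda>n. k (n + N0)) = Fin c" using lim lim_shift[OF k] by simp
  then have "random_matrix \<pi> (\<lambda>n. k (n + N0)) (shift_vars N0 \<omega>) i j = neg_power \<pi> (Fin c) * \<omega> (ZVar i j)"
    using N0 by (simp add: random_matrix_eq rm_term_def del: neg_power.simps)
  moreover have "(\<Sum>n<N0. rm_term k \<omega> i j n) = (\<Sum>n<N0. neg_power \<pi> (k n) * \<omega> (XVar n i) * \<omega> (YVar n j))"
    using N0 by (intro sum.cong) (auto simp: rm_term_def lim)
  ultimately show ?thesis using random_matrix_split[OF \<omega> k, of i j N0] by simp
qed

text \<open>If \<open>k\<close> is constant from \<open>N0\<close> on, then the block \<open>Z\<close> can be replaced by a sum of \<open>J * m\<close> products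
  \<open>X Y\<close>: on the event of a unit block both are uniform given all other variables, and adding
  integral terms does not change a uniform distribution.\<close>

lemma integral_mu_diff_le:
  assumes h: "corner_fun m h" and B: "\<And>M. \<bar>h M\<bar> \<le> B"
    and k: "decseq k" "\<And>n. n \<ge> N0 \<Longrightarrow> k n = Fin c" "\<And>n. n < N0 \<Longrightarrow> Fin c < k n"
    and k': "decseq k'" "\<And>n. n < N0 + J * m \<Longrightarrow> k' n = k n" "lim k' < Fin c" "k' (N0 + J * m) \<le> Fin c"
  shows "\<bar>(\<integral>M. h M \<partial>mu \<pi> k') - (\<integral>M. h M \<partial>mu \<pi> k)\<bar> \<le> 2 * B * (1 - (1 / q) ^ (m * m)) ^ J"
proof -
  interpret H: prob_space "haar_pow :: (var_label \<Rightarrow> 'a) measure" by (rule prob_space_haar_pow)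
  have B0: "0 \<le> B" using B[of undefined] by linarith
  have hm[measurable]: "h \<in> borel_measurable borel" using h by (simp add: corner_fun_def)
  have hc: "h M = h M'" if "\<And>i j. i < m \<Longrightarrow> j < m \<Longrightarrow> M i j = M' i j" for M M'
    using h that unfolding corner_fun_def by blast
  define L where "L = J * m"
  define p where "p = neg_power \<pi> (Fin c)"
  have p: "abs_val p = q powi c" "p \<noteq> 0" unfolding p_def by (simp_all add: abs_val_pi_power_int)
  define A where "A \<omega> i j = (\<Sum>n<N0. neg_power \<pi> (k n) * \<omega> (XVar n i) * \<omega> (YVar n j))" for \<omega> :: "var_label \<Rightarrow> 'a" and i j
  \<comment> \<open>The contribution of \<open>k'\<close> from index \<open>N0 + L\<close> on,
    measured in units of \<open>p\<close>. It is integral because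
    \<open>k' (N0 + L) \<le> Fin c\<close>, so it acts as the shift in
    \<open>integral_uniform_product\<close>.\<close>
  define W where "W \<omega> i j = random_matrix \<pi> (\<lambda>n. k' (n + (N0 + L))) (shift_vars (N0 + L) \<omega>) i j / p"
    for \<omega> :: "var_label \<Rightarrow> 'a" and i j
  \<comment> \<open>The common conditional expectation: the first \<open>N0\<close> terms are fixed
    and \<open>p\<close> times a Haar distributed matrix is added. For \<open>k\<close> it arises by
    integrating out \<open>Z\<close>, for \<open>k'\<close> by integrating out the variables
    \<open>Y\<close> in a window of length \<open>L\<close>, provided the corresponding
    \<open>X\<close> have a unit block.\<close>
  define R where "R \<omega> = (\<integral>z. h (\<lambda>i j. A \<omega> i j + p * z (i, j)) \<partial>(haar_pow :: (nat \<times> nat \<Rightarrow> 'a) measure))" for \<omega>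
  \<comment> \<open>\<open>S\<close> and \<open>S'\<close> are the coordinates kept fixed, so each
    is the complement of the set of variables to be integrated.\<close>
  define S where "S = - {v. \<exists>n j. v = YVar n j \<and> N0 \<le> n \<and> n < N0 + L}"
  define S' where "S' = - {v. \<exists>i j. v = ZVar i j}"
  have O: "\<omega> v \<in> ring_of_integers" if "\<omega> \<in> space haar_pow" for \<omega> :: "var_label \<Rightarrow> 'a" and v
    using that by (simp add: in_space_haar_pow)
  have mM: "(\<lambda>z. (\<lambda>i j. a i j + p * z (i, j))) \<in> borel_measurable (haar_pow :: (nat \<times> nat \<Rightarrow> 'a) measure)" for a
    by (intro borel_measurable_inf_matrixI) measurable
  have k'm: "(\<lambda>\<omega>. h (random_matrix \<pi> k' \<omega>)) \<in> borel_measurable haar_pow"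
    using measurable_random_matrix[OF k'(1)] by measurable
  have km: "(\<lambda>\<omega>. h (random_matrix \<pi> k \<omega>)) \<in> borel_measurable haar_pow"
    using measurable_random_matrix[OF k(1)] by measurable
  have in_k: "(\<integral>y. h (random_matrix \<pi> k (merge_coords S' (x, y))) \<partial>haar_pow) = R x" if x: "x \<in> space haar_pow" for x
  proof -
    define T where "T y = (\<lambda>(i, j). y (ZVar i j))" for y :: "var_label \<Rightarrow> 'a"
    have "(\<integral>y. h (random_matrix \<pi> k (merge_coords S' (x, y))) \<partial>haar_pow) = (\<integral>y. h (\<lambda>i j. A x i j + p * T y (i, j)) \<partial>haar_pow)"
    proof (intro Bochner_Integration.integral_cong refl hc)
      fix y :: "var_label \<Rightarrow> 'a" and i j assume y: "y \<in> space haar_pow"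
      have "merge_coords S' (x, y) \<in> space haar_pow"
        using x y by (simp add: in_space_haar_pow merge_coords_def)
      then show "random_matrix \<pi> k (merge_coords S' (x, y)) i j = A x i j + p * T y (i, j)"
        using random_matrix_finite_lim[OF _ k]
        by (simp add: A_def p_def T_def merge_coords_def S'_def del: neg_power.simps)
    qed
    also have "\<dots> = R x"
      unfolding R_def
    proof (rule integral_haar_pow_surj)
      show "T \<in> haar_pow \<rightarrow>\<^sub>M haar_pow"
        by (rule measurable_haar_powI) (auto simp: T_def split_def O)
      show "T (\<lambda>i. x i + y i) j = T x j + T y j" for x y j by (simp add: T_def split_def)
      show "\<exists>x\<in>space haar_pow. T x = y" if "y \<in> space haar_pow" for y
        using that by (intro bexI[of _ "\<lambda>v. case v of ZVar i j \<Rightarrow> y (i, j) | _ \<Rightarrow> 0"])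
          (auto simp: T_def in_space_haar_pow split: var_label.split)
      show "(\<lambda>z. h (\<lambda>i j. A x i j + p * z (i, j))) \<in> borel_measurable haar_pow"
        using measurable_compose[OF mM hm] .
    qed
    finally show ?thesis .
  qed
  have in_k': "(\<integral>y. h (random_matrix \<pi> k' (merge_coords S (x, y))) \<partial>haar_pow) = R x"
    if x: "x \<in> space haar_pow" and good: "has_unit_block (\<lambda>i a. XVar (N0 + a) i) m J x" for x
  proof -
    define X where "X i a = x (XVar (N0 + a) i)" for i a
    obtain g g' where g: "GL_pair L g g'" "m \<le> L" "\<And>i a. i < m \<Longrightarrow> a < L \<Longrightarrow> g i a = X i a"
      using has_unit_block_rows[OF x good] unfolding L_def X_def by metis
    have W: "W x i j \<in> ring_of_integers" for i j
    proof -
      have "abs_val (random_matrix \<pi> (\<lambda>n. k' (n + (N0 + L))) (shift_vars (N0 + L) x) i j) \<le> q powi c"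
        using k'(4) by (intro abs_val_random_matrix_le shift_vars_space x decseq_shift k') (simp add: L_def)
      then show ?thesis using q_powi_pos[of c] by (simp add: W_def mem_ring_of_integers abs_val_divide p)
    qed
    have "(\<integral>y. h (random_matrix \<pi> k' (merge_coords S (x, y))) \<partial>haar_pow) =
        (\<integral>y. (\<lambda>z. h (\<lambda>i j. A x i j + p * z (i, j))) (\<lambda>(i, j). (\<Sum>a<L. X i a * y (YVar (N0 + a) j)) + W x i j) \<partial>haar_pow)"
    proof (intro Bochner_Integration.integral_cong refl hc)
      fix y :: "var_label \<Rightarrow> 'a" and i j assume y: "y \<in> space haar_pow"
      let ?m = "merge_coords S (x, y)"
      have m: "?m \<in> space haar_pow" using x y by (simp add: in_space_haar_pow merge_coords_def)
      have "(\<Sum>n<N0 + L. rm_term k' ?m i j n) = (\<Sum>n<N0. rm_term k' ?m i j n) + (\<Sum>a<L. rm_term k' ?m i j (N0 + a))"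
        by (induction L) (simp_all add: add.assoc)
      also have "(\<Sum>n<N0. rm_term k' ?m i j n) = A x i j"
        unfolding A_def
      proof (rule sum.cong)
        fix n assume n: "n \<in> {..<N0}"
        have "k' n = k n" using k'(2)[of n] n by simp
        moreover have "lim k' < k n" using k(3)[of n] k'(3) n by simp
        ultimately show "rm_term k' ?m i j n = neg_power \<pi> (k n) * x (XVar n i) * x (YVar n j)"
          using n by (simp add: rm_term_def merge_coords_def S_def)
      qed simp
      also have "(\<Sum>a<L. rm_term k' ?m i j (N0 + a)) = p * (\<Sum>a<L. X i a * y (YVar (N0 + a) j))"
        unfolding sum_distrib_left
      proof (rule sum.cong)
        fix a assume a: "a \<in> {..<L}"
        have "k' (N0 + a) = Fin c" using k'(2)[of "N0 + a"] k(2)[of "N0 + a"] a by (simp add: L_def)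
        then show "rm_term k' ?m i j (N0 + a) = p * (X i a * y (YVar (N0 + a) j))"
          using k'(3) a by (simp add: rm_term_def merge_coords_def S_def X_def p_def mult.assoc del: neg_power.simps)
      qed simp
      finally have 1: "(\<Sum>n<N0 + L. rm_term k' ?m i j n) = A x i j + p * (\<Sum>a<L. X i a * y (YVar (N0 + a) j))" .
      have "shift_vars (N0 + L) ?m = shift_vars (N0 + L) x"
      proof
        fix v show "shift_vars (N0 + L) ?m v = shift_vars (N0 + L) x v"
          by (cases v) (auto simp: merge_coords_def S_def)
      qed
      then have "random_matrix \<pi> (\<lambda>n. k' (n + (N0 + L))) (shift_vars (N0 + L) ?m) i j = p * W x i j"
        using p(2) by (simp add: W_def)
      then show "random_matrix \<pi> k' ?m i j = A x i j + p * (case (i, j) of (i, j) \<Rightarrow> (\<Sum>a<L. X i a * y (YVar (N0 + a) j)) + W x i j)"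
        unfolding random_matrix_split[OF m k'(1), of i j "N0 + L"] 1 by (simp add: ring_distribs)
    qed
    also have "\<dots> = (\<integral>z. h (\<lambda>i j. A x i j + p * z (i, j)) \<partial>haar_pow)"
    proof (rule integral_uniform_product[OF g])
      show "X i a \<in> ring_of_integers" for i a using O[OF x] by (simp add: X_def)
      show "(\<lambda>z. h (\<lambda>i j. A x i j + p * z (i, j))) \<in> borel_measurable haar_pow"
        using measurable_compose[OF mM hm] .
      show "h (\<lambda>i j. A x i j + p * z (i, j)) = h (\<lambda>i j. A x i j + p * z' (i, j))"
        if "\<And>i j. i < m \<Longrightarrow> j < m \<Longrightarrow> z (i, j) = z' (i, j)" for z z'
        using that by (intro hc) auto
    qed (use W in auto)
    finally show ?thesis by (simp add: R_def)
  qed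
  have R_le: "\<bar>R x\<bar> \<le> B" if x: "x \<in> space haar_pow" for x
    unfolding in_k[OF x, symmetric] by (rule abs_integral_le_const[OF prob_space_haar_pow B])
  let ?I = "\<lambda>x. \<integral>y. h (random_matrix \<pi> k' (merge_coords S (x, y))) \<partial>haar_pow"
  have I_le: "\<bar>?I x\<bar> \<le> B" for x
    by (rule abs_integral_le_const[OF prob_space_haar_pow B])
  have Im: "?I \<in> borel_measurable haar_pow"
    by (rule integral_merge_coords(2)[OF k'm, of B]) (rule B)
  have Rm: "R \<in> borel_measurable haar_pow"
  proof -
    have "(\<lambda>x. \<integral>y. h (random_matrix \<pi> k (merge_coords S' (x, y))) \<partial>haar_pow) \<in> borel_measurable haar_pow"
      by (rule integral_merge_coords(2)[OF km, of B]) (rule B)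
    then show ?thesis using in_k by (simp cong: measurable_cong)
  qed
  have "(\<integral>M. h M \<partial>mu \<pi> k') = (\<integral>x. ?I x \<partial>haar_pow)"
    unfolding integral_mu[OF k'(1) hm] by (rule integral_merge_coords(1)[OF k'm, of B]) (rule B)
  moreover have "(\<integral>M. h M \<partial>mu \<pi> k) = (\<integral>x. R x \<partial>haar_pow)"
  proof -
    have "(\<integral>M. h M \<partial>mu \<pi> k) = (\<integral>x. (\<integral>y. h (random_matrix \<pi> k (merge_coords S' (x, y))) \<partial>haar_pow) \<partial>haar_pow)"
      unfolding integral_mu[OF k(1) hm] by (rule integral_merge_coords(1)[OF km, of B]) (rule B)
    then show ?thesis using in_k by (simp cong: Bochner_Integration.integral_cong)
  qed
  moreover have "integrable haar_pow ?I" "integrable haar_pow R"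
    using I_le R_le Im Rm by (auto intro!: H.integrable_const_bound[of _ B])
  ultimately have "\<bar>(\<integral>M. h M \<partial>mu \<pi> k') - (\<integral>M. h M \<partial>mu \<pi> k)\<bar> = \<bar>\<integral>x. ?I x - R x \<partial>haar_pow\<bar>"
    by simp
  also have "\<dots> \<le> (\<integral>x. \<bar>?I x - R x\<bar> \<partial>haar_pow)" by (rule integral_abs_bound)
  also have "\<dots> \<le> (\<integral>x. 2 * B * of_bool (\<not> has_unit_block (\<lambda>i a. XVar (N0 + a) i) m J x) \<partial>(haar_pow :: (var_label \<Rightarrow> 'a) measure))"
  proof (rule integral_mono)
    show "integrable haar_pow (\<lambda>x. \<bar>?I x - R x\<bar>)"
      using \<open>integrable haar_pow ?I\<close> \<open>integrable haar_pow R\<close> by auto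
    show "integrable haar_pow (\<lambda>x::var_label \<Rightarrow> 'a. 2 * B * of_bool (\<not> has_unit_block (\<lambda>i a. XVar (N0 + a) i) m J x))"
      using B0 by (intro H.integrable_const_bound[of _ "2 * B"]) auto
    show "\<bar>?I x - R x\<bar> \<le> 2 * B * of_bool (\<not> has_unit_block (\<lambda>i a. XVar (N0 + a) i) m J x)"
      if x: "x \<in> space haar_pow" for x
      using in_k'[OF x] I_le[of x] R_le[OF x] by (cases "has_unit_block (\<lambda>i a. XVar (N0 + a) i) m J x") auto
  qed
  also have "\<dots> = 2 * B * (1 - (1 / q) ^ (m * m)) ^ J"
    using prob_not_unit_block[of "\<lambda>i a. XVar (N0 + a) i" m J] by simp
  finally show ?thesis .
qed

end

section \<open>Compactness, truncation and local estimates\<close>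

lemma compact_Pi_UNIV:
  fixes S :: "'i \<Rightarrow> 'b::topological_space set"
  assumes "\<And>i. compact (S i)"
  shows "compact {f. \<forall>i. f i \<in> S i}"
proof -
  have "compactin (product_topology (\<lambda>i. euclidean) UNIV) (\<Pi>\<^sub>E i\<in>UNIV. S i)"
    using assms by (subst compactin_PiE) auto
  moreover have "(\<Pi>\<^sub>E i\<in>UNIV. S i) = {f. \<forall>i. f i \<in> S i}" by auto
  ultimately show ?thesis by (simp add: euclidean_product_topology)
qed

text \<open>A neighbourhood of \<open>MInfty\<close> contains all integers below some
  \<open>a\<close>, so only the finitely many points from \<open>a\<close> to \<open>c\<close>
  remain to be covered.\<close>

lemma compact_atMost_Fin: "compact {..Fin c}"
  unfolding compact_eq_Heine_Borel
proof (intro allI impI, elim conjE)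
  fix C assume C: "\<forall>t\<in>C. open t" "{..Fin c} \<subseteq> \<Union>C"
  then obtain U where U: "U \<in> C" "MInfty \<in> U" by (meson MInfty_le UnionE atMost_iff subsetD)
  then obtain b where b: "MInfty < b" "{MInfty..<b} \<subseteq> U"
    using open_right[of U MInfty "Fin 0"] C by auto
  then obtain a where a: "b = Fin a" by (auto simp: MInfty_less_iff)
  have "\<exists>g. \<forall>s\<in>{a..c}. g s \<in> C \<and> Fin s \<in> g s"
  proof (intro bchoice ballI)
    fix s assume "s \<in> {a..c}"
    then have "Fin s \<in> {..Fin c}" by simp
    then have "Fin s \<in> \<Union>C" using C(2) by (rule subsetD[rotated])
    then show "\<exists>y. y \<in> C \<and> Fin s \<in> y" by blast
  qed
  then obtain g where g: "\<And>s. s \<in> {a..c} \<Longrightarrow> g s \<in> C \<and> Fin s \<in> g s" by blast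
  have "x \<in> \<Union>(insert U (g ` {a..c}))" if "x \<le> Fin c" for x
  proof (cases "x < Fin a")
    case True
    then show ?thesis using b a by auto
  next
    case False
    then obtain s where "x = Fin s" "s \<in> {a..c}" using \<open>x \<le> Fin c\<close> by (cases x) auto
    then show ?thesis using g[of s] by blast
  qed
  then show "\<exists>C'\<subseteq>C. finite C' \<and> {..Fin c} \<subseteq> \<Union>C'"
    using U g by (intro exI[of _ "insert U (g ` {a..c})"]) auto
qed

lemma tendsto_funI:
  fixes f :: "'b \<Rightarrow> 'i \<Rightarrow> 'c::topological_space"
  assumes "\<And>i. ((\<lambda>n. f n i) \<longlongrightarrow> l i) F"
  shows "(f \<longlongrightarrow> l) F"
proof -
  have "limitin (product_topology (\<lambda>i. euclidean) UNIV) f l F"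
    using assms by (simp add: limitin_componentwise)
  then show ?thesis by (simp add: euclidean_product_topology)
qed

lemma open_agree_initial:
  assumes "\<And>j. j < N \<Longrightarrow> k j \<noteq> MInfty"
  shows "open {k'::nat \<Rightarrow> int_minf. \<forall>j<N. k' j = k j}"
proof -
  have "open {k'::nat \<Rightarrow> int_minf. \<forall>j\<in>{..<N}. k' j \<in> {k j}}"
  proof (rule product_topology_basis')
    show "open {k j}" if "j \<in> {..<N}" for j
      using assms[of j] that open_singleton_Fin by (cases "k j") auto
  qed simp
  moreover have "{k'::nat \<Rightarrow> int_minf. \<forall>j\<in>{..<N}. k' j \<in> {k j}} = {k'. \<forall>j<N. k' j = k j}" by auto
  ultimately show ?thesis by simp
qed

lemma open_le_Fin: "open {k::nat \<Rightarrow> int_minf. k j \<le> Fin c}"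
proof -
  have "open {k::nat \<Rightarrow> int_minf. \<forall>i\<in>{j}. k i \<in> {..Fin c}}"
    using open_atMost_Fin by (intro product_topology_basis') auto
  then show ?thesis by simp
qed

context uniformized_field
begin

definition entry_ball :: "real \<Rightarrow> 'a inf_matrix set" where
  "entry_ball R = {M. \<forall>i j. abs_val (M i j) \<le> R}"

lemma compact_entry_ball: "compact (entry_ball R)"
proof -
  have "compact {f::nat \<Rightarrow> 'a. \<forall>j. f j \<in> cball 0 R}"
    by (intro compact_Pi_UNIV compact_cball_nonarch)
  from compact_Pi_UNIV[OF this]
  have "compact {M::'a inf_matrix. \<forall>i. M i \<in> {f. \<forall>j. f j \<in> cball 0 R}}" .
  then show ?thesis by (simp add: entry_ball_def cball_eq_abs_val)
qed

text \<open>The chosen point depends on the ball around \<open>x\<close> only, not on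
  \<open>x\<close>. So the function is constant on balls, hence continuous, and plays the role of
  cutting off an expansion after \<open>n\<close> digits.\<close>

definition digit_rep :: "nat \<Rightarrow> 'a \<Rightarrow> 'a" where
  "digit_rep n x = (SOME y. y \<in> cball x (1 / q ^ n))"

lemma digit_rep_close: "abs_val (digit_rep n x - x) \<le> 1 / q ^ n"
proof -
  have "x \<in> cball x (1 / q ^ n)" by simp
  then have "digit_rep n x \<in> cball x (1 / q ^ n)" unfolding digit_rep_def by (rule someI)
  then show ?thesis by (simp add: cball_eq_abs_val)
qed

lemma digit_rep_eq: "abs_val (x - y) \<le> 1 / q ^ n \<Longrightarrow> digit_rep n x = digit_rep n y"
  unfolding digit_rep_def by (simp add: cball_nonarch_eq)

lemma continuous_on_digit_rep: "continuous_on UNIV (digit_rep n)"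
  unfolding continuous_on_topological
proof (intro ballI allI impI)
  fix x B assume B: "digit_rep n x \<in> B"
  have "digit_rep n y \<in> B" if "y \<in> cball x (1 / q ^ n)" for y
    using that B digit_rep_eq[of y x n] by (simp add: cball_eq_abs_val)
  moreover have "open (cball x (1 / q ^ n))" "x \<in> cball x (1 / q ^ n)"
    by (auto intro: open_cball_nonarch)
  ultimately show "\<exists>A. open A \<and> x \<in> A \<and> (\<forall>y\<in>UNIV. y \<in> A \<longrightarrow> digit_rep n y \<in> B)"
    by blast
qed

definition trunc :: "nat \<Rightarrow> 'a inf_matrix \<Rightarrow> 'a inf_matrix" where
  "trunc n M i j = (if i < n \<and> j < n then digit_rep n (M i j) else 0)"

lemma continuous_on_trunc: "continuous_on UNIV (trunc n)"
proof (intro continuous_on_coordinatewise_then_product)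
  fix i j
  show "continuous_on UNIV (\<lambda>M. trunc n M i j)"
  proof (cases "i < n \<and> j < n")
    case True
    then show ?thesis unfolding trunc_def
      using continuous_on_compose2[OF continuous_on_digit_rep[of n] continuous_on_entry[of i j]] by simp
  next
    case False
    then have "(\<lambda>M. trunc n M i j) = (\<lambda>_. 0)" by (auto simp: trunc_def)
    then show ?thesis by (simp only:) (rule continuous_on_const)
  qed
qed

lemma trunc_eq:
  assumes "\<And>i j. i < n \<Longrightarrow> j < n \<Longrightarrow> abs_val (M i j - M' i j) \<le> 1 / q ^ n"
  shows "trunc n M = trunc n M'"
  using assms by (auto simp: trunc_def fun_eq_iff intro: digit_rep_eq)

text \<open>By compactness a sequence of counterexamples has a convergent subsequence. Its
  truncations converge to the same limit, because every fixed entry eventually lies in the kept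
  corner and is reproduced to increasing precision, which contradicts continuity of \<open>f\<close>
  there.\<close>

lemma uniform_trunc_approx:
  fixes f :: "'a inf_matrix \<Rightarrow> real"
  assumes f: "continuous_on UNIV f" and e: "0 < e"
  shows "\<exists>n\<ge>1. \<forall>M\<in>entry_ball R. \<bar>f (trunc n M) - f M\<bar> < e"
proof (rule ccontr)
  assume "\<not> ?thesis"
  then have "\<forall>n. \<exists>M\<in>entry_ball R. \<not> \<bar>f (trunc (Suc n) M) - f M\<bar> < e" by auto
  then obtain X where X: "\<And>n. X n \<in> entry_ball R" "\<And>n. \<not> \<bar>f (trunc (Suc n) (X n)) - f (X n)\<bar> < e" by metis
  obtain l r where lr: "l \<in> entry_ball R" "strict_mono r" "(X \<circ> r) \<longlonglongrightarrow> l"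
    using compact_imp_seq_compact[OF compact_entry_ball[of R]] X(1) unfolding seq_compact_def by blast
  have ent: "(\<lambda>n. X (r n) i j) \<longlonglongrightarrow> l i j" for i j
    using continuous_on_tendsto_compose[OF continuous_on_entry[of i j] lr(3)] by simp
  have "(\<lambda>n. trunc (Suc (r n)) (X (r n))) \<longlonglongrightarrow> l"
  proof (intro tendsto_funI)
    fix i j
    have "(\<lambda>n. trunc (Suc (r n)) (X (r n)) i j - X (r n) i j) \<longlonglongrightarrow> 0"
    proof (rule tendstoI)
      fix d :: real assume "0 < d"
      then obtain m where m: "1 / q ^ m < d" by (rule inverse_q_power_lt)
      have "dist (trunc (Suc (r n)) (X (r n)) i j - X (r n) i j) 0 < d" if n: "n \<ge> max m (max i j)" for n
      proof -
        have rn: "n \<le> r n" using seq_suble[OF lr(2)] .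
        then have "trunc (Suc (r n)) (X (r n)) i j = digit_rep (Suc (r n)) (X (r n) i j)"
          using n by (simp add: trunc_def)
        then have "dist (trunc (Suc (r n)) (X (r n)) i j - X (r n) i j) 0 \<le> 1 / q ^ Suc (r n)"
          using digit_rep_close[of "Suc (r n)" "X (r n) i j"] by (simp add: abs_val_conv_dist)
        also have "\<dots> \<le> 1 / q ^ m"
          using n rn q_gt_1 by (intro divide_left_mono power_increasing) auto
        finally show ?thesis using m by simp
      qed
      then show "\<forall>\<^sub>F n in sequentially. dist (trunc (Suc (r n)) (X (r n)) i j - X (r n) i j) 0 < d"
        by (rule eventually_sequentiallyI)
    qed
    from tendsto_add[OF this ent[of i j]]
    show "(\<lambda>n. trunc (Suc (r n)) (X (r n)) i j) \<longlonglongrightarrow> l i j" by simp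
  qed
  then have "(\<lambda>n. f (trunc (Suc (r n)) (X (r n)))) \<longlonglongrightarrow> f l"
    by (rule continuous_on_tendsto_compose[OF f]) auto
  moreover have "(\<lambda>n. f (X (r n))) \<longlonglongrightarrow> f l"
    using continuous_on_tendsto_compose[OF f lr(3)] by simp
  ultimately have "(\<lambda>n. f (trunc (Suc (r n)) (X (r n))) - f (X (r n))) \<longlonglongrightarrow> 0"
    using tendsto_diff by fastforce
  then have "\<forall>\<^sub>F n in sequentially. \<bar>f (trunc (Suc (r n)) (X (r n))) - f (X (r n))\<bar> < e"
    using e unfolding tendsto_iff by simp
  then show False using X(2) by (auto simp: eventually_sequentially)
qed

text \<open>If \<open>k\<close> reaches \<open>- n\<close>, parameters that agree with
  \<open>k\<close> up to that point change the matrix by at most \<open>1 / q ^ n\<close>, which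
  \<open>h\<close> does not notice. Otherwise \<open>k\<close> stabilises at an integer
  \<open>c\<close>; a parameter agreeing with \<open>k\<close> for long enough either equals
  \<open>k\<close> or falls below \<open>c\<close> later, and then
  \<open>integral_mu_diff_le\<close> applies.\<close>

lemma locally_close_corner:
  fixes h :: "'a inf_matrix \<Rightarrow> real"
  assumes h: "h \<in> borel_measurable borel" "\<And>M. \<bar>h M\<bar> \<le> B"
    and hc: "\<And>M M'. (\<And>i j. i < n \<Longrightarrow> j < n \<Longrightarrow> abs_val (M i j - M' i j) \<le> 1 / q ^ n) \<Longrightarrow> h M = h M'"
    and n: "1 \<le> n" and k: "k \<in> Delta" and e: "0 < e"
  shows "\<exists>U. open U \<and> k \<in> U \<and> (\<forall>k'\<in>Delta. k' \<in> U \<longrightarrow> \<bar>(\<integral>M. h M \<partial>mu \<pi> k') - (\<integral>M. h M \<partial>mu \<pi> k)\<bar> \<le> e)"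
proof (cases "\<exists>N. k N \<le> Fin (- int n)")
  case True
  define N where "N = (LEAST N. k N \<le> Fin (- int n))"
  have N: "k N \<le> Fin (- int n)" unfolding N_def using True by (rule LeastI_ex)
  have big: "Fin (- int n) < k j" if "j < N" for j
    using not_less_Least[OF that[unfolded N_def]] by simp
  then have fin: "k j \<noteq> MInfty" if "j < N" for j using that by fastforce
  define U where "U = {k'. \<forall>j<N. k' j = k j} \<inter> {k'. k' N \<le> Fin (- int n)}"
  have "\<bar>(\<integral>M. h M \<partial>mu \<pi> k') - (\<integral>M. h M \<partial>mu \<pi> k)\<bar> \<le> e" if k': "k' \<in> Delta" "k' \<in> U" for k'
  proof -
    have "h (random_matrix \<pi> k' \<omega>) = h (random_matrix \<pi> k \<omega>)" if \<omega>: "\<omega> \<in> space haar_pow" for \<omega>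
    proof (rule hc)
      fix i j
      have dec: "decseq k" "decseq k'" using k k' by (auto simp: Delta_def)
      have tail: "abs_val (random_matrix \<pi> (\<lambda>n. \<kappa> (n + N)) (shift_vars N \<omega>) i j) \<le> 1 / q ^ n"
        if "decseq \<kappa>" "\<kappa> N \<le> Fin (- int n)" for \<kappa>
        using abs_val_random_matrix_le[OF shift_vars_space[OF \<omega>] decseq_shift[OF that(1)], of N "- int n" N i j] that(2)
        by (simp add: q_powi_minus_nat)
      have "rm_term k' \<omega> i j a = rm_term k \<omega> i j a" if "a < N" for a
      proof -
        have "k' a = k a" using k' that by (simp add: U_def)
        moreover have "lim k < k a" "lim k' < k a"
          using decseq_lim_le[OF dec(1), of N] decseq_lim_le[OF dec(2), of N] N k' big[OF that]
          by (auto simp: U_def)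
        ultimately show ?thesis by (simp add: rm_term_def)
      qed
      then have eq: "(\<Sum>a<N. rm_term k' \<omega> i j a) = (\<Sum>a<N. rm_term k \<omega> i j a)" by simp
      have "random_matrix \<pi> k' \<omega> i j - random_matrix \<pi> k \<omega> i j =
          random_matrix \<pi> (\<lambda>n. k' (n + N)) (shift_vars N \<omega>) i j - random_matrix \<pi> (\<lambda>n. k (n + N)) (shift_vars N \<omega>) i j"
        unfolding random_matrix_split[OF \<omega> dec(1), of i j N] random_matrix_split[OF \<omega> dec(2), of i j N] eq by simp
      then show "abs_val (random_matrix \<pi> k' \<omega> i j - random_matrix \<pi> k \<omega> i j) \<le> 1 / q ^ n"
        using tail[OF dec(1) N] tail[OF dec(2)] k' by (auto simp: U_def intro: abs_val_diff_le)
    qed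
    then have "(\<integral>M. h M \<partial>mu \<pi> k') = (\<integral>M. h M \<partial>mu \<pi> k)"
      using k k' h(1) by (simp add: integral_mu Delta_def cong: Bochner_Integration.integral_cong)
    then show ?thesis using e by simp
  qed
  moreover have "open U" unfolding U_def by (intro open_Int open_agree_initial open_le_Fin fin)
  moreover have "k \<in> U" using N by (simp add: U_def)
  ultimately show ?thesis by blast
next
  case False
  have k_dec: "decseq k" using k by (simp add: Delta_def)
  from k_dec obtain c N1 where c: "lim k = Fin c" "\<And>n. n \<ge> N1 \<Longrightarrow> k n = Fin c"
  proof (cases rule: decseq_int_minf_cases)
    case infinite
    then show ?thesis using False by blast
  qed (rule that)
  define N0 where "N0 = (LEAST N. k N \<le> Fin c)"
  have N0: "k N0 \<le> Fin c" unfolding N0_def by (rule LeastI[of _ N1]) (simp add: c)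
  have big: "Fin c < k j" if "j < N0" for j
    using not_less_Least[OF that[unfolded N0_def]] by simp
  have const: "k j = Fin c" if "j \<ge> N0" for j
    using decseqD[OF k_dec that] N0 decseq_lim_le[OF k_dec, of j] c by (metis order.antisym order.trans)
  have B0: "0 \<le> B" using h(2)[of undefined] by linarith
  have "(\<lambda>J. 2 * B * (1 - (1 / q) ^ (n * n)) ^ J) \<longlonglongrightarrow> 2 * B * 0"
    by (intro tendsto_mult_left prob_not_unit_block_tendsto)
  then have "\<forall>\<^sub>F J in sequentially. 2 * B * (1 - (1 / q) ^ (n * n)) ^ J < e"
    using e by (intro order_tendstoD) auto
  then obtain J where J: "2 * B * (1 - (1 / q) ^ (n * n)) ^ J < e"
    by (meson eventually_sequentially order.refl)
  \<comment> \<open>Agreement extends over \<open>J * n\<close> indices of the constant tail and, by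
    the \<open>Suc\<close>, one further index, which gives \<open>k' (N0 + J * n) = Fin c\<close>
    and bounds the rest of \<open>k'\<close>.\<close>
  define U where "U = {k'. \<forall>j<Suc (N0 + J * n). k' j = k j}"
  have "\<bar>(\<integral>M. h M \<partial>mu \<pi> k') - (\<integral>M. h M \<partial>mu \<pi> k)\<bar> \<le> e" if k': "k' \<in> Delta" "k' \<in> U" for k'
  proof -
    have dec: "decseq k'" using k' by (simp add: Delta_def)
    have k'c: "k' (N0 + J * n) = Fin c" using k' const[of "N0 + J * n"] by (simp add: U_def)
    then have lim: "lim k' \<le> Fin c" using decseq_lim_le[OF dec, of "N0 + J * n"] by simp
    show ?thesis
    proof (cases "lim k' = Fin c")
      case True
      \<comment> \<open>Monotonicity squeezes \<open>k'\<close> between its limit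
        \<open>Fin c\<close> and the value \<open>Fin c\<close> reached at
        \<open>N0 + J * n\<close>.\<close>
      have "k' = k"
      proof
        fix j show "k' j = k j"
        proof (cases "j \<le> N0 + J * n")
          case False
          then have "k' j \<le> Fin c" using decseqD[OF dec, of "N0 + J * n" j] k'c by simp
          moreover have "Fin c \<le> k' j" using decseq_lim_le[OF dec, of j] True by simp
          ultimately show ?thesis using const[of j] False by simp
        qed (use k' in \<open>simp add: U_def\<close>)
      qed
      then show ?thesis using e by simp
    next
      case False
      have "corner_fun n h"
        using h(1) by (auto simp: corner_fun_def intro!: hc)
      then have "\<bar>(\<integral>M. h M \<partial>mu \<pi> k') - (\<integral>M. h M \<partial>mu \<pi> k)\<bar> \<le> 2 * B * (1 - (1 / q) ^ (n * n)) ^ J"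
        using h(2) k_dec const big dec k' k'c lim False
        by (intro integral_mu_diff_le[where ?N0.0=N0 and c=c]) (auto simp: U_def)
      then show ?thesis using J by simp
    qed
  qed
  moreover have "open U"
    unfolding U_def
  proof (rule open_agree_initial)
    fix j show "k j \<noteq> MInfty" using decseq_lim_le[OF k_dec, of j] c by auto
  qed
  moreover have "k \<in> U" by (simp add: U_def)
  ultimately show ?thesis by blast
qed

text \<open>Truncation approximates \<open>f\<close> uniformly only on compact sets. The open
  condition \<open>k' 0 \<le> Fin b\<close> confines the random matrices of all nearby parameters to
  one compact set, so \<open>f\<close> may be replaced by a function of finitely many digits of
  finitely many entries.\<close>

lemma continuous_on_integral_mu:
  fixes f :: "'a inf_matrix \<Rightarrow> real"
  assumes f: "continuous_on UNIV f" and bd: "bounded (range f)"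
  shows "continuous_on Delta (\<lambda>k. \<integral>M. f M \<partial>mu \<pi> k)"
  unfolding continuous_on_topological
proof (intro ballI allI impI)
  interpret H: prob_space "haar_pow :: (var_label \<Rightarrow> 'a) measure" by (rule prob_space_haar_pow)
  obtain B where B: "\<And>M. \<bar>f M\<bar> \<le> B" using bd by (auto simp: bounded_iff)
  fix k S assume k: "k \<in> Delta" and S: "open S" "(\<integral>M. f M \<partial>mu \<pi> k) \<in> S"
  then obtain e where e: "0 < e" "\<And>y. \<bar>y - (\<integral>M. f M \<partial>mu \<pi> k)\<bar> < e \<Longrightarrow> y \<in> S"
    by (metis dist_real_def open_dist)
  obtain b where b: "k 0 \<le> Fin b" by (cases "k 0") auto
  obtain n where n: "1 \<le> n" "\<And>M. M \<in> entry_ball (q powi b) \<Longrightarrow> \<bar>f (trunc n M) - f M\<bar> < e / 4"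
    using uniform_trunc_approx[OF f, of "e / 4" "q powi b"] e by auto
  define h where "h M = f (trunc n M)" for M
  have ch: "continuous_on UNIV h"
    unfolding h_def by (rule continuous_on_compose2[OF f continuous_on_trunc]) simp
  have hm[measurable]: "h \<in> borel_measurable borel" and fm[measurable]: "f \<in> borel_measurable borel"
    using ch f by (auto intro: borel_measurable_continuous_onI)
  have hB: "\<bar>h M\<bar> \<le> B" for M by (simp add: h_def B)
  have hc: "h M = h M'" if "\<And>i j. i < n \<Longrightarrow> j < n \<Longrightarrow> abs_val (M i j - M' i j) \<le> 1 / q ^ n" for M M'
    unfolding h_def using trunc_eq[OF that] by simp
  obtain U where U: "open U" "k \<in> U"
    "\<And>k'. k' \<in> Delta \<Longrightarrow> k' \<in> U \<Longrightarrow> \<bar>(\<integral>M. h M \<partial>mu \<pi> k') - (\<integral>M. h M \<partial>mu \<pi> k)\<bar> \<le> e / 4"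
    using locally_close_corner[OF hm hB hc n(1) k, of "e / 4"] e by auto
  have close: "\<bar>(\<integral>M. f M \<partial>mu \<pi> k') - (\<integral>M. h M \<partial>mu \<pi> k')\<bar> \<le> e / 4"
    if k': "k' \<in> Delta" "k' 0 \<le> Fin b" for k'
  proof -
    have dec: "decseq k'" using k' by (simp add: Delta_def)
    have [measurable]: "random_matrix \<pi> k' \<in> haar_pow \<rightarrow>\<^sub>M borel" by (rule measurable_random_matrix[OF dec])
    have i: "integrable haar_pow (\<lambda>\<omega>. f (random_matrix \<pi> k' \<omega>))" "integrable haar_pow (\<lambda>\<omega>. h (random_matrix \<pi> k' \<omega>))"
      using B hB by (auto intro!: H.integrable_const_bound[of _ B])
    have "\<bar>\<integral>\<omega>. f (random_matrix \<pi> k' \<omega>) - h (random_matrix \<pi> k' \<omega>) \<partial>haar_pow\<bar> \<le>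
        (\<integral>\<omega>. \<bar>f (random_matrix \<pi> k' \<omega>) - h (random_matrix \<pi> k' \<omega>)\<bar> \<partial>haar_pow)"
      by (rule integral_abs_bound)
    also have "\<dots> \<le> (\<integral>\<omega>. e / 4 \<partial>(haar_pow :: (var_label \<Rightarrow> 'a) measure))"
    proof (rule integral_mono)
      fix \<omega> :: "var_label \<Rightarrow> 'a" assume "\<omega> \<in> space haar_pow"
      then have "random_matrix \<pi> k' \<omega> \<in> entry_ball (q powi b)"
        unfolding entry_ball_def using abs_val_random_matrix_le[OF _ dec k'(2)] by blast
      then show "\<bar>f (random_matrix \<pi> k' \<omega>) - h (random_matrix \<pi> k' \<omega>)\<bar> \<le> e / 4"
        using n(2)[of "random_matrix \<pi> k' \<omega>"] by (simp add: h_def abs_minus_commute)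
    qed (use i in auto)
    finally show ?thesis using i by (simp add: integral_mu[OF dec] H.prob_space)
  qed
  have "(\<integral>M. f M \<partial>mu \<pi> k') \<in> S" if k': "k' \<in> Delta" "k' \<in> U \<inter> {k'. k' 0 \<le> Fin b}" for k'
  proof (rule e(2))
    have "k' \<in> U" "k' 0 \<le> Fin b" using k'(2) by auto
    note close[OF k b] close[OF k'(1) this(2)] U(3)[OF k'(1) this(1)]
    then show "\<bar>(\<integral>M. f M \<partial>mu \<pi> k') - (\<integral>M. f M \<partial>mu \<pi> k)\<bar> < e"
      using e(1) by linarith
  qed
  moreover have "open (U \<inter> {k'. k' 0 \<le> Fin b})" by (intro open_Int U open_le_Fin)
  ultimately show "\<exists>A. open A \<and> k \<in> A \<and> (\<forall>y\<in>Delta. y \<in> A \<longrightarrow> (\<integral>M. f M \<partial>mu \<pi> y) \<in> S)"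
    using U(2) b by blast
qed

lemma continuous_map_mu: "continuous_map (top_of_set Delta) weak_topology (mu \<pi>)"
  unfolding weak_topology_def continuous_on_generated_topo_iff
proof (intro conjI allI impI)
  fix S assume "S \<in> {{\<mu> \<in> borel_probs. (\<integral>x. f x \<partial>\<mu>) \<in> U} |(f :: 'a inf_matrix \<Rightarrow> real) U.
        continuous_on UNIV f \<and> bounded (range f) \<and> open U}"
  then obtain f :: "'a inf_matrix \<Rightarrow> real" and U where f: "continuous_on UNIV f" "bounded (range f)" "open U"
    and S: "S = {\<mu> \<in> borel_probs. (\<integral>x. f x \<partial>\<mu>) \<in> U}" by blast
  have "mu \<pi> -` S \<inter> topspace (top_of_set Delta) = Delta \<inter> (\<lambda>k. \<integral>x. f x \<partial>mu \<pi> k) -` U"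
    using mu_borel_probs by (auto simp: S Delta_def)
  then show "openin (top_of_set Delta) (mu \<pi> -` S \<inter> topspace (top_of_set Delta))"
    using continuous_openin_preimage_gen[OF continuous_on_integral_mu[OF f(1,2)] f(3)] by simp
next
  have "borel_probs \<in> {{\<mu> \<in> borel_probs. (\<integral>x. f x \<partial>\<mu>) \<in> U} |(f :: 'a inf_matrix \<Rightarrow> real) U.
        continuous_on UNIV f \<and> bounded (range f) \<and> open U}"
    by (intro CollectI exI[of _ "\<lambda>_. 0"] exI[of _ UNIV]) auto
  then show "mu \<pi> ` topspace (top_of_set Delta) \<subseteq> \<Union>{{\<mu> \<in> borel_probs. (\<integral>x. f x \<partial>\<mu>) \<in> U} |(f :: 'a inf_matrix \<Rightarrow> real) U.
        continuous_on UNIV f \<and> bounded (range f) \<and> open U}"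
    using mu_borel_probs by (auto simp: Delta_def)
qed

end

section \<open>Averages over orbits\<close>

text \<open>The transpose of \<open>X\<close> times the leading block of \<open>M\<close> times
  \<open>Y\<close>. The summation index comes first in the labels so that a diagonal
  \<open>M\<close> gives the sum of rank-one terms in \<open>random_matrix\<close>.\<close>

definition sandwich :: "nat \<Rightarrow> 'a::nonarch_local_field inf_matrix \<Rightarrow> (var_label \<Rightarrow> 'a) \<Rightarrow> 'a inf_matrix" where
  "sandwich N M \<omega> i j = (\<Sum>a<N. \<omega> (XVar a i) * (\<Sum>b<N. M a b * \<omega> (YVar b j)))"

text \<open>Up to a small probability, multiplying by Haar distributed rectangular matrices is the same as
  taking a corner after acting with random elements of the group, so \<open>orbit_avg N f\<close> replaces the
  average of \<open>f\<close> over the orbit of the group at level \<open>N\<close>.\<close>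

definition orbit_avg :: "nat \<Rightarrow> ('a::nonarch_local_field inf_matrix \<Rightarrow> real) \<Rightarrow> 'a inf_matrix \<Rightarrow> real" where
  "orbit_avg N f M = (\<integral>\<omega>. f (sandwich N M \<omega>) \<partial>haar_pow)"

text \<open>Moves the factors of a \<open>block_equiv\<close> from the matrix onto the variables.
  For invertible factors this is an additive bijection and preserves Haar measure, so
  \<open>orbit_avg N f\<close> depends only on the equivalence class of the leading block.\<close>

fun block_vars :: "nat \<Rightarrow> 'a::nonarch_local_field inf_matrix \<Rightarrow> 'a inf_matrix \<Rightarrow>
    (var_label \<Rightarrow> 'a) \<Rightarrow> var_label \<Rightarrow> 'a" where
  "block_vars N g h \<omega> (XVar a i) = (if a < N then \<Sum>c<N. \<omega> (XVar c i) * g c a else \<omega> (XVar a i))"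
| "block_vars N g h \<omega> (YVar b j) = (if b < N then \<Sum>d<N. h b d * \<omega> (YVar d j) else \<omega> (YVar b j))"
| "block_vars N g h \<omega> (ZVar i j) = \<omega> (ZVar i j)"

lemma sandwich_block_vars:
  assumes "\<And>i j. i < N \<Longrightarrow> j < N \<Longrightarrow> B i j = (\<Sum>a<N. g i a * (\<Sum>b<N. A a b * h b j))"
  shows "sandwich N B \<omega> = sandwich N A (block_vars N g h \<omega>)"
proof (intro ext)
  fix i j
  have "sandwich N B \<omega> i j =
      (\<Sum>c<N. \<omega> (XVar c i) * (\<Sum>d<N. (\<Sum>a<N. g c a * (\<Sum>b<N. A a b * h b d)) * \<omega> (YVar d j)))"
    using assms by (simp add: sandwich_def)
  also have "\<dots> = (\<Sum>c<N. \<omega> (XVar c i) * (\<Sum>a<N. g c a * (\<Sum>b<N. A a b * (\<Sum>d<N. h b d * \<omega> (YVar d j)))))"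
    by (simp only: sum_mult_assoc)
  also have "\<dots> = (\<Sum>a<N. (\<Sum>c<N. \<omega> (XVar c i) * g c a) * (\<Sum>b<N. A a b * (\<Sum>d<N. h b d * \<omega> (YVar d j))))"
    by (rule sum_mult_assoc[symmetric])
  finally show "sandwich N B \<omega> i j = sandwich N A (block_vars N g h \<omega>) i j"
    by (simp add: sandwich_def)
qed

lemma block_vars_inverse:
  assumes g: "GL_pair N g g'" and h: "GL_pair N h h'"
  shows "block_vars N g h (block_vars N g' h' \<omega>) = \<omega>"
proof
  fix v
  show "block_vars N g h (block_vars N g' h' \<omega>) v = \<omega> v"
  proof (cases v)
    case (XVar a i)
    have "(\<Sum>c<N. (\<Sum>e<N. \<omega> (XVar e i) * g' e c) * g c a) = \<omega> (XVar a i)" if "a < N"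
    proof -
      have "(\<Sum>c<N. (\<Sum>e<N. \<omega> (XVar e i) * g' e c) * g c a) = (\<Sum>e<N. \<omega> (XVar e i) * (\<Sum>c<N. g' e c * g c a))"
        by (rule sum_mult_assoc)
      also have "\<dots> = (\<Sum>e<N. \<omega> (XVar e i) * inf_id e a)"
        using g that by (intro sum.cong) (auto simp: GL_pair_def)
      finally show ?thesis using that by simp
    qed
    then show ?thesis by (simp add: XVar)
  next
    case (YVar b j)
    have "(\<Sum>d<N. h b d * (\<Sum>e<N. h' d e * \<omega> (YVar e j))) = \<omega> (YVar b j)" if "b < N"
    proof -
      have "(\<Sum>d<N. h b d * (\<Sum>e<N. h' d e * \<omega> (YVar e j))) = (\<Sum>e<N. (\<Sum>d<N. h b d * h' d e) * \<omega> (YVar e j))"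
        by (rule sum_mult_assoc[symmetric])
      also have "\<dots> = (\<Sum>e<N. inf_id b e * \<omega> (YVar e j))"
        using h that by (intro sum.cong) (auto simp: GL_pair_def)
      finally show ?thesis using that by simp
    qed
    then show ?thesis by (simp add: YVar)
  qed simp
qed

lemma GL_act_inverse:
  assumes g: "GL_pair N g g'" and h: "GL_pair N h h'"
  shows "GL_act g h (GL_act g' h' M) = M"
proof (intro ext)
  fix i j
  note g' = GL_pair_sym[OF g] and h' = GL_pair_sym[OF h]
  have inner: "(\<Sum>a\<in>vrange N i. g i a * (\<Sum>d\<in>vrange N b. h d b * (\<Sum>c\<in>vrange N a. g' a c * M c d))) =
      (\<Sum>d\<in>vrange N b. h d b * M i d)" for b
  proof -
    have "(\<Sum>a\<in>vrange N i. g i a * (\<Sum>d\<in>vrange N b. h d b * (\<Sum>c\<in>vrange N a. g' a c * M c d))) =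
        (\<Sum>d\<in>vrange N b. h d b * (\<Sum>a\<in>vrange N i. g i a * (\<Sum>c\<in>vrange N a. g' a c * M c d)))"
      unfolding sum_distrib_left[of "g _ _"] sum_distrib_left[of "h _ b"]
      by (subst sum.swap) (simp add: mult.left_commute)
    then show ?thesis by (simp only: GL_pair_vrange_left[OF g])
  qed
  have "GL_act g h (GL_act g' h' M) i j =
    (\<Sum>b\<in>vrange N j. h' b j * (\<Sum>a\<in>vrange N i. g i a * (\<Sum>d\<in>vrange N b. h d b * (\<Sum>c\<in>vrange N a. g' a c * M c d))))"
    by (simp add: GL_act_vrange[OF g h] GL_act_vrange[OF g' h'])
  also have "\<dots> = (\<Sum>b\<in>vrange N j. h' b j * (\<Sum>d\<in>vrange N b. h d b * M i d))"
    by (simp only: inner)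
  also have "\<dots> = M i j" by (rule GL_pair_vrange_right[OF h])
  finally show "GL_act g h (GL_act g' h' M) i j = M i j" .
qed

lemma block_equiv_GL_act:
  assumes g: "GL_pair N g g'" and h: "GL_pair N h h'"
  shows "block_equiv N M (GL_act g h M)"
  unfolding block_equiv_def
proof (rule exI[of _ g], rule exI[of _ g'], rule exI[of _ h'], rule exI[of _ h], intro conjI allI impI)
  show "GL_pair N g g'" by fact
  show "GL_pair N h' h" by (rule GL_pair_sym[OF h])
  fix i j assume "i < N" "j < N"
  then show "GL_act g h M i j = (\<Sum>a<N. g i a * (\<Sum>b<N. M a b * h' b j))"
    by (simp add: GL_act_eq[OF g h order.refl] sum_distrib_left mult.assoc)
qed

context uniformized_field
begin

lemma measurable_sandwich:
  "(\<lambda>(M, \<omega>). sandwich N M \<omega>) \<in> (borel :: 'a inf_matrix measure) \<Otimes>\<^sub>M haar_pow \<rightarrow>\<^sub>M borel"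
proof (rule borel_measurable_inf_matrixI)
  fix i j
  have 1: "(\<lambda>p. fst p a b) \<in> borel_measurable ((borel :: 'a inf_matrix measure) \<Otimes>\<^sub>M (haar_pow :: (var_label \<Rightarrow> 'a) measure))" for a b
    by (rule measurable_compose[OF measurable_fst measurable_inf_matrix_entry])
  have 2: "(\<lambda>p. snd p v) \<in> borel_measurable ((borel :: 'a inf_matrix measure) \<Otimes>\<^sub>M (haar_pow :: (var_label \<Rightarrow> 'a) measure))" for v
    by (rule measurable_compose[OF measurable_snd measurable_haar_pow_component])
  show "(\<lambda>x. (case x of (M, \<omega>) \<Rightarrow> sandwich N M \<omega>) i j) \<in>
      borel_measurable ((borel :: 'a inf_matrix measure) \<Otimes>\<^sub>M haar_pow)"
    unfolding sandwich_def split_def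
    by (intro borel_measurable_sum borel_measurable_mult_nonarch 1 2)
qed

lemma measurable_sandwich_fixed: "sandwich N M \<in> haar_pow \<rightarrow>\<^sub>M (borel :: 'a inf_matrix measure)"
proof -
  have "(\<lambda>\<omega>. (M, \<omega>)) \<in> haar_pow \<rightarrow>\<^sub>M borel \<Otimes>\<^sub>M haar_pow" by (rule measurable_Pair1') simp
  from measurable_compose[OF this measurable_sandwich] show ?thesis by simp
qed

lemma orbit_avg_block_equiv:
  fixes f :: "'a inf_matrix \<Rightarrow> real"
  assumes "block_equiv N A B" and f: "f \<in> borel_measurable borel"
  shows "orbit_avg N f B = orbit_avg N f A"
proof -
  obtain g g' h h' where g: "GL_pair N g g'" and h: "GL_pair N h h'"
    and B: "\<And>i j. i < N \<Longrightarrow> j < N \<Longrightarrow> B i j = (\<Sum>a<N. g i a * (\<Sum>b<N. A a b * h b j))"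
    using assms(1) unfolding block_equiv_def by blast
  have meas: "block_vars N x y \<in> haar_pow \<rightarrow>\<^sub>M haar_pow"
    if "\<And>i j. x i j \<in> ring_of_integers" "\<And>i j. y i j \<in> ring_of_integers" for x y :: "'a inf_matrix"
  proof (rule measurable_haar_powI)
    show "(\<lambda>\<omega>. block_vars N x y \<omega> v) \<in> borel_measurable haar_pow" for v
      by (cases v) (simp_all add: borel_measurable_sum)
    show "block_vars N x y \<omega> v \<in> ring_of_integers" if "\<omega> \<in> space haar_pow" for \<omega> v
      using that \<open>\<And>i j. x i j \<in> ring_of_integers\<close> \<open>\<And>i j. y i j \<in> ring_of_integers\<close>
      by (cases v) (auto simp: in_space_haar_pow)
  qed
  have m: "block_vars N g h \<in> haar_pow \<rightarrow>\<^sub>M haar_pow" "block_vars N g' h' \<in> haar_pow \<rightarrow>\<^sub>M haar_pow"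
    using g h by (auto intro!: meas simp: GL_pair_def)
  have "sandwich N B \<omega> = sandwich N A (block_vars N g h \<omega>)" for \<omega>
    by (rule sandwich_block_vars[OF B])
  then have "orbit_avg N f B = (\<integral>\<omega>. f (sandwich N A (block_vars N g h \<omega>)) \<partial>haar_pow)"
    unfolding orbit_avg_def by (simp only:)
  also have "\<dots> = orbit_avg N f A"
    unfolding orbit_avg_def
  proof (rule integral_haar_pow_surj[OF m(1)])
    show "block_vars N g h (\<lambda>i. x i + y i) v = block_vars N g h x v + block_vars N g h y v" for x y v
      by (cases v) (simp_all add: ring_distribs sum.distrib)
    show "\<exists>x\<in>space haar_pow. block_vars N g h x = y" if "y \<in> space haar_pow" for y
      using block_vars_inverse[OF g h] measurable_space[OF m(2) that] by blast
    show "(\<lambda>\<omega>. f (sandwich N A \<omega>)) \<in> borel_measurable haar_pow"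
      by (rule measurable_compose[OF measurable_sandwich_fixed f])
  qed
  finally show ?thesis .
qed

text \<open>The block may be replaced by its Smith form, and unit factors turn the diagonal into
  powers of \<open>\<pi>\<close>. The sandwich of this diagonal matrix is the random matrix whose
  parameter lists the exponents, followed by \<open>MInfty\<close>; its limit is
  \<open>MInfty\<close>, so the block \<open>Z\<close> is absent.\<close>

lemma orbit_avg_eq_mu:
  fixes M :: "'a inf_matrix"
  obtains k where "k \<in> Delta"
    "\<And>f :: 'a inf_matrix \<Rightarrow> real. f \<in> borel_measurable borel \<Longrightarrow> orbit_avg N f M = (\<integral>x. f x \<partial>mu \<pi> k)"
proof -
  obtain d where d: "block_equiv N M (\<lambda>i j. if i = j then d i else 0)"
    "\<And>i j. i \<le> j \<Longrightarrow> j < N \<Longrightarrow> abs_val (d j) \<le> abs_val (d i)"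
    using smith_normal_form[of N M] by blast
  have "\<exists>x. if d a = 0 then x = MInfty else \<exists>e. x = Fin e \<and> abs_val (d a) = q powi e" for a
    by (cases "d a = 0") (auto elim: abs_val_values)
  then obtain e where e: "\<And>a. if d a = 0 then e a = MInfty else \<exists>s. e a = Fin s \<and> abs_val (d a) = q powi s"
    by metis
  define k where "k a = (if a < N then e a else MInfty)" for a
  have dec: "decseq k"
    unfolding decseq_def
  proof (intro allI impI)
    fix i j :: nat assume ij: "i \<le> j"
    show "k j \<le> k i"
    proof (cases "j < N")
      case True
      have "abs_val (d j) \<le> abs_val (d i)" using d(2)[OF ij True] .
      moreover have "\<not> q powi s \<le> 0" for s using q_powi_pos[of s] by (simp only: not_le)
      ultimately show ?thesis
        using e[of i] e[of j] ij True by (auto simp: k_def split: if_splits)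
    qed (simp add: k_def)
  qed
  \<comment> \<open>The unit that carries \<open>d a\<close> to the power of \<open>\<pi>\<close> of
    the same absolute value.\<close>
  define u where "u a = (if d a = 0 then 1 else neg_power \<pi> (e a) / d a)" for a
  have u: "abs_val (u a) = 1" for a
    using e[of a] by (auto simp: u_def abs_val_divide simp del: neg_power.simps)
  have ud: "u a * d a = neg_power \<pi> (e a)" for a
    using e[of a] by (auto simp: u_def)
  have "block_equiv N (\<lambda>i j. if i = j then d i else 0) (\<lambda>i j. if i = j then neg_power \<pi> (k i) else 0)"
  proof (rule block_equiv_left[OF GL_pair_diag[of u N, OF u]])
    fix i j assume ij: "i < N" "j < N"
    have "(\<Sum>a<N. (if i = a \<and> i < N then u i else inf_id i a) * (if a = j then d a else 0)) =
        (\<Sum>a<N. inf_id i a * (u i * (if a = j then d a else 0)))"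
      using ij by (intro sum.cong) (auto simp: inf_id_def)
    also have "\<dots> = (if i = j then neg_power \<pi> (k i) else 0)"
      using ij ud by (simp add: k_def)
    finally show "(if i = j then neg_power \<pi> (k i) else 0) =
        (\<Sum>a<N. (if i = a \<and> i < N then u i else inf_id i a) * (if a = j then d a else 0))" by simp
  qed
  then have eq: "block_equiv N M (\<lambda>i j. if i = j then neg_power \<pi> (k i) else 0)"
    using d(1) block_equiv_trans by blast
  have lim: "lim k = MInfty"
    by (intro limI tendsto_eventually eventually_sequentiallyI[of N]) (simp add: k_def)
  have rm: "random_matrix \<pi> k \<omega> = sandwich N (\<lambda>i j. if i = j then neg_power \<pi> (k i) else 0) \<omega>"
    if \<omega>: "\<omega> \<in> space haar_pow" for \<omega>
  proof (intro ext)
    fix i j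
    have l0: "lim (\<lambda>_::nat. MInfty) = MInfty" by (intro limI tendsto_const)
    have "random_matrix \<pi> (\<lambda>n. k (n + N)) (shift_vars N \<omega>) i j = 0"
      by (simp add: random_matrix_eq rm_term_def k_def l0)
    then have "random_matrix \<pi> k \<omega> i j = (\<Sum>n<N. rm_term k \<omega> i j n)"
      using random_matrix_split[OF \<omega> dec, of i j N] by simp
    also have "\<dots> = (\<Sum>n<N. \<omega> (XVar n i) * (neg_power \<pi> (k n) * \<omega> (YVar n j)))"
    proof (rule sum.cong)
      fix n
      show "rm_term k \<omega> i j n = \<omega> (XVar n i) * (neg_power \<pi> (k n) * \<omega> (YVar n j))"
        by (cases "k n") (simp_all add: rm_term_def lim mult_ac)
    qed simp
    also have "\<dots> = sandwich N (\<lambda>i j. if i = j then neg_power \<pi> (k i) else 0) \<omega> i j"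
    proof -
      have "(\<Sum>b<N. (if a = b then neg_power \<pi> (k a) else 0) * \<omega> (YVar b j)) = neg_power \<pi> (k a) * \<omega> (YVar a j)"
        if "a < N" for a
        using that by (simp add: if_distrib[where f="\<lambda>x. x * _"] cong: if_cong)
      then show ?thesis by (simp add: sandwich_def)
    qed
    finally show "random_matrix \<pi> k \<omega> i j = sandwich N (\<lambda>i j. if i = j then neg_power \<pi> (k i) else 0) \<omega> i j" .
  qed
  show ?thesis
  proof (rule that[of k])
    show "k \<in> Delta" using dec by (simp add: Delta_def)
    fix f :: "'a inf_matrix \<Rightarrow> real" assume f: "f \<in> borel_measurable borel"
    have "orbit_avg N f M = orbit_avg N f (\<lambda>i j. if i = j then neg_power \<pi> (k i) else 0)"
      using orbit_avg_block_equiv[OF eq f] by simp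
    also have "\<dots> = (\<integral>x. f x \<partial>mu \<pi> k)"
      unfolding orbit_avg_def integral_mu[OF dec f] using rm by (intro Bochner_Integration.integral_cong) auto
    finally show "orbit_avg N f M = (\<integral>x. f x \<partial>mu \<pi> k)" .
  qed
qed

lemma measurable_orbit_avg:
  fixes f :: "'a inf_matrix \<Rightarrow> real"
  assumes f: "f \<in> borel_measurable borel"
  shows "orbit_avg N f \<in> borel_measurable borel"
proof -
  interpret H: prob_space "haar_pow :: (var_label \<Rightarrow> 'a) measure" by (rule prob_space_haar_pow)
  show ?thesis
    unfolding orbit_avg_def
    using measurable_compose[OF measurable_sandwich f]
    by (intro H.borel_measurable_lebesgue_integral) (simp add: split_def)
qed

lemma abs_orbit_avg_le:
  fixes f :: "'a inf_matrix \<Rightarrow> real"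
  assumes "\<And>M. \<bar>f M\<bar> \<le> B"
  shows "\<bar>orbit_avg N f M\<bar> \<le> B"
  unfolding orbit_avg_def using assms by (intro abs_integral_le_const prob_space_haar_pow)

lemma orbit_avg_GL_act:
  fixes f :: "'a inf_matrix \<Rightarrow> real"
  assumes "GL_pair N g g'" "GL_pair N h h'" "N \<le> K" "f \<in> borel_measurable borel"
  shows "orbit_avg K f (GL_act g h M) = orbit_avg K f M"
  by (rule orbit_avg_block_equiv[OF block_equiv_GL_act[OF GL_pair_mono[OF assms(1,3)] GL_pair_mono[OF assms(2,3)]] assms(4)])

lemma integral_GL_act:
  fixes f :: "'a inf_matrix \<Rightarrow> real"
  assumes \<mu>: "\<mu> \<in> P_erg" and g: "GL_pair N g g'" and h: "GL_pair N h h'" and f: "f \<in> borel_measurable borel"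
  shows "(\<integral>M. f (GL_act g h M) \<partial>\<mu>) = (\<integral>M. f M \<partial>\<mu>)"
proof -
  have "sets \<mu> = sets borel" using \<mu> by (auto simp: P_erg_def borel_probs_def)
  then have "GL_act g h \<in> \<mu> \<rightarrow>\<^sub>M borel"
    using measurable_GL_act[OF g h] by (simp cong: measurable_cong_sets)
  then have "(\<integral>M. f M \<partial>distr \<mu> borel (GL_act g h)) = (\<integral>M. f (GL_act g h M) \<partial>\<mu>)"
    using f by (rule integral_distr)
  moreover have "distr \<mu> borel (GL_act g h) = \<mu>"
    using \<mu> GL_pair_GL_inf(1)[OF g] GL_pair_GL_inf(1)[OF h] by (auto simp: P_erg_def GL_invariant_def)
  ultimately show ?thesis by simp
qed

text \<open>Fubini lets \<open>\<omega>\<close> be fixed first. If both rectangles can be completed,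
  the sandwich agrees on the corner with the action of a group element of level
  \<open>J * m\<close>, and invariance of \<open>\<mu>\<close> and of \<open>G\<close> removes it.
  Otherwise the two sides differ by at most \<open>2 * (B * C)\<close>; the two bad events have the
  same probability.\<close>

lemma integral_orbit_avg_mult:
  fixes f G :: "'a inf_matrix \<Rightarrow> real"
  assumes \<mu>: "\<mu> \<in> P_erg" and f: "corner_fun m f" "\<And>M. \<bar>f M\<bar> \<le> B"
    and G: "G \<in> borel_measurable borel" "\<And>M. \<bar>G M\<bar> \<le> C"
    and inv: "\<And>g g' h h' M. GL_pair (J * m) g g' \<Longrightarrow> GL_pair (J * m) h h' \<Longrightarrow> G (GL_act g h M) = G M"
  shows "\<bar>(\<integral>M. orbit_avg (J * m) f M * G M \<partial>\<mu>) - (\<integral>M. f M * G M \<partial>\<mu>)\<bar> \<le>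
    4 * (B * C) * (1 - (1 / q) ^ (m * m)) ^ J"
proof -
  interpret H: prob_space "haar_pow :: (var_label \<Rightarrow> 'a) measure" by (rule prob_space_haar_pow)
  interpret \<mu>: prob_space \<mu> using \<mu> by (simp add: P_erg_def borel_probs_def)
  interpret PP: pair_prob_space \<mu> "haar_pow :: (var_label \<Rightarrow> 'a) measure" ..
  have s[measurable_cong]: "sets \<mu> = sets borel" using \<mu> by (simp add: P_erg_def borel_probs_def)
  define N where "N = J * m"
  have fm[measurable]: "f \<in> borel_measurable borel" using f by (simp add: corner_fun_def)
  have fc: "f M = f M'" if "\<And>i j. i < m \<Longrightarrow> j < m \<Longrightarrow> M i j = M' i j" for M M'
    using f(1) that unfolding corner_fun_def by blast
  note [measurable] = G(1)
  have B0: "0 \<le> B" "0 \<le> C" using f(2)[of undefined] G(2)[of undefined] by linarith+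
  have fG: "\<bar>f M * G M'\<bar> \<le> B * C" for M M'
    unfolding abs_mult using f(2) G(2) B0 by (intro mult_mono) auto
  have sm: "(\<lambda>p. sandwich N (fst p) (snd p)) \<in> \<mu> \<Otimes>\<^sub>M haar_pow \<rightarrow>\<^sub>M borel"
    using measurable_sandwich[of N] by (simp add: split_def s cong: measurable_cong_sets sets_pair_measure_cong)
  have jm: "(\<lambda>p. f (sandwich N (fst p) (snd p)) * G (fst p)) \<in> borel_measurable (\<mu> \<Otimes>\<^sub>M haar_pow)"
    using measurable_compose[OF sm fm] by measurable
  have ji: "integrable (\<mu> \<Otimes>\<^sub>M haar_pow) (\<lambda>p. f (sandwich N (fst p) (snd p)) * G (fst p))"
    using fG by (intro PP.integrable_const_bound[of _ "B * C"] jm AE_I2) auto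
  let ?I = "\<lambda>\<omega>. \<integral>M. f (sandwich N M \<omega>) * G M \<partial>\<mu>"
  let ?R = "\<integral>M. f M * G M \<partial>\<mu>"
  have "(\<integral>M. orbit_avg N f M * G M \<partial>\<mu>) = (\<integral>M. (\<integral>\<omega>. f (sandwich N M \<omega>) * G M \<partial>haar_pow) \<partial>\<mu>)"
    by (simp add: orbit_avg_def)
  also have "\<dots> = (\<integral>\<omega>. ?I \<omega> \<partial>haar_pow)"
    using PP.Fubini_integral[of "\<lambda>M \<omega>. f (sandwich N M \<omega>) * G M"] ji by (simp add: split_def)
  finally have eq: "(\<integral>M. orbit_avg N f M * G M \<partial>\<mu>) = (\<integral>\<omega>. ?I \<omega> \<partial>haar_pow)" .
  define bad :: "(nat \<Rightarrow> nat \<Rightarrow> var_label) \<Rightarrow> (var_label \<Rightarrow> 'a) \<Rightarrow> real"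
    where "bad lab \<omega> = of_bool (\<not> has_unit_block lab m J \<omega>)" for lab \<omega>
  \<comment> \<open>Swapping the label arguments makes the corner index the row of the rectangle,
    which is what \<open>has_unit_block\<close> completes.\<close>
  let ?LX = "\<lambda>i a. XVar a i" and ?LY = "\<lambda>j b. YVar b j"
  have good: "?I \<omega> = ?R" if \<omega>: "\<omega> \<in> space haar_pow" and X: "has_unit_block ?LX m J \<omega>" and Y: "has_unit_block ?LY m J \<omega>" for \<omega>
  proof -
    obtain g g' where g: "GL_pair N g g'" "m \<le> N" "\<And>i a. i < m \<Longrightarrow> a < N \<Longrightarrow> g i a = \<omega> (XVar a i)"
      using has_unit_block_rows[OF \<omega> X] unfolding N_def by metis
    obtain y y' where y: "GL_pair N y y'" "\<And>j b. j < m \<Longrightarrow> b < N \<Longrightarrow> y j b = \<omega> (YVar b j)"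
      using has_unit_block_rows[OF \<omega> Y] unfolding N_def by metis
    \<comment> \<open>\<open>GL_act\<close> multiplies on the right by the inverse of its second
      argument. So the transpose of the completed \<open>y\<close> has to be the inverse
      \<open>h'\<close>, and the group element is the transpose of \<open>y'\<close>.\<close>
    define h where "h i j = y' j i" for i j
    define h' where "h' i j = y j i" for i j
    have h: "GL_pair N h h'"
      using GL_pair_transpose[OF GL_pair_sym[OF y(1)]] by (simp add: h_def[abs_def] h'_def[abs_def])
    have "sandwich N M \<omega> i j = GL_act g h M i j" if "i < m" "j < m" for M i j
    proof -
      have "GL_act g h M i j = (\<Sum>a<N. \<Sum>b<N. g i a * M a b * h' b j)"
        using that g(2) by (intro GL_act_eq[OF g(1) h]) auto
      also have "\<dots> = (\<Sum>a<N. \<omega> (XVar a i) * (\<Sum>b<N. M a b * \<omega> (YVar b j)))"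
        using that by (simp add: g(3) h'_def y(2) sum_distrib_left mult.assoc)
      finally show ?thesis by (simp add: sandwich_def)
    qed
    then have "?I \<omega> = (\<integral>M. f (GL_act g h M) * G (GL_act g h M) \<partial>\<mu>)"
      using inv[of g g' h h'] g(1) h
      by (intro Bochner_Integration.integral_cong refl arg_cong2[where f="(*)"] fc) (auto simp: N_def)
    also have "\<dots> = ?R"
      by (rule integral_GL_act[OF \<mu> g(1) h, of "\<lambda>M. f M * G M"]) measurable
    finally show ?thesis .
  qed
  have I_le: "\<bar>?I \<omega>\<bar> \<le> B * C" for \<omega>
    by (rule abs_integral_le_const[OF \<mu>.prob_space_axioms fG])
  have R_le: "\<bar>?R\<bar> \<le> B * C"
    by (rule abs_integral_le_const[OF \<mu>.prob_space_axioms fG])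
  have Im: "?I \<in> borel_measurable haar_pow"
  proof -
    have "(\<lambda>p. f (sandwich N (snd p) (fst p)) * G (snd p)) \<in> borel_measurable (haar_pow \<Otimes>\<^sub>M \<mu>)"
      using measurable_compose[OF measurable_pair_swap' jm] by (simp add: split_def)
    then show ?thesis
      by (intro \<mu>.borel_measurable_lebesgue_integral) (simp add: split_def)
  qed
  have bm: "bad lab \<in> borel_measurable haar_pow" for lab
    unfolding bad_def by measurable
  have ib: "integrable haar_pow (bad lab)" for lab
    using bm by (intro H.integrable_const_bound[of _ 1]) (auto simp: bad_def)
  have iI: "integrable haar_pow ?I"
    using I_le Im by (intro H.integrable_const_bound[of _ "B * C"]) auto
  have "\<bar>(\<integral>\<omega>. ?I \<omega> \<partial>haar_pow) - ?R\<bar> = \<bar>\<integral>\<omega>. ?I \<omega> - ?R \<partial>haar_pow\<bar>"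
    using iI by (simp add: H.prob_space)
  also have "\<dots> \<le> (\<integral>\<omega>. \<bar>?I \<omega> - ?R\<bar> \<partial>haar_pow)" by (rule integral_abs_bound)
  also have "\<dots> \<le> (\<integral>\<omega>. 2 * (B * C) * (bad ?LX \<omega> + bad ?LY \<omega>) \<partial>haar_pow)"
  proof (rule integral_mono)
    show "integrable haar_pow (\<lambda>\<omega>. \<bar>?I \<omega> - ?R\<bar>)" using iI by simp
    show "integrable haar_pow (\<lambda>\<omega>. 2 * (B * C) * (bad ?LX \<omega> + bad ?LY \<omega>))" using ib by simp
    fix \<omega> :: "var_label \<Rightarrow> 'a" assume \<omega>: "\<omega> \<in> space haar_pow"
    have BC: "0 \<le> B * C" using B0 by simp
    show "\<bar>?I \<omega> - ?R\<bar> \<le> 2 * (B * C) * (bad ?LX \<omega> + bad ?LY \<omega>)"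
    proof (cases "has_unit_block ?LX m J \<omega> \<and> has_unit_block ?LY m J \<omega>")
      case True
      then show ?thesis using good[OF \<omega>] by (simp add: bad_def)
    next
      case False
      then have "1 \<le> bad ?LX \<omega> + bad ?LY \<omega>" by (auto simp: bad_def)
      then have "2 * (B * C) * 1 \<le> 2 * (B * C) * (bad ?LX \<omega> + bad ?LY \<omega>)"
        using BC by (intro mult_left_mono) auto
      then show ?thesis using I_le[of \<omega>] R_le by linarith
    qed
  qed
  also have "\<dots> = 2 * (B * C) * ((\<integral>\<omega>. bad ?LX \<omega> \<partial>haar_pow) + (\<integral>\<omega>. bad ?LY \<omega> \<partial>haar_pow))"
    using ib by simp
  also have "\<dots> = 4 * (B * C) * (1 - (1 / q) ^ (m * m)) ^ J"
    using prob_not_unit_block[of ?LX m J] prob_not_unit_block[of ?LY m J]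
    by (simp add: bad_def)
  finally show ?thesis using eq by (simp add: N_def)
qed

end

section \<open>Ergodic measures are limits of orbital measures\<close>

context uniformized_field
begin

text \<open>The sets where \<open>g\<close> lies above or below its mean are invariant, hence null
  or full. Either of them being full would make the mean strictly larger or smaller than
  itself.\<close>

lemma invariant_fun_AE_const:
  fixes g :: "'a inf_matrix \<Rightarrow> real"
  assumes \<mu>: "\<mu> \<in> P_erg" and g: "g \<in> borel_measurable borel" "AE M in \<mu>. \<bar>g M\<bar> \<le> B"
    and inv: "\<And>x y M. x \<in> GL_inf \<Longrightarrow> y \<in> GL_inf \<Longrightarrow> g (GL_act x y M) = g M"
  shows "AE M in \<mu>. g M = (\<integral>M. g M \<partial>\<mu>)"
proof -
  interpret \<mu>: prob_space \<mu> using \<mu> by (simp add: P_erg_def borel_probs_def)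
  have s[measurable_cong]: "sets \<mu> = sets borel" using \<mu> by (simp add: P_erg_def borel_probs_def)
  have sp: "space \<mu> = UNIV" using sets_eq_imp_space_eq[OF s] by simp
  note [measurable] = g(1)
  have int: "integrable \<mu> g" using g(2) by (intro \<mu>.integrable_const_bound[of _ B]) auto
  let ?e = "\<integral>M. g M \<partial>\<mu>"
  have zero_one: "measure \<mu> {M. P (g M)} = 0 \<or> measure \<mu> {M. P (g M)} = 1" if P: "{M. P (g M)} \<in> sets borel" for P
  proof -
    have "GL_act x y ` {M. P (g M)} = {M. P (g M)}" if xy: "x \<in> GL_inf" "y \<in> GL_inf" for x y
    proof
      show "GL_act x y ` {M. P (g M)} \<subseteq> {M. P (g M)}" using inv[OF xy] by auto
      show "{M. P (g M)} \<subseteq> GL_act x y ` {M. P (g M)}"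
      proof
        fix M assume M: "M \<in> {M. P (g M)}"
        obtain N where N: "GL_pair N x (GL_inv x)" "GL_pair N y (GL_inv y)"
          using GL_inf_common_pair[OF xy] by blast
        have "g (GL_act (GL_inv x) (GL_inv y) M) = g M"
          using GL_pair_GL_inf(1)[OF GL_pair_sym[OF N(1)]] GL_pair_GL_inf(1)[OF GL_pair_sym[OF N(2)]] by (rule inv)
        then show "M \<in> GL_act x y ` {M. P (g M)}"
          using M GL_act_inverse[OF N] by (intro image_eqI[of _ _ "GL_act (GL_inv x) (GL_inv y) M"]) auto
      qed
    qed
    then have "GL_invariant_set {M. P (g M)}" by (simp add: GL_invariant_set_def)
    then show ?thesis using \<mu> P unfolding P_erg_def by blast
  qed
  have gt: "measure \<mu> {M. ?e < g M} = 0"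
  proof (rule ccontr)
    assume "measure \<mu> {M. ?e < g M} \<noteq> 0"
    then have "measure \<mu> {M. ?e < g M} = 1" using zero_one[of "\<lambda>x. ?e < x"] by auto
    then have "AE M in \<mu>. ?e < g M"
      using \<mu>.AE_in_set_eq_1[of "{M. ?e < g M}"] by simp
    then have "?e < ?e" by (rule \<mu>.expectation_greater[OF int])
    then show False by simp
  qed
  have lt: "measure \<mu> {M. g M < ?e} = 0"
  proof (rule ccontr)
    assume "measure \<mu> {M. g M < ?e} \<noteq> 0"
    then have "measure \<mu> {M. g M < ?e} = 1" using zero_one[of "\<lambda>x. x < ?e"] by auto
    then have "AE M in \<mu>. g M < ?e"
      using \<mu>.AE_in_set_eq_1[of "{M. g M < ?e}"] by simp
    then have "?e < ?e" by (rule \<mu>.expectation_less[OF int])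
    then show False by simp
  qed
  have "AE M in \<mu>. \<not> ?e < g M" "AE M in \<mu>. \<not> g M < ?e"
    using gt lt \<mu>.prob_eq_0[of "{M. ?e < g M}"] \<mu>.prob_eq_0[of "{M. g M < ?e}"] by simp_all
  then show ?thesis by eventually_elim simp
qed

text \<open>The squared distances decay like \<open>(1 / 4) ^ n\<close>, so the mean distances are
  at most \<open>(1 / 2) ^ n\<close>. Their sum has finite integral, hence the telescoping series
  converges absolutely almost everywhere.\<close>

lemma AE_convergent_of_L2:
  fixes b :: "nat \<Rightarrow> 'b \<Rightarrow> real"
  assumes "prob_space M" and m[measurable]: "\<And>n. b n \<in> borel_measurable M" and bd: "\<And>n x. \<bar>b n x\<bar> \<le> B"
    and L2: "\<And>n. (\<integral>x. (b n x - b (Suc n) x)\<^sup>2 \<partial>M) \<le> (1 / 4) ^ n"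
  shows "AE x in M. convergent (\<lambda>n. b n x)"
proof -
  interpret prob_space M by fact
  have i2: "integrable M (\<lambda>x. (b n x - b (Suc n) x)\<^sup>2)" for n
  proof (rule integrable_const_bound[of _ "(2 * B)\<^sup>2"])
    have "\<bar>b n x - b (Suc n) x\<bar> \<le> 2 * B" for x using bd[of n x] bd[of "Suc n" x] by linarith
    then have "(b n x - b (Suc n) x)\<^sup>2 \<le> (2 * B)\<^sup>2" for x by (rule abs_le_square_iff[THEN iffD1, OF order.trans]) simp
    then show "AE x in M. norm ((b n x - b (Suc n) x)\<^sup>2) \<le> (2 * B)\<^sup>2" by simp
  qed simp
  have L1: "(\<integral>\<^sup>+x. ennreal \<bar>b n x - b (Suc n) x\<bar> \<partial>M) \<le> ennreal ((1 / 2) ^ n)" for n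
  proof -
    \<comment> \<open>The inequality of arithmetic and geometric means with weight
      \<open>2 ^ n\<close> passes pointwise from squares to absolute values, in place of the
      Cauchy-Schwarz inequality.\<close>
    have le: "\<bar>z\<bar> \<le> (z\<^sup>2 * 2 ^ n + (1 / 2) ^ n) / 2" for z :: real
    proof -
      have "0 \<le> (\<bar>z\<bar> * 2 ^ n - 1)\<^sup>2 * (1 / 2) ^ n" by simp
      also have "(\<bar>z\<bar> * 2 ^ n - 1)\<^sup>2 * (1 / 2) ^ n = z\<^sup>2 * 2 ^ n + (1 / 2) ^ n - 2 * \<bar>z\<bar>"
        by (simp add: power2_eq_square algebra_simps power_divide)
      finally show ?thesis by simp
    qed
    have "(\<integral>\<^sup>+x. ennreal \<bar>b n x - b (Suc n) x\<bar> \<partial>M) \<le>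
        (\<integral>\<^sup>+x. ennreal (((b n x - b (Suc n) x)\<^sup>2 * 2 ^ n + (1 / 2) ^ n) / 2) \<partial>M)"
      using le by (intro nn_integral_mono ennreal_leI)
    also have "\<dots> = ennreal (\<integral>x. ((b n x - b (Suc n) x)\<^sup>2 * 2 ^ n + (1 / 2) ^ n) / 2 \<partial>M)"
      using i2[of n] by (intro nn_integral_eq_integral) auto
    also have "(\<integral>x. ((b n x - b (Suc n) x)\<^sup>2 * 2 ^ n + (1 / 2) ^ n) / 2 \<partial>M) =
        ((\<integral>x. (b n x - b (Suc n) x)\<^sup>2 \<partial>M) * 2 ^ n + (1 / 2) ^ n) / 2"
      using i2[of n] by (simp add: prob_space)
    also have "\<dots> \<le> ((1 / 4) ^ n * 2 ^ n + (1 / 2) ^ n) / 2"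
      using L2[of n] by (intro divide_right_mono add_right_mono mult_right_mono) auto
    also have "(1 / 4) ^ n * 2 ^ n = (1 / 2 :: real) ^ n"
      by (simp flip: power_mult_distrib)
    finally show ?thesis by (simp add: ennreal_leI)
  qed
  have "(\<integral>\<^sup>+x. (\<Sum>n. ennreal \<bar>b n x - b (Suc n) x\<bar>) \<partial>M) = (\<Sum>n. \<integral>\<^sup>+x. ennreal \<bar>b n x - b (Suc n) x\<bar> \<partial>M)"
    by (rule nn_integral_suminf) measurable
  also have "\<dots> \<le> (\<Sum>n. ennreal ((1 / 2) ^ n))"
    by (intro suminf_le L1) auto
  also have "\<dots> = ennreal (\<Sum>n. (1 / 2) ^ n)"
    by (rule suminf_ennreal2) auto
  also have "\<dots> < \<infinity>" by simp
  finally have "(\<integral>\<^sup>+x. (\<Sum>n. ennreal \<bar>b n x - b (Suc n) x\<bar>) \<partial>M) \<noteq> \<infinity>" by simp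
  then have "AE x in M. (\<Sum>n. ennreal \<bar>b n x - b (Suc n) x\<bar>) \<noteq> \<infinity>"
    by (intro nn_integral_noteq_infinite) measurable
  then show ?thesis
  proof eventually_elim
    fix x assume "(\<Sum>n. ennreal \<bar>b n x - b (Suc n) x\<bar>) \<noteq> \<infinity>"
    then have "summable (\<lambda>n. \<bar>b n x - b (Suc n) x\<bar>)"
      by (intro summable_suminf_not_top) auto
    then have "summable (\<lambda>n. \<bar>b (Suc n) x - b n x\<bar>)"
      by (simp only: abs_minus_commute[of "b (Suc _) x"])
    then have "summable (\<lambda>n. b (Suc n) x - b n x)" by (rule summable_rabs_cancel)
    then have "(\<lambda>N. \<Sum>n<N. b (Suc n) x - b n x) \<longlonglongrightarrow> (\<Sum>n. b (Suc n) x - b n x)"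
      by (rule summable_LIMSEQ)
    then have "(\<lambda>N. b N x - b 0 x) \<longlonglongrightarrow> (\<Sum>n. b (Suc n) x - b n x)"
      by (simp add: sum_lessThan_telescope[of "\<lambda>n. b n x"])
    then have "(\<lambda>N. b N x - b 0 x + b 0 x) \<longlonglongrightarrow> (\<Sum>n. b (Suc n) x - b n x) + b 0 x"
      by (intro tendsto_intros)
    then show "convergent (\<lambda>n. b n x)" by (auto simp: convergent_def)
  qed
qed

text \<open>Acting inside an integral shows that \<open>orbit_avg\<close> behaves like a decreasing family of orthogonal
  projections, up to errors that tend to \<open>0\<close>. A subsequence is therefore Cauchy in \<open>L\<^sup>2\<close>, and its
  almost sure limit is invariant, hence constant. For the full sequence only an upper bound of
  \<open>S J\<close> is needed, which the approximate monotonicity of \<open>S\<close> provides.\<close>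

lemma orbit_avg_L2:
  fixes f :: "'a inf_matrix \<Rightarrow> real"
  assumes \<mu>: "\<mu> \<in> P_erg" and f: "corner_fun m f" "\<And>M. \<bar>f M\<bar> \<le> B" and m: "1 \<le> m" and e: "0 < e"
  shows "\<exists>J0. \<forall>J\<ge>J0. (\<integral>M. (orbit_avg (J * m) f M - (\<integral>M. f M \<partial>\<mu>))\<^sup>2 \<partial>\<mu>) < e"
proof -
  interpret \<mu>: prob_space \<mu> using \<mu> by (simp add: P_erg_def borel_probs_def)
  have s[measurable_cong]: "sets \<mu> = sets borel" using \<mu> by (simp add: P_erg_def borel_probs_def)
  have fm[measurable]: "f \<in> borel_measurable borel" using f by (simp add: corner_fun_def)
  define c where "c = (\<integral>M. f M \<partial>\<mu>)"
  define a where "a J = orbit_avg (J * m) f" for J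
  have am[measurable]: "a J \<in> borel_measurable borel" for J
    unfolding a_def by (rule measurable_orbit_avg[OF fm])
  have B0: "0 \<le> B" using f(2)[of undefined] by linarith
  have aB: "\<bar>a J M\<bar> \<le> B" for J M unfolding a_def by (rule abs_orbit_avg_le[OF f(2)])
  have cB: "\<bar>c\<bar> \<le> B" unfolding c_def by (rule abs_integral_le_const[OF \<mu>.prob_space_axioms f(2)])
  define \<theta> where "\<theta> = 1 - (1 / q) ^ (m * m)"
  have \<theta>: "0 \<le> \<theta>" "\<theta> \<le> 1" using q_gt_1 by (auto simp: \<theta>_def intro: power_le_one)
  have \<theta>0: "(\<lambda>J. \<theta> ^ J) \<longlonglongrightarrow> 0" unfolding \<theta>_def by (rule prob_not_unit_block_tendsto)
  have \<theta>_mono: "\<theta> ^ J' \<le> \<theta> ^ J" if "J \<le> J'" for J J' using \<theta> that by (intro power_decreasing) auto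
  have int: "integrable \<mu> h" if "h \<in> borel_measurable borel" "\<And>M. \<bar>h M\<bar> \<le> K" for h :: "'a inf_matrix \<Rightarrow> real" and K
    using that by (intro \<mu>.integrable_const_bound[of _ K]) auto
  have pB: "\<bar>x * y\<bar> \<le> B * B" if "\<bar>x\<bar> \<le> B" "\<bar>y\<bar> \<le> B" for x y
    unfolding abs_mult using that by (intro mult_mono) auto
  have iaa: "integrable \<mu> (\<lambda>M. a J M * a J' M)" for J J'
    by (rule int[of _ "B * B"]) (auto intro!: pB aB)
  have ifa: "integrable \<mu> (\<lambda>M. f M * a J M)" for J
    by (rule int[of _ "B * B"]) (auto intro!: pB aB f)
  have ia: "integrable \<mu> (a J)" for J by (rule int[of _ B]) (auto intro!: aB)
  define S where "S J = (\<integral>M. f M * a J M \<partial>\<mu>)" for J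
  have F1: "\<bar>(\<integral>M. a J M \<partial>\<mu>) - c\<bar> \<le> 4 * B * \<theta> ^ J" for J
    using integral_orbit_avg_mult[OF \<mu> f, of "\<lambda>_. 1" 1 J] by (simp add: a_def c_def \<theta>_def)
  \<comment> \<open>The average at the higher level \<open>J'\<close> is invariant under the group
    of level \<open>J\<close>, so it may serve as the test function \<open>G\<close>.\<close>
  have F2: "\<bar>(\<integral>M. a J M * a J' M \<partial>\<mu>) - S J'\<bar> \<le> 4 * (B * B) * \<theta> ^ J" if "J \<le> J'" for J J'
    unfolding S_def a_def \<theta>_def
  proof (rule integral_orbit_avg_mult[OF \<mu> f])
    show "orbit_avg (J' * m) f (GL_act g h M) = orbit_avg (J' * m) f M"
      if "GL_pair (J * m) g g'" "GL_pair (J * m) h h'" for g g' h h' M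
      using that \<open>J \<le> J'\<close> by (intro orbit_avg_GL_act[OF _ _ _ fm]) auto
  qed (use am aB in \<open>auto simp: a_def\<close>)
  have SB: "\<bar>S J\<bar> \<le> B * B" for J
    unfolding S_def by (rule abs_integral_le_const[OF \<mu>.prob_space_axioms]) (intro pB f aB)
  \<comment> \<open>Expanding the square, the inner products are close to \<open>S J\<close>,
    \<open>S J'\<close> and \<open>S J'\<close>. They enter with weights \<open>1\<close>,
    \<open>2\<close> and \<open>1\<close>, so the errors \<open>4 * (B * B)\<close> add up to
    \<open>16 * (B * B)\<close>. Since the left side is nonnegative, this is also the approximate
    monotonicity of \<open>S\<close>.\<close>
  have sq: "(\<integral>M. (a J M - a J' M)\<^sup>2 \<partial>\<mu>) \<le> S J - S J' + 16 * (B * B) * \<theta> ^ J" if J: "J \<le> J'" for J J'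
  proof -
    have "(\<integral>M. (a J M - a J' M)\<^sup>2 \<partial>\<mu>) = (\<integral>M. a J M * a J M - 2 * (a J M * a J' M) + a J' M * a J' M \<partial>\<mu>)"
      by (simp add: power2_eq_square algebra_simps)
    also have "\<dots> = (\<integral>M. a J M * a J M \<partial>\<mu>) - 2 * (\<integral>M. a J M * a J' M \<partial>\<mu>) + (\<integral>M. a J' M * a J' M \<partial>\<mu>)"
      using iaa by simp
    also have "\<dots> \<le> S J - S J' + 16 * (B * B) * \<theta> ^ J"
    proof -
      have "4 * (B * B) * \<theta> ^ J' \<le> 4 * (B * B) * \<theta> ^ J"
        using \<theta>_mono[OF J] B0 by (intro mult_left_mono) auto
      then show ?thesis using F2[of J J] F2[OF J] F2[of J' J'] by (simp add: abs_le_iff)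
    qed
    finally show ?thesis .
  qed
  obtain l r where r: "strict_mono r" "(S \<circ> r) \<longlonglongrightarrow> l"
    using bounded_imp_convergent_subsequence[of S] SB by (auto simp: bounded_iff)
  have "\<exists>n0. \<forall>n\<ge>n0. \<forall>n'\<ge>n. (\<integral>M. (a (r n) M - a (r n') M)\<^sup>2 \<partial>\<mu>) \<le> \<epsilon>" if \<epsilon>: "0 < \<epsilon>" for \<epsilon>
  proof -
    have "Cauchy (S \<circ> r)" using r(2) by (rule LIMSEQ_imp_Cauchy)
    then obtain n1 where n1: "\<And>n n'. n \<ge> n1 \<Longrightarrow> n' \<ge> n1 \<Longrightarrow> \<bar>S (r n) - S (r n')\<bar> < \<epsilon> / 2"
      using \<epsilon> unfolding Cauchy_def dist_real_def comp_def by (meson half_gt_zero)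
    have "(\<lambda>J. 16 * (B * B) * \<theta> ^ J) \<longlonglongrightarrow> 16 * (B * B) * 0" by (intro tendsto_mult_left \<theta>0)
    then have "\<forall>\<^sub>F J in sequentially. 16 * (B * B) * \<theta> ^ J < \<epsilon> / 2"
      using \<epsilon> by (intro order_tendstoD) auto
    then obtain n2 where n2: "\<And>J. J \<ge> n2 \<Longrightarrow> 16 * (B * B) * \<theta> ^ J < \<epsilon> / 2"
      by (auto simp: eventually_sequentially)
    have "(\<integral>M. (a (r n) M - a (r n') M)\<^sup>2 \<partial>\<mu>) \<le> \<epsilon>" if n: "n \<ge> max n1 n2" "n' \<ge> n" for n n'
    proof -
      have "r n \<le> r n'" using r(1) n by (simp add: strict_mono_less_eq)
      moreover have "n2 \<le> r n" using seq_suble[OF r(1), of n] n by simp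
      moreover have "\<bar>S (r n) - S (r n')\<bar> < \<epsilon> / 2" using n by (intro n1) auto
      ultimately show ?thesis
        using sq[of "r n" "r n'"] n2[of "r n"] abs_ge_self[of "S (r n) - S (r n')"] by linarith
    qed
    then show ?thesis by blast
  qed
  then have "\<forall>j. \<exists>n0. \<forall>n\<ge>n0. \<forall>n'\<ge>n. (\<integral>M. (a (r n) M - a (r n') M)\<^sup>2 \<partial>\<mu>) \<le> (1 / 4) ^ j" by simp
  then obtain n0 where n0: "\<And>j n n'. n \<ge> n0 j \<Longrightarrow> n' \<ge> n \<Longrightarrow> (\<integral>M. (a (r n) M - a (r n') M)\<^sup>2 \<partial>\<mu>) \<le> (1 / 4) ^ j"
    by metis
  \<comment> \<open>The partial sums of \<open>Suc (n0 i)\<close> form a strictly increasing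
    sequence that dominates \<open>n0\<close>, so consecutive members satisfy the bound
    \<open>(1 / 4) ^ j\<close>.\<close>
  define t where "t j = (\<Sum>i\<le>j. Suc (n0 i))" for j
  have t_mono: "strict_mono t" by (rule strict_mono_Suc_iff[THEN iffD2]) (simp add: t_def)
  have t_ge: "n0 j \<le> t j" for j
    unfolding t_def using member_le_sum[of j "{..j}" "\<lambda>i. Suc (n0 i)"] by simp
  define b where "b j = a (r (t j))" for j
  have u_mono: "strict_mono (\<lambda>j. r (t j))"
    using strict_mono_o[OF r(1) t_mono] by (simp add: comp_def)
  have bm[measurable]: "b j \<in> borel_measurable borel" for j unfolding b_def by (rule am)
  have bB: "\<bar>b j M\<bar> \<le> B" for j M unfolding b_def by (rule aB)
  have conv: "AE M in \<mu>. convergent (\<lambda>j. b j M)"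
  proof (rule AE_convergent_of_L2[OF \<mu>.prob_space_axioms _ bB])
    show "b n \<in> borel_measurable \<mu>" for n by measurable
    show "(\<integral>x. (b n x - b (Suc n) x)\<^sup>2 \<partial>\<mu>) \<le> (1 / 4) ^ n" for n
      unfolding b_def using n0[OF t_ge[of n], of "t (Suc n)"] t_mono by (simp add: strict_mono_less_eq)
  qed
  define g where "g M = lim (\<lambda>j. b j M)" for M
  have gm[measurable]: "g \<in> borel_measurable borel" unfolding g_def by measurable
  have lim: "AE M in \<mu>. (\<lambda>j. b j M) \<longlonglongrightarrow> g M"
    using conv by eventually_elim (simp add: g_def convergent_LIMSEQ_iff)
  have gB: "AE M in \<mu>. \<bar>g M\<bar> \<le> B"
    using lim
  proof eventually_elim
    fix M assume "(\<lambda>j. b j M) \<longlonglongrightarrow> g M"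
    then have "(\<lambda>j. \<bar>b j M\<bar>) \<longlonglongrightarrow> \<bar>g M\<bar>" by (rule tendsto_rabs)
    then show "\<bar>g M\<bar> \<le> B" by (rule LIMSEQ_le_const2) (use bB in auto)
  qed
  have g_inv: "g (GL_act x y M) = g M" if xy: "x \<in> GL_inf" "y \<in> GL_inf" for x y M
  proof -
    obtain N where N: "GL_pair N x (GL_inv x)" "GL_pair N y (GL_inv y)"
      using GL_inf_common_pair[OF xy] by blast
    have "b j (GL_act x y M) = b j M" if "N \<le> j" for j
    proof -
      have "N \<le> r (t j)" using seq_suble[OF u_mono, of j] that by simp
      also have "\<dots> \<le> r (t j) * m" using m by simp
      finally show ?thesis unfolding b_def a_def by (rule orbit_avg_GL_act[OF N _ fm])
    qed
    then have "\<forall>\<^sub>F j in sequentially. b j (GL_act x y M) = b j M"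
      by (rule eventually_sequentiallyI)
    \<comment> \<open>Both sequences agree from index \<open>N\<close> on and have the same limits.
      Hence \<open>lim\<close> returns the same value even where they diverge, and \<open>g\<close>
      is invariant at every point rather than almost everywhere.\<close>
    then have "(\<lambda>j. b j (GL_act x y M)) \<longlonglongrightarrow> L \<longleftrightarrow> (\<lambda>j. b j M) \<longlonglongrightarrow> L" for L
      by (rule tendsto_cong)
    then show ?thesis by (simp add: g_def lim_def)
  qed
  define d where "d = (\<integral>M. g M \<partial>\<mu>)"
  have gd: "AE M in \<mu>. g M = d"
    unfolding d_def
  proof (rule invariant_fun_AE_const[OF \<mu> gm gB])
    show "g (GL_act x y M) = g M" if "x \<in> GL_inf" "y \<in> GL_inf" for x y M
      using that by (rule g_inv)
  qed
  have bd: "AE M in \<mu>. (\<lambda>j. b j M) \<longlonglongrightarrow> d"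
    using lim gd by eventually_elim simp
  have "(\<lambda>j. \<integral>M. b j M \<partial>\<mu>) \<longlonglongrightarrow> (\<integral>M. d \<partial>\<mu>)"
    using bd bB by (intro integral_dominated_convergence[where w="\<lambda>_. B"]) auto
  then have 1: "(\<lambda>j. \<integral>M. b j M \<partial>\<mu>) \<longlonglongrightarrow> d" by (simp add: \<mu>.prob_space)
  have "(\<lambda>j. \<integral>M. b j M * b j M \<partial>\<mu>) \<longlonglongrightarrow> (\<integral>M. d * d \<partial>\<mu>)"
  proof (rule integral_dominated_convergence[where w="\<lambda>_. B * B"])
    show "AE M in \<mu>. (\<lambda>j. b j M * b j M) \<longlonglongrightarrow> d * d"
      using bd by eventually_elim (intro tendsto_intros)
    show "AE M in \<mu>. norm (b j M * b j M) \<le> B * B" for j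
      using pB[OF bB bB, of j _ j] by (intro AE_I2) (simp only: real_norm_def)
  qed auto
  then have 2: "(\<lambda>j. \<integral>M. b j M * b j M \<partial>\<mu>) \<longlonglongrightarrow> d * d" by (simp add: \<mu>.prob_space)
  have \<theta>u: "(\<lambda>j. \<theta> ^ r (t j)) \<longlonglongrightarrow> 0"
    using LIMSEQ_subseq_LIMSEQ[OF \<theta>0 u_mono] by (simp add: comp_def)
  have "(\<lambda>j. (\<integral>M. b j M \<partial>\<mu>) - c) \<longlonglongrightarrow> 0"
  proof (rule Lim_null_comparison)
    show "\<forall>\<^sub>F j in sequentially. norm ((\<integral>M. b j M \<partial>\<mu>) - c) \<le> 4 * B * \<theta> ^ r (t j)"
      using F1 by (simp add: b_def)
    show "(\<lambda>j. 4 * B * \<theta> ^ r (t j)) \<longlonglongrightarrow> 0" using tendsto_mult_left[OF \<theta>u, of "4 * B"] by simp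
  qed
  moreover have "(\<lambda>j. (\<integral>M. b j M \<partial>\<mu>) - c) \<longlonglongrightarrow> d - c" using 1 by (intro tendsto_intros)
  ultimately have dc: "d = c" using LIMSEQ_unique by fastforce
  have "(\<lambda>j. (\<integral>M. b j M * b j M \<partial>\<mu>) - S (r (t j))) \<longlonglongrightarrow> 0"
  proof (rule Lim_null_comparison)
    show "\<forall>\<^sub>F j in sequentially. norm ((\<integral>M. b j M * b j M \<partial>\<mu>) - S (r (t j))) \<le> 4 * (B * B) * \<theta> ^ r (t j)"
      using F2[OF order.refl] by (simp add: b_def)
    show "(\<lambda>j. 4 * (B * B) * \<theta> ^ r (t j)) \<longlonglongrightarrow> 0" using tendsto_mult_left[OF \<theta>u, of "4 * (B * B)"] by simp
  qed
  from tendsto_diff[OF 2 this] have Sc: "(\<lambda>j. S (r (t j))) \<longlonglongrightarrow> c * c" by (simp add: dc)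
  \<comment> \<open>The constant collects the three errors estimated below: \<open>4\<close> from
    the square, \<open>16\<close> from the monotonicity of \<open>S\<close> and \<open>8\<close>
    from the mixed term.\<close>
  have "(\<lambda>j. 28 * (B * B) * \<theta> ^ r (t j)) \<longlonglongrightarrow> 28 * (B * B) * 0" by (intro tendsto_mult_left \<theta>u)
  then have "\<forall>\<^sub>F j in sequentially. 28 * (B * B) * \<theta> ^ r (t j) < e / 2"
    using e by (intro order_tendstoD) auto
  moreover have "\<forall>\<^sub>F j in sequentially. S (r (t j)) < c * c + e / 2"
    using e by (intro order_tendstoD(2)[OF Sc]) simp
  ultimately have "\<forall>\<^sub>F j in sequentially. 28 * (B * B) * \<theta> ^ r (t j) < e / 2 \<and> S (r (t j)) < c * c + e / 2"
    by eventually_elim simp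
  then obtain j where j: "28 * (B * B) * \<theta> ^ r (t j) < e / 2" "S (r (t j)) < c * c + e / 2"
    by (auto simp: eventually_sequentially)
  define J0 where "J0 = r (t j)"
  have "(\<integral>M. (a J M - c)\<^sup>2 \<partial>\<mu>) < e" if J: "J \<ge> J0" for J
  proof -
    have "(\<integral>M. (a J M - c)\<^sup>2 \<partial>\<mu>) = (\<integral>M. a J M * a J M - 2 * c * a J M + c * c \<partial>\<mu>)"
      by (simp add: power2_eq_square algebra_simps)
    also have "\<dots> = (\<integral>M. a J M * a J M \<partial>\<mu>) - 2 * c * (\<integral>M. a J M \<partial>\<mu>) + c * c"
      using iaa ia by (simp add: \<mu>.prob_space)
    finally have eq: "(\<integral>M. (a J M - c)\<^sup>2 \<partial>\<mu>) = (\<integral>M. a J M * a J M \<partial>\<mu>) - 2 * c * (\<integral>M. a J M \<partial>\<mu>) + c * c" .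
    define p where "p = B * B * \<theta> ^ J0"
    have D: "B * B * \<theta> ^ J \<le> p"
      unfolding p_def using \<theta>_mono[OF J] B0 by (intro mult_left_mono) auto
    have 1: "(\<integral>M. a J M * a J M \<partial>\<mu>) \<le> S J + 4 * p"
      using F2[of J J] D by (simp add: abs_le_iff)
    have "0 \<le> (\<integral>M. (a J0 M - a J M)\<^sup>2 \<partial>\<mu>)" by simp
    then have 2: "S J \<le> S J0 + 16 * p" using sq[OF J] unfolding p_def by linarith
    have "\<bar>2 * c * ((\<integral>M. a J M \<partial>\<mu>) - c)\<bar> \<le> 2 * B * (4 * B * \<theta> ^ J)"
      unfolding abs_mult using cB F1[of J] B0 by (intro mult_mono) auto
    then have 3: "- (2 * c * (\<integral>M. a J M \<partial>\<mu>)) \<le> - 2 * (c * c) + 8 * p"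
      using D by (simp add: abs_le_iff algebra_simps)
    show ?thesis using 1 2 3 eq j by (simp add: J0_def[symmetric] p_def)
  qed
  then show ?thesis by (auto simp: a_def c_def)
qed


lemma corner_fun_mono: "corner_fun m f \<Longrightarrow> m \<le> n \<Longrightarrow> corner_fun n f"
proof -
  assume f: "corner_fun m f" and "m \<le> n"
  have "f M = f M'" if "\<forall>i<n. \<forall>j<n. M i j = M' i j" for M M'
  proof -
    have "\<forall>i<m. \<forall>j<m. M i j = M' i j" using that \<open>m \<le> n\<close> by simp
    then show ?thesis using f unfolding corner_fun_def by blast
  qed
  then show ?thesis using f unfolding corner_fun_def by blast
qed

text \<open>The mean of the sum of squared deviations is below \<open>e\<^sup>2\<close>, so at least
  one matrix \<open>M\<close> has all its averages close at once. Those averages are the integrals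
  against a single \<open>mu \<pi> k\<close>.\<close>

lemma ex_mu_close:
  fixes \<F> :: "('a inf_matrix \<Rightarrow> real) set"
  assumes \<mu>: "\<mu> \<in> P_erg" and fin: "finite \<F>"
    and \<F>: "\<And>f. f \<in> \<F> \<Longrightarrow> \<exists>m. corner_fun m f" "\<And>f. f \<in> \<F> \<Longrightarrow> bounded (range f)" and e: "0 < e"
  shows "\<exists>k\<in>Delta. \<forall>f\<in>\<F>. \<bar>(\<integral>M. f M \<partial>mu \<pi> k) - (\<integral>M. f M \<partial>\<mu>)\<bar> < e"
proof -
  interpret \<mu>: prob_space \<mu> using \<mu> by (simp add: P_erg_def borel_probs_def)
  have s[measurable_cong]: "sets \<mu> = sets borel" using \<mu> by (simp add: P_erg_def borel_probs_def)
  obtain mf where mf: "\<And>f. f \<in> \<F> \<Longrightarrow> corner_fun (mf f) f" using \<F>(1) by metis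
  have "\<exists>B. \<forall>M. \<bar>f M\<bar> \<le> B" if "f \<in> \<F>" for f using \<F>(2)[OF that] by (auto simp: bounded_iff)
  then obtain Bf where Bf: "\<And>f M. f \<in> \<F> \<Longrightarrow> \<bar>f M\<bar> \<le> Bf f" by metis
  define m where "m = Suc (\<Sum>f\<in>\<F>. mf f)"
  have mc: "corner_fun m f" if "f \<in> \<F>" for f
  proof (rule corner_fun_mono[OF mf[OF that]])
    show "mf f \<le> m" unfolding m_def using member_le_sum[OF that _ fin, of mf] by simp
  qed
  define c where "c f = (\<integral>M. f M \<partial>\<mu>)" for f :: "'a inf_matrix \<Rightarrow> real"
  \<comment> \<open>Dividing by \<open>Suc (card \<F>)\<close> keeps the sum over
    \<open>\<F>\<close> strictly below \<open>e\<^sup>2\<close>, also when \<open>\<F>\<close> is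
    empty.\<close>
  define \<epsilon> where "\<epsilon> = e\<^sup>2 / Suc (card \<F>)"
  have \<epsilon>: "0 < \<epsilon>" using e by (simp add: \<epsilon>_def)
  have "\<exists>J0. \<forall>J\<ge>J0. (\<integral>M. (orbit_avg (J * m) f M - c f)\<^sup>2 \<partial>\<mu>) < \<epsilon>" if "f \<in> \<F>" for f
    unfolding c_def by (rule orbit_avg_L2[OF \<mu> mc[OF that] Bf[OF that] _ \<epsilon>]) (simp add: m_def)
  then obtain J0 where J0: "\<And>f J. f \<in> \<F> \<Longrightarrow> J \<ge> J0 f \<Longrightarrow> (\<integral>M. (orbit_avg (J * m) f M - c f)\<^sup>2 \<partial>\<mu>) < \<epsilon>"
    by metis
  define J where "J = (\<Sum>f\<in>\<F>. J0 f)"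
  have small: "(\<integral>M. (orbit_avg (J * m) f M - c f)\<^sup>2 \<partial>\<mu>) < \<epsilon>" if "f \<in> \<F>" for f
    unfolding J_def using J0[OF that] member_le_sum[OF that _ fin, of J0] by simp
  have int: "integrable \<mu> (\<lambda>M. (orbit_avg (J * m) f M - c f)\<^sup>2)" if f: "f \<in> \<F>" for f
  proof (rule \<mu>.integrable_const_bound[of _ "(2 * Bf f)\<^sup>2"])
    have fm: "f \<in> borel_measurable borel" using mc[OF f] by (simp add: corner_fun_def)
    note [measurable] = measurable_orbit_avg[OF fm]
    have cB: "\<bar>c f\<bar> \<le> Bf f" unfolding c_def by (rule abs_integral_le_const[OF \<mu>.prob_space_axioms Bf[OF f]])
    have "\<bar>orbit_avg (J * m) f M - c f\<bar> \<le> \<bar>2 * Bf f\<bar>" for M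
    proof -
      have "\<bar>orbit_avg (J * m) f M\<bar> \<le> Bf f" by (rule abs_orbit_avg_le) (rule Bf[OF f])
      then show ?thesis using cB by linarith
    qed
    then show "AE M in \<mu>. norm ((orbit_avg (J * m) f M - c f)\<^sup>2) \<le> (2 * Bf f)\<^sup>2"
      by (simp add: abs_le_square_iff)
    show "(\<lambda>M. (orbit_avg (J * m) f M - c f)\<^sup>2) \<in> borel_measurable \<mu>" by measurable
  qed
  have "\<exists>M. (\<Sum>f\<in>\<F>. (orbit_avg (J * m) f M - c f)\<^sup>2) < e\<^sup>2"
  proof (rule ccontr)
    assume "\<not> ?thesis"
    then have "e\<^sup>2 \<le> (\<Sum>f\<in>\<F>. (orbit_avg (J * m) f M - c f)\<^sup>2)" for M by (simp add: not_less)
    then have "(\<integral>M. e\<^sup>2 \<partial>\<mu>) \<le> (\<integral>M. (\<Sum>f\<in>\<F>. (orbit_avg (J * m) f M - c f)\<^sup>2) \<partial>\<mu>)"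
      using int by (intro integral_mono) auto
    also have "\<dots> = (\<Sum>f\<in>\<F>. \<integral>M. (orbit_avg (J * m) f M - c f)\<^sup>2 \<partial>\<mu>)"
      using int by (intro Bochner_Integration.integral_sum)
    also have "\<dots> \<le> (\<Sum>f\<in>\<F>. \<epsilon>)" using small by (intro sum_mono less_imp_le)
    also have "\<dots> < e\<^sup>2" using e by (simp add: \<epsilon>_def field_simps)
    finally show False by (simp add: \<mu>.prob_space)
  qed
  then obtain M where M: "(\<Sum>f\<in>\<F>. (orbit_avg (J * m) f M - c f)\<^sup>2) < e\<^sup>2" by blast
  obtain k where k: "k \<in> Delta"
    "\<And>f :: 'a inf_matrix \<Rightarrow> real. f \<in> borel_measurable borel \<Longrightarrow> orbit_avg (J * m) f M = (\<integral>x. f x \<partial>mu \<pi> k)"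
    using orbit_avg_eq_mu[of "J * m" M] by blast
  have "\<bar>(\<integral>M. f M \<partial>mu \<pi> k) - (\<integral>M. f M \<partial>\<mu>)\<bar> < e" if f: "f \<in> \<F>" for f
  proof -
    have "(orbit_avg (J * m) f M - c f)\<^sup>2 \<le> (\<Sum>f\<in>\<F>. (orbit_avg (J * m) f M - c f)\<^sup>2)"
      using fin f by (intro member_le_sum) auto
    then have "(orbit_avg (J * m) f M - c f)\<^sup>2 < e\<^sup>2" using M by simp
    then have "\<bar>orbit_avg (J * m) f M - c f\<bar>\<^sup>2 < e\<^sup>2" by simp
    then have "\<bar>orbit_avg (J * m) f M - c f\<bar> < e"
      by (rule power2_less_imp_less) (use e in simp)
    then show ?thesis using k(2)[of f] mc[OF f] by (simp add: c_def corner_fun_def)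
  qed
  then show ?thesis using k(1) by blast
qed

section \<open>Separating measures and passing to the limit\<close>

definition clopen_corner :: "'a inf_matrix set \<Rightarrow> bool" where
  "clopen_corner A \<longleftrightarrow> open A \<and> closed A \<and>
     (\<exists>m. \<forall>M M'. (\<forall>i<m. \<forall>j<m. M i j = M' i j) \<longrightarrow> (M \<in> A \<longleftrightarrow> M' \<in> A))"

lemma clopen_corner_Int: "clopen_corner A \<Longrightarrow> clopen_corner B \<Longrightarrow> clopen_corner (A \<inter> B)"
proof -
  assume A: "clopen_corner A" and B: "clopen_corner B"
  obtain m where m: "\<And>M M'. (\<forall>i<m. \<forall>j<m. M i j = M' i j) \<Longrightarrow> (M \<in> A \<longleftrightarrow> M' \<in> A)"
    using A unfolding clopen_corner_def by blast
  obtain n where n: "\<And>M M'. (\<forall>i<n. \<forall>j<n. M i j = M' i j) \<Longrightarrow> (M \<in> B \<longleftrightarrow> M' \<in> B)"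
    using B unfolding clopen_corner_def by blast
  have "M \<in> A \<inter> B \<longleftrightarrow> M' \<in> A \<inter> B" if "\<forall>i<max m n. \<forall>j<max m n. M i j = M' i j" for M M'
    using m[of M M'] n[of M M'] that by simp
  then show ?thesis
    using A B unfolding clopen_corner_def by blast
qed

text \<open>Balls are clopen, and an open set of entries is a countable union of balls by the
  Lindelof property. Indicators of clopen corner sets are continuous, so this generator lets
  integrals of continuous corner functions determine the measure.\<close>

lemma sets_borel_clopen_corner:
  "sets (borel :: 'a inf_matrix measure) = sigma_sets UNIV (Collect clopen_corner)"
proof
  have "Collect clopen_corner \<subseteq> sets borel" by (auto simp: clopen_corner_def)
  then show "sigma_sets UNIV (Collect clopen_corner) \<subseteq> sets borel"
    using sets.sigma_sets_subset[of "Collect clopen_corner" "borel :: 'a inf_matrix measure"] by simp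
  define N where "N = sigma (UNIV :: 'a inf_matrix set) (Collect clopen_corner)"
  have N: "space N = UNIV" "sets N = sigma_sets UNIV (Collect clopen_corner)" by (simp_all add: N_def)
  have "(\<lambda>M. M) \<in> N \<rightarrow>\<^sub>M borel"
  proof (rule borel_measurable_inf_matrixI, rule borel_measurableI)
    fix i j and S :: "'a set" assume S: "open S"
    define \<C> where "\<C> = {cball x r |x r. 0 < r \<and> cball x r \<subseteq> S}"
    have "\<Union>\<C> = S"
    proof
      show "S \<subseteq> \<Union>\<C>"
      proof
        fix x assume "x \<in> S"
        then obtain r where "0 < r" "cball x r \<subseteq> S" using S by (auto simp: open_contains_cball)
        then show "x \<in> \<Union>\<C>" by (auto simp: \<C>_def intro!: exI[of _ "cball x r"])
      qed
    qed (auto simp: \<C>_def)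
    moreover have "open U" if "U \<in> \<C>" for U using that open_cball_nonarch by (auto simp: \<C>_def)
    ultimately obtain \<D> where \<D>: "\<D> \<subseteq> \<C>" "countable \<D>" "\<Union>\<D> = S"
      using Lindelof[of \<C>] by metis
    have "(\<lambda>M. M i j) -` U \<in> sets N" if "U \<in> \<D>" for U
    proof -
      have U: "open U" "closed U" using that \<D>(1) open_cball_nonarch by (auto simp: \<C>_def)
      have "clopen_corner ((\<lambda>M. M i j) -` U)"
        unfolding clopen_corner_def
        using open_vimage[OF U(1) continuous_on_entry[of i j]] closed_vimage[OF U(2) continuous_on_entry[of i j]]
        by (auto intro!: exI[of _ "Suc (max i j)"])
      then show ?thesis unfolding N by (intro sigma_sets.Basic) simp
    qed
    then have "(\<Union>U\<in>\<D>. (\<lambda>M. M i j) -` U) \<in> sets N"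
      using \<D>(2) by (intro sets.countable_UN') auto
    moreover have "(\<Union>U\<in>\<D>. (\<lambda>M. M i j) -` U) = (\<lambda>M. M i j) -` S \<inter> space N"
      using \<D>(3) N(1) by auto
    ultimately show "(\<lambda>M. M i j) -` S \<inter> space N \<in> sets N" by simp
  qed
  from measurable_sets[OF this] show "sets borel \<subseteq> sigma_sets UNIV (Collect clopen_corner)"
    using N by auto
qed

lemma borel_probs_eqI:
  fixes \<mu> \<nu> :: "'a inf_matrix measure"
  assumes \<mu>: "\<mu> \<in> borel_probs" and \<nu>: "\<nu> \<in> borel_probs"
    and eq: "\<And>m f. corner_fun m f \<Longrightarrow> continuous_on UNIV f \<Longrightarrow> bounded (range f) \<Longrightarrow> (\<integral>M. f M \<partial>\<mu>) = (\<integral>M. f M \<partial>\<nu>)"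
  shows "\<mu> = \<nu>"
proof (rule measure_eqI_generator_eq[of "Collect clopen_corner" UNIV])
  interpret \<mu>: prob_space \<mu> using \<mu> by (simp add: borel_probs_def)
  interpret \<nu>: prob_space \<nu> using \<nu> by (simp add: borel_probs_def)
  have s: "sets \<mu> = sets borel" "sets \<nu> = sets borel" using \<mu> \<nu> by (auto simp: borel_probs_def)
  have sp: "space \<mu> = UNIV" "space \<nu> = UNIV" using s[THEN sets_eq_imp_space_eq] by auto
  show "Int_stable (Collect clopen_corner)" by (auto simp: Int_stable_def clopen_corner_Int)
  show "sets \<mu> = sigma_sets UNIV (Collect clopen_corner)" "sets \<nu> = sigma_sets UNIV (Collect clopen_corner)"
    using s sets_borel_clopen_corner by auto
  show "range (\<lambda>_::nat. UNIV) \<subseteq> Collect clopen_corner" by (auto simp: clopen_corner_def)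
  show "emeasure \<mu> UNIV \<noteq> \<infinity>" by simp
  fix A assume "A \<in> Collect clopen_corner"
  then have A: "open A" "closed A" and "\<exists>m. \<forall>M M'. (\<forall>i<m. \<forall>j<m. M i j = M' i j) \<longrightarrow> (M \<in> A \<longleftrightarrow> M' \<in> A)"
    by (auto simp: clopen_corner_def)
  then obtain m where m: "\<And>M M'. (\<forall>i<m. \<forall>j<m. M i j = M' i j) \<Longrightarrow> (M \<in> A \<longleftrightarrow> M' \<in> A)" by blast
  let ?f = "\<lambda>M. of_bool (M \<in> A) :: real"
  have cont: "continuous_on UNIV ?f" by (rule continuous_on_of_bool_clopen[OF A])
  have "corner_fun m ?f"
    unfolding corner_fun_def using m borel_measurable_continuous_onI[OF cont] by auto
  moreover have "bounded (range ?f)" by (auto simp: bounded_iff intro!: exI[of _ 1])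
  ultimately have "(\<integral>M. ?f M \<partial>\<mu>) = (\<integral>M. ?f M \<partial>\<nu>)" using cont by (intro eq)
  then have "measure \<mu> A = measure \<nu> A"
    using integral_of_bool[of \<mu> "\<lambda>M. M \<in> A"] integral_of_bool[of \<nu> "\<lambda>M. M \<in> A"] A s sp by simp
  then show "emeasure \<mu> A = emeasure \<nu> A"
    by (simp add: \<mu>.emeasure_eq_measure \<nu>.emeasure_eq_measure)
qed auto

lemma closed_Delta: "closed Delta"
proof -
  have "closed (\<Inter>n. {k :: nat \<Rightarrow> int_minf. k (Suc n) \<le> k n})"
    by (intro closed_INT ballI closed_Collect_le continuous_on_product_coordinates)
  moreover have "(\<Inter>n. {k :: nat \<Rightarrow> int_minf. k (Suc n) \<le> k n}) = Delta"
    by (auto simp: Delta_def decseq_Suc_iff)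
  ultimately show ?thesis by simp
qed

lemma closed_Delta_le: "closed {k \<in> Delta. k 0 \<le> Fin l}"
proof -
  have "closed {k :: nat \<Rightarrow> int_minf. k 0 \<le> Fin l}"
    by (intro closed_Collect_le continuous_on_product_coordinates continuous_on_const)
  then have "closed (Delta \<inter> {k. k 0 \<le> Fin l})" using closed_Delta by (rule closed_Int[rotated])
  moreover have "Delta \<inter> {k. k 0 \<le> Fin l} = {k \<in> Delta. k 0 \<le> Fin l}" by auto
  ultimately show ?thesis by simp
qed

lemma compact_Delta_le: "compact {k \<in> Delta. k 0 \<le> Fin l}"
proof -
  have "compact {k :: nat \<Rightarrow> int_minf. \<forall>n. k n \<in> {..Fin l}}"
    by (rule compact_Pi_UNIV) (rule compact_atMost_Fin)
  moreover have "{k \<in> Delta. k 0 \<le> Fin l} = {k. \<forall>n. k n \<in> {..Fin l}} \<inter> Delta"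
  proof -
    have "k n \<le> Fin l" if "decseq k" "k 0 \<le> Fin l" for k :: "nat \<Rightarrow> int_minf" and n
      using decseqD[OF that(1), of 0 n] that(2) by simp
    then show ?thesis by (auto simp: Delta_def)
  qed
  ultimately show ?thesis by (simp add: compact_Int_closed closed_Delta)
qed

lemma corner_fun_phi_fun: "corner_fun 1 (\<lambda>M. phi_fun l (M 0 0))"
  unfolding corner_fun_def by auto

text \<open>\<open>phi_fun l x\<close> is eventually \<open>1\<close> as \<open>l\<close> grows, so
  dominated convergence sends \<open>phi \<mu> l\<close> to \<open>1\<close>.\<close>

lemma phi_gt_half:
  assumes \<mu>: "\<mu> \<in> borel_probs"
  shows "\<exists>l. 1 / 2 < phi \<mu> l"
proof -
  interpret \<mu>: prob_space \<mu> using \<mu> by (simp add: borel_probs_def)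
  have s[measurable_cong]: "sets \<mu> = sets borel" using \<mu> by (simp add: borel_probs_def)
  have "(\<lambda>n. phi_fun (int n) x) \<longlonglongrightarrow> 1" for x
  proof -
    obtain n0 where n0: "abs_val x \<le> q ^ n0"
      using real_arch_pow[OF q_gt_1, of "abs_val x"] by (auto intro: less_imp_le)
    have "phi_fun (int n) x = 1" if "n \<ge> n0" for n
    proof (rule phi_fun_eq_1)
      have "q ^ n0 \<le> q ^ n" using q_gt_1 that by (intro power_increasing) auto
      then show "abs_val x \<le> q powi int n" using n0 by simp
    qed
    then show ?thesis by (intro tendsto_eventually eventually_sequentiallyI[of n0])
  qed
  then have "(\<lambda>n. phi \<mu> (int n)) \<longlonglongrightarrow> (\<integral>M. 1 \<partial>\<mu>)"
    unfolding phi_def using abs_phi_fun_le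
    by (intro integral_dominated_convergence[where w="\<lambda>_. 1"]) auto
  then have "\<forall>\<^sub>F n in sequentially. 1 / 2 < phi \<mu> (int n)"
    by (intro order_tendstoD(1)[where y="\<integral>M. 1 \<partial>\<mu>"]) (auto simp: \<mu>.prob_space)
  then show ?thesis by (auto simp: eventually_sequentially)
qed

text \<open>Each test function and tolerance cut out a closed subset of the compact set
  \<open>C\<close> of parameters, and \<open>ex_mu_close\<close> shows that finitely many of them
  meet. A parameter common to all of them gives every test function the same integral as
  \<open>\<mu>\<close>.\<close>

lemma P_erg_eq_mu:
  assumes \<mu>: "\<mu> \<in> P_erg"
  shows "\<exists>k\<in>Delta. mu \<pi> k = \<mu>"
proof -
  have bp: "\<mu> \<in> borel_probs" using \<mu> by (simp add: P_erg_def)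
  obtain l where l: "1 / 2 < phi \<mu> l" using phi_gt_half[OF bp] by blast
  define C where "C = {k \<in> Delta. k 0 \<le> Fin l}"
  have C: "compact C" unfolding C_def by (rule compact_Delta_le)
  define T where "T f e = {k \<in> C. \<bar>(\<integral>M. f M \<partial>mu \<pi> k) - (\<integral>M. f M \<partial>\<mu>)\<bar> \<le> e}" for f and e :: real
  define I where "I = {(f, e :: real). (\<exists>m. corner_fun m f) \<and> continuous_on UNIV f \<and> bounded (range f) \<and> 0 < e}"
  have "C \<inter> (\<Inter>p\<in>I. T (fst p) (snd p)) \<noteq> {}"
  proof (rule compact_imp_fip_image[OF C])
    fix p assume "p \<in> I"
    then have f: "continuous_on UNIV (fst p)" "bounded (range (fst p))" by (auto simp: I_def)
    have "continuous_on C (\<lambda>k. \<integral>M. fst p M \<partial>mu \<pi> k)"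
      by (rule continuous_on_subset[OF continuous_on_integral_mu[OF f]]) (auto simp: C_def)
    then have "closed (C \<inter> (\<lambda>k. \<bar>(\<integral>M. fst p M \<partial>mu \<pi> k) - (\<integral>M. fst p M \<partial>\<mu>)\<bar>) -` {..snd p})"
      by (intro continuous_closed_preimage continuous_intros closed_Delta_le[of l, folded C_def]) auto
    moreover have "C \<inter> (\<lambda>k. \<bar>(\<integral>M. fst p M \<partial>mu \<pi> k) - (\<integral>M. fst p M \<partial>\<mu>)\<bar>) -` {..snd p} = T (fst p) (snd p)"
      by (auto simp: T_def)
    ultimately show "closed (T (fst p) (snd p))" by simp
  next
    fix I' assume I': "finite I'" "I' \<subseteq> I"
    \<comment> \<open>The additional tolerance keeps \<open>phi (mu \<pi> k) l\<close> above
      \<open>1 / 2\<close> for the parameter found below, which places it in \<open>C\<close>. It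
      also makes the minimum meaningful when \<open>I'\<close> is empty.\<close>
    define e where "e = Min (insert (phi \<mu> l - 1 / 2) (snd ` I'))"
    have "0 < e" unfolding e_def using I' l by (subst Min_gr_iff) (auto simp: I_def)
    have e_le: "e \<le> phi \<mu> l - 1 / 2" "p \<in> I' \<Longrightarrow> e \<le> snd p" for p
      unfolding e_def using I'(1) by (auto intro!: Min_le)
    let ?g = "\<lambda>M. phi_fun l (M 0 0)"
    have "\<exists>k\<in>Delta. \<forall>f\<in>insert ?g (fst ` I'). \<bar>(\<integral>M. f M \<partial>mu \<pi> k) - (\<integral>M. f M \<partial>\<mu>)\<bar> < e"
    proof (rule ex_mu_close[OF \<mu> _ _ _ \<open>0 < e\<close>])
      show "finite (insert ?g (fst ` I'))" using I'(1) by simp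
      show "\<exists>m. corner_fun m f" if "f \<in> insert ?g (fst ` I')" for f
        using that I'(2) corner_fun_phi_fun by (auto simp: I_def)
      have "bounded (range ?g)" using abs_phi_fun_le by (auto simp: bounded_iff)
      then show "bounded (range f)" if "f \<in> insert ?g (fst ` I')" for f
        using that I'(2) by (auto simp: I_def)
    qed
    then obtain k where k: "k \<in> Delta" "\<bar>phi (mu \<pi> k) l - phi \<mu> l\<bar> < e"
      "\<And>p. p \<in> I' \<Longrightarrow> \<bar>(\<integral>M. fst p M \<partial>mu \<pi> k) - (\<integral>M. fst p M \<partial>\<mu>)\<bar> < e"
      unfolding phi_def by auto
    have "1 / 2 < phi (mu \<pi> k) l" using k(2) e_le(1) by linarith
    then have "k 0 \<le> Fin l" using k(1) by (intro first_le_of_phi) (auto simp: Delta_def)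
    then have "k \<in> C" using k(1) by (simp add: C_def)
    moreover have "k \<in> T (fst p) (snd p)" if "p \<in> I'" for p
      using k(3)[OF that] e_le(2)[OF that] \<open>k \<in> C\<close> by (simp add: T_def)
    ultimately show "C \<inter> (\<Inter>p\<in>I'. T (fst p) (snd p)) \<noteq> {}" by blast
  qed
  then obtain k where k: "k \<in> C" "\<And>p. p \<in> I \<Longrightarrow> k \<in> T (fst p) (snd p)" by blast
  have dec: "k \<in> Delta" using k(1) by (simp add: C_def)
  have "mu \<pi> k = \<mu>"
  proof (rule borel_probs_eqI[OF _ bp])
    show "mu \<pi> k \<in> borel_probs" using dec by (intro mu_borel_probs) (simp add: Delta_def)
    fix m f assume f: "corner_fun m f" "continuous_on UNIV f" "bounded (range f)"
    have "\<bar>(\<integral>M. f M \<partial>mu \<pi> k) - (\<integral>M. f M \<partial>\<mu>)\<bar> \<le> 0 + e" if "0 < e" for e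
      using k(2)[of "(f, e)"] f that by (auto simp: I_def T_def)
    then have "\<bar>(\<integral>M. f M \<partial>mu \<pi> k) - (\<integral>M. f M \<partial>\<mu>)\<bar> \<le> 0" by (rule field_le_epsilon)
    then show "(\<integral>M. f M \<partial>mu \<pi> k) = (\<integral>M. f M \<partial>\<mu>)" by simp
  qed
  then show ?thesis using dec by blast
qed

lemma mu_image: "mu \<pi> ` Delta = P_erg"
  using mu_P_erg P_erg_eq_mu by (fastforce simp: Delta_def)

lemma homeomorphic_map_mu:
  "homeomorphic_map (top_of_set Delta) (subtopology weak_topology P_erg) (mu \<pi>)"
proof (rule homeomorphic_maps_imp_map)
  let ?g = "inv_into Delta (mu \<pi>)"
  have g: "?g (mu \<pi> k) = k" if "k \<in> Delta" for k using inj_on_mu that by simp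
  have "continuous_map (top_of_set Delta) (subtopology weak_topology P_erg) (mu \<pi>)"
    using continuous_map_mu mu_image by (auto simp: continuous_map_in_subtopology)
  moreover have "continuous_map (subtopology weak_topology P_erg) (top_of_set Delta) ?g"
    by (rule continuous_map_mu_inverse[OF _ g]) (simp add: mu_image)
  ultimately show "homeomorphic_maps (top_of_set Delta) (subtopology weak_topology P_erg) (mu \<pi>) ?g"
    using g by (auto simp: homeomorphic_maps_def simp flip: mu_image)
qed

end

theorem theorem1p2:
  fixes \<pi> :: "'a::nonarch_local_field"
  assumes "uniformizer \<pi>"
    and "abs_val \<pi> = 1 / real (residue_card \<pi>)"
  shows "homeomorphic_map (top_of_set Delta) (subtopology weak_topology P_erg) (mu \<pi>)"
proof -
  interpret uniformized_field \<pi> by standard fact+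
  show ?thesis by (rule homeomorphic_map_mu)
qed

end
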